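(* Let $\mathbb{E}$ be any rearrangement invariant Banach function space over $(\mathbb{R}_+,dt)$ with Boyd indices $p_{\mathbb{E}},q_{\mathbb{E}}\in(1,\infty)$. Then, for every weight $w\in A^+_{p_{\mathbb{E}}}(\mathbb{R}_+)$ the operator $M^+_+$ is bounded on $\mathbb{E}_w$, and for every weight $w\in A^-_{p_{\mathbb{E}}}(\mathbb{R}_+)$ the operator $M^-_+$ is bounded on $\mathbb{E}_w$.
   Context: $\mathbb{R}_+=[0,\infty)$. Rearrangement invariant Banach function spaces are understood in the sense of Bennett–Sharpley. With $D_tf(s)=f(s/t)$ and $h_{\mathbb{E}}(t)=\|D_t\|_{\mathcal{L}(\mathbb{E})}$ ($t>0$), the Boyd indices are $p_{\mathbb{E}}=\lim_{t\to\infty}\frac{\log t}{\log h_{\mathbb{E}}(t)}$ and $q_{\mathbb{E}}=\lim_{t\to0+}\frac{\log t}{\log h_{\mathbb{E}}(t)}$. A weight on $\mathbb{R}_+$ is a measurable $w:\mathbb{R}_+\to[0,\infty)$ with $w>0$ a.e. For a weight $w$ locally integrable on $(0,\infty)$, $\mathbb{E}_w$ is the space of measurable $f$ on $\mathbb{R}_+$ with $\|f\|_{\mathbb{E}_w}:=\|f_w^*\|_{\mathbb{E}}<\infty$, where $f_w^*$ is the decreasing rearrangement of $|f|$ with respect to the measure $w\,dt$. For $p\in(1,\infty)$, $p'=p/(p-1)$: $w\in A_p^+(\mathbb{R}_+)$ if $\sup_{0\le a<b<c}\frac1{(c-a)^p}\int_a^bw\,dt\big(\int_b^cw^{1-p'}dt\big)^{p-1}<\infty$;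 $w\in A_p^-(\mathbb{R}_+)$ if $\sup_{0\le a<b<c}\frac1{(c-a)^p}\int_b^cw\,dt\big(\int_a^bw^{1-p'}dt\big)^{p-1}<\infty$. Such weights are locally integrable on $(0,\infty)$. For measurable $f$ on $\mathbb{R}_+$, extended by $0$ to $\mathbb{R}$, and $t\in\mathbb{R}_+$: $M^+_+f(t)=\sup_{h>0}\frac1h\int_t^{t+h}|f|\,ds$ and $M^-_+f(t)=\sup_{h>0}\frac1h\int_{t-h}^t|f|\,ds$. *)

theory Defs
  imports "HOL-Analysis.Analysis"
begin

section \<open>Rearrangement invariant Banach function spaces\<close>

text \<open>
  The axioms (P1)--(P5) of Bennett and Sharpley.  A function norm acts on nonnegative, extended
  real-valued measurable functions; its values on non-measurable functions are left unspecified.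
\<close>

locale banach_function_norm =
  fixes M :: "'a measure" and \<rho> :: "('a \<Rightarrow> ennreal) \<Rightarrow> ennreal"
  assumes norm_eq_0_iff:
      "f \<in> borel_measurable M \<Longrightarrow> \<rho> f = 0 \<longleftrightarrow> (AE x in M. f x = 0)"
    and norm_scale:
      "f \<in> borel_measurable M \<Longrightarrow> 0 \<le> a \<Longrightarrow> \<rho> (\<lambda>x. ennreal a * f x) = ennreal a * \<rho> f"
    and norm_triangle:
      "f \<in> borel_measurable M \<Longrightarrow> g \<in> borel_measurable M \<Longrightarrow> \<rho> (\<lambda>x. f x + g x) \<le> \<rho> f + \<rho> g"
    and norm_mono:
      "f \<in> borel_measurable M \<Longrightarrow> g \<in> borel_measurable M \<Longrightarrow> (AE x in M. g x \<le> f x) \<Longrightarrow> \<rho> g \<le> \<rho> f"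
    and norm_Fatou:
      "(\<And>n. F n \<in> borel_measurable M) \<Longrightarrow> f \<in> borel_measurable M \<Longrightarrow>
        (AE x in M. incseq (\<lambda>n. F n x) \<and> (\<lambda>n. F n x) \<longlonglongrightarrow> f x) \<Longrightarrow>
        (\<lambda>n::nat. \<rho> (F n)) \<longlonglongrightarrow> \<rho> f"
    and norm_indicator:
      "A \<in> sets M \<Longrightarrow> emeasure M A < \<infinity> \<Longrightarrow> \<rho> (indicator A) < \<infinity>"
    and norm_integral:
      "A \<in> sets M \<Longrightarrow> emeasure M A < \<infinity> \<Longrightarrow>
        \<exists>C>0. \<forall>f\<in>borel_measurable M. (\<integral>\<^sup>+x\<in>A. f x \<partial>M) \<le> ennreal C * \<rho> f"

definition distribution_fun :: "'a measure \<Rightarrow> ('a \<Rightarrow> ennreal) \<Rightarrow> ennreal \<Rightarrow> ennreal" where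
  "distribution_fun M f s = emeasure M {x \<in> space M. s < f x}"

text \<open>
  As in Bennett and Sharpley, rearrangement invariance is only demanded of equimeasurable functions
  that are finite almost everywhere.
\<close>

locale rearrangement_invariant_norm = banach_function_norm +
  assumes norm_equimeasurable:
    "f \<in> borel_measurable M \<Longrightarrow> g \<in> borel_measurable M \<Longrightarrow>
      (AE x in M. f x < \<infinity>) \<Longrightarrow> (AE x in M. g x < \<infinity>) \<Longrightarrow>
      (\<And>s::real. 0 \<le> s \<Longrightarrow> distribution_fun M f (ennreal s) = distribution_fun M g (ennreal s)) \<Longrightarrow>
      \<rho> f = \<rho> g"

text \<open>
  The half-line \<open>[0,\<infinity>)\<close> with Lebesgue measure.  Functions on it are represented by functions on
  \<open>real\<close>; their values at negative arguments play no role.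
\<close>

abbreviation halfline :: "real measure" where
  "halfline \<equiv> lebesgue_on {0..}"

definition bfs_norm :: "((real \<Rightarrow> ennreal) \<Rightarrow> ennreal) \<Rightarrow> (real \<Rightarrow> complex) \<Rightarrow> ennreal" where
  "bfs_norm \<rho> f = \<rho> (\<lambda>t. ennreal (norm (f t)))"

definition bfs :: "((real \<Rightarrow> ennreal) \<Rightarrow> ennreal) \<Rightarrow> (real \<Rightarrow> complex) set" where
  "bfs \<rho> = {f \<in> borel_measurable halfline. bfs_norm \<rho> f < \<infinity>}"


section \<open>Boyd indices\<close>

text \<open>The operator norm of the dilation \<open>(D\<^sub>t f)(s) = f (s / t)\<close> on the space given by \<open>\<rho>\<close>.\<close>

definition dilation_norm :: "((real \<Rightarrow> ennreal) \<Rightarrow> ennreal) \<Rightarrow> real \<Rightarrow> ennreal" where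
  "dilation_norm \<rho> t = (SUP f\<in>{f \<in> bfs \<rho>. bfs_norm \<rho> f \<le> 1}. bfs_norm \<rho> (\<lambda>s. f (s / t)))"

text \<open>
  Boyd indices as relations, for finite values of the index.  On a rearrangement invariant space
  the dilation norm is a positive real number, so \<^const>\<open>enn2real\<close> loses nothing.  If
  its logarithm vanishes at points tending to the limit point, then the index is \<open>\<infinity>\<close>, whereas the
  quotient below is \<open>0\<close> at these points; either way there is no index in \<open>(1,\<infinity>)\<close>.
\<close>

definition has_lower_boyd_index :: "((real \<Rightarrow> ennreal) \<Rightarrow> ennreal) \<Rightarrow> real \<Rightarrow> bool" where
  "has_lower_boyd_index \<rho> p \<longleftrightarrow>
    ((\<lambda>t. ln t / ln (enn2real (dilation_norm \<rho> t))) \<longlongrightarrow> p) at_top"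

definition has_upper_boyd_index :: "((real \<Rightarrow> ennreal) \<Rightarrow> ennreal) \<Rightarrow> real \<Rightarrow> bool" where
  "has_upper_boyd_index \<rho> q \<longleftrightarrow>
    ((\<lambda>t. ln t / ln (enn2real (dilation_norm \<rho> t))) \<longlongrightarrow> q) (at_right 0)"


section \<open>Weights and weighted spaces\<close>

definition weight :: "(real \<Rightarrow> real) \<Rightarrow> bool" where
  "weight w \<longleftrightarrow> w \<in> borel_measurable halfline \<and> (\<forall>t\<ge>0. 0 \<le> w t) \<and> (AE t in halfline. 0 < w t)"

text \<open>Powers with a positive real exponent on \<open>[0,\<infinity>]\<close>.\<close>

definition ennreal_powr :: "ennreal \<Rightarrow> real \<Rightarrow> ennreal" where
  "ennreal_powr x r = (if x = \<infinity> then \<infinity> else ennreal (enn2real x powr r))"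

definition conj_exponent :: "real \<Rightarrow> real" where
  "conj_exponent p = p / (p - 1)"

definition Ap_plus :: "real \<Rightarrow> (real \<Rightarrow> real) set" where
  "Ap_plus p = {w. weight w \<and>
    (SUP (a, b, c)\<in>{(a, b, c). 0 \<le> a \<and> a < b \<and> b < c}.
        ennreal (1 / (c - a) powr p)
        * (\<integral>\<^sup>+t\<in>{a..b}. ennreal (w t) \<partial>halfline)
        * ennreal_powr (\<integral>\<^sup>+t\<in>{b..c}. ennreal (w t powr (1 - conj_exponent p)) \<partial>halfline) (p - 1)) < \<infinity>}"

definition Ap_minus :: "real \<Rightarrow> (real \<Rightarrow> real) set" where
  "Ap_minus p = {w. weight w \<and>
    (SUP (a, b, c)\<in>{(a, b, c). 0 \<le> a \<and> a < b \<and> b < c}.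
        ennreal (1 / (c - a) powr p)
        * (\<integral>\<^sup>+t\<in>{b..c}. ennreal (w t) \<partial>halfline)
        * ennreal_powr (\<integral>\<^sup>+t\<in>{a..b}. ennreal (w t powr (1 - conj_exponent p)) \<partial>halfline) (p - 1)) < \<infinity>}"

definition weighted_measure :: "(real \<Rightarrow> real) \<Rightarrow> real measure" where
  "weighted_measure w = density halfline (\<lambda>t. ennreal (w t))"

definition decreasing_rearrangement :: "'a measure \<Rightarrow> ('a \<Rightarrow> ennreal) \<Rightarrow> real \<Rightarrow> ennreal" where
  "decreasing_rearrangement M f t = Inf {s. distribution_fun M f s \<le> ennreal t}"

text \<open>
  The weighted norm is defined on moduli, since the maximal functions below take values in
  \<open>[0,\<infinity>]\<close>.
\<close>

definition weighted_norm ::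
    "((real \<Rightarrow> ennreal) \<Rightarrow> ennreal) \<Rightarrow> (real \<Rightarrow> real) \<Rightarrow> (real \<Rightarrow> ennreal) \<Rightarrow> ennreal" where
  "weighted_norm \<rho> w g = \<rho> (decreasing_rearrangement (weighted_measure w) g)"

definition weighted_space ::
    "((real \<Rightarrow> ennreal) \<Rightarrow> ennreal) \<Rightarrow> (real \<Rightarrow> real) \<Rightarrow> (real \<Rightarrow> complex) set" where
  "weighted_space \<rho> w =
    {f \<in> borel_measurable halfline. weighted_norm \<rho> w (\<lambda>t. ennreal (norm (f t))) < \<infinity>}"

text \<open>
  Boundedness of an operator with values in the \<open>[0,\<infinity>]\<close>-valued functions: every image is
  measurable and finite almost everywhere, hence a member of the weighted space up to a null set,
  and the norm inequality holds.
\<close>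

definition bounded_on_weighted_space ::
    "((real \<Rightarrow> ennreal) \<Rightarrow> ennreal) \<Rightarrow> (real \<Rightarrow> real) \<Rightarrow> ((real \<Rightarrow> complex) \<Rightarrow> real \<Rightarrow> ennreal) \<Rightarrow> bool" where
  "bounded_on_weighted_space \<rho> w T \<longleftrightarrow>
    (\<exists>C::real. 0 \<le> C \<and> (\<forall>f\<in>weighted_space \<rho> w.
        T f \<in> borel_measurable halfline \<and> (AE t in halfline. T f t < \<infinity>) \<and>
        weighted_norm \<rho> w (T f) \<le> ennreal C * weighted_norm \<rho> w (\<lambda>t. ennreal (norm (f t)))))"


section \<open>One-sided maximal operators\<close>

text \<open>Integrating over the half-line measure amounts to extending \<open>f\<close> by \<open>0\<close> to negative arguments.\<close>

definition maximal_plus :: "(real \<Rightarrow> complex) \<Rightarrow> real \<Rightarrow> ennreal" where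
  "maximal_plus f t =
    (SUP h\<in>{0<..}. ennreal (1 / h) * (\<integral>\<^sup>+s\<in>{t..t + h}. ennreal (norm (f s)) \<partial>halfline))"

definition maximal_minus :: "(real \<Rightarrow> complex) \<Rightarrow> real \<Rightarrow> ennreal" where
  "maximal_minus f t =
    (SUP h\<in>{0<..}. ennreal (1 / h) * (\<integral>\<^sup>+s\<in>{t - h..t}. ennreal (norm (f s)) \<partial>halfline))"

end

theory Submission
  imports Defs
begin

text \<open>
  Write \<open>w(S)\<close> for the integral of \<open>w\<close> over \<open>S\<close>, \<open>\<sigma> = w\<^bsup>1-p'\<^esup>\<close>, and \<open>M\<close> for the maximal operator over
  intervals to the right.  The heart of the matter is a weak type inequality for characteristic
  functions, \<open>w {M \<chi>\<^sub>E > \<theta>} \<le> C \<theta>\<^bsup>-r\<^esup> w(E)\<close>, with some \<open>r < p\<close>.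

  Given this, a function \<open>f\<close> is cut at the heights \<open>f\<^sup>*(t / 2\<^sup>k)\<close> of its rearrangement with respect to
  \<open>w dt\<close>.  The sets \<open>E\<^sub>k = {|f| > f\<^sup>*(t / 2\<^sup>k)}\<close> satisfy \<open>w(E\<^sub>k) \<le> t / 2\<^sup>k\<close>, and applying the inequality to
  each of them shows that \<open>(M f)\<^sup>*(t)\<close> is at most \<open>f\<^sup>*(t) + A \<Sum>\<^sub>k 2\<^bsup>-uk\<^esup> f\<^sup>*(t / 2\<^bsup>k+1\<^esup>)\<close> whenever \<open>u < 1/r\<close>
  (\<open>rearrangement_maximal_le\<close>).  The summands are dilations of \<open>f\<^sup>*\<close>, whose norms grow at most like
  \<open>2\<^bsup>vk\<^esup>\<close> for each \<open>v > 1/p\<close> by the definition of the lower Boyd index.  With \<open>1/p < v < u < 1/r\<close> the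
  series converges in norm (\<open>norm_dilation_series_le\<close>).

  The exponent \<open>r < p\<close> is obtained without a reverse Hoelder inequality.  Hoelder's inequality and the
  \<open>A\<^sub>p\<^sup>+\<close> condition give \<open>w(a,b) |E|\<^sup>p \<le> C w(E) (c - a)\<^sup>p\<close> for \<open>E \<subseteq> (b,c)\<close>, and a dual inequality in which
  \<open>\<sigma>(b,c)\<close> is bounded by \<open>\<sigma>\<close> of a large subset of \<open>(a,b)\<close>.  Let \<open>F = {M \<chi>\<^sub>E > 1/2}\<close>.  On each component
  of \<open>F\<close> the rising sun lemma makes the complement of \<open>E\<close> dense to the left, and by the dual
  inequality \<open>F - E\<close> carries a fixed proportion of \<open>\<sigma>(F)\<close>; so \<open>\<sigma>(E) \<le> (1 - 1/D) \<sigma>(F)\<close>.  Iterating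
  \<open>E \<mapsto> F\<close> shows that \<open>\<sigma>(E)\<close> is at most a constant times a power of \<open>|E|\<close> (\<open>measure_N_decay\<close>), and this improves the
  first inequality to an exponent \<open>r < p\<close> (\<open>density_le_power_gain\<close>).  Summing it over a
  suitable partition of each component of \<open>{M \<chi>\<^sub>E > \<theta>}\<close> proves the weak type inequality
  (\<open>emeasure_le_by_halving_right\<close>, \<open>restricted_weak_type_open\<close>).

  These estimates are local, for a weight on an arbitrary open interval.  The operator over intervals to
  the left on \<open>[0,\<infinity>)\<close> is the reflection of \<open>M\<close> on the negative half-line.
\<close>

section \<open>Lebesgue measure and open subsets of the line\<close>

lemma measurable_uminus_lebesgue: "uminus \<in> (lebesgue :: real measure) \<rightarrow>\<^sub>M lebesgue"
  using lebesgue_measurable_scaling[of "-1::real"]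
  by (simp add: scaleR_minus1_left[abs_def] cong: measurable_cong)

lemma lebesgue_distr_uminus: "distr lebesgue lebesgue uminus = (lebesgue :: real measure)"
  using lebesgue_real_scale[of "-1::real"] by (simp add: density_1 cong: distr_cong)

lemma vimage_uminus_sets_lebesgue:
  "S \<in> sets lebesgue \<Longrightarrow> uminus -` S \<in> sets (lebesgue :: real measure)"
  using measurable_sets[OF measurable_uminus_lebesgue, of S] by simp

lemma emeasure_lebesgue_uminus:
  assumes "S \<in> sets lebesgue"
  shows "emeasure lebesgue (uminus -` S) = emeasure lebesgue (S :: real set)"
  using emeasure_distr[OF measurable_uminus_lebesgue assms] lebesgue_distr_uminus by simp

lemma measure_lebesgue_uminus:
  assumes "S \<in> sets lebesgue"
  shows "measure lebesgue (uminus -` S) = measure lebesgue (S :: real set)"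
  using emeasure_lebesgue_uminus[OF assms] by (simp add: measure_def)

lemma nn_integral_lebesgue_uminus:
  fixes f :: "real \<Rightarrow> ennreal"
  assumes "f \<in> borel_measurable lebesgue"
  shows "(\<integral>\<^sup>+t. f (- t) \<partial>lebesgue) = (\<integral>\<^sup>+t. f t \<partial>lebesgue)"
  using nn_integral_distr[OF measurable_uminus_lebesgue, of f] assms lebesgue_distr_uminus by simp

lemma lmeasurable_subset_interval: "S \<in> sets lebesgue \<Longrightarrow> S \<subseteq> {b<..<c} \<Longrightarrow> S \<in> lmeasurable" for b c :: real
  by (rule fmeasurableI2[of "{b<..<c}"]) (simp_all add: lmeasurable_interval)

lemma measure_lebesgue_cong_finite:
  assumes "S \<in> lmeasurable" "finite X" "S - T \<union> (T - S) \<subseteq> X"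
  shows "measure lebesgue T = measure lebesgue (S :: real set)"
  by (rule measure_negligible_symdiff[OF assms(1)]) (use assms negligible_finite negligible_subset in blast)

lemma open_connected_bounded_real:
  fixes C :: "real set"
  assumes "open C" "connected C" "bounded C" "C \<noteq> {}"
  obtains a b where "a < b" "C = {a<..<b}"
proof -
  have bb: "bdd_below C" "bdd_above C"
    using assms(3) by (auto simp: bounded_imp_bdd_above bounded_imp_bdd_below)
  have 1: "Inf C < x" "x < Sup C" if x: "x \<in> C" for x
  proof -
    obtain e where e: "e > 0" "ball x e \<subseteq> C"
      by (rule openE[OF assms(1) x])
    moreover have "x - e/2 \<in> ball x e" "x + e/2 \<in> ball x e"
      using \<open>e > 0\<close> by (simp_all add: dist_real_def)
    ultimately have "x - e/2 \<in> C" "x + e/2 \<in> C" by blast+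
    then have "Inf C \<le> x - e/2" "x + e/2 \<le> Sup C"
      using bb by (auto intro: cInf_lower cSup_upper)
    with \<open>e > 0\<close> show "Inf C < x" "x < Sup C" by auto
  qed
  have 2: "x \<in> C" if x: "Inf C < x" "x < Sup C" for x
  proof -
    obtain y where "y \<in> C" "y < x" using x(1) assms(4) bb by (meson cInf_lessD)
    moreover obtain z where "z \<in> C" "x < z" using x(2) assms(4) bb by (meson less_cSupD)
    ultimately show ?thesis
      using assms(2) by (meson connectedD_interval less_imp_le)
  qed
  have "C = {Inf C<..<Sup C}" using 1 2 by auto
  moreover have "Inf C < Sup C" using 1 assms(4) by force
  ultimately show ?thesis using that by blast
qed

lemma open_bounded_real_components:
  fixes F :: "real set"
  assumes "open F" "bounded F" "C \<in> components F"
  obtains a b where "a < b" "C = {a<..<b}" "a \<notin> F" "b \<notin> F"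
proof -
  have "open C" using open_components assms by blast
  moreover have "connected C" "C \<noteq> {}" "C \<subseteq> F"
    using assms in_components_connected in_components_nonempty in_components_subset by blast+
  moreover have "bounded C" using assms bounded_subset calculation by blast
  ultimately obtain a b where ab: "a < b" "C = {a<..<b}"
    using open_connected_bounded_real by metis
  have *: "x \<notin> F" if x: "x \<in> {a, b}" for x
  proof
    assume "x \<in> F"
    then obtain e where e: "e > 0" "ball x e \<subseteq> F"
      using openE[OF assms(1)] by blast
    have "C \<inter> ball x e \<noteq> {}"
    proof -
      define d where "d = min e (b - a) / 2"
      have "d > 0" "d < e" "d < b - a" using e ab by (auto simp: d_def min_def)
      then have "a + d \<in> C \<inter> ball a e" "b - d \<in> C \<inter> ball b e"
        using ab by (auto simp: dist_real_def)
      then show ?thesis using x by auto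
    qed
    then have "ball x e \<subseteq> C"
      using components_maximal[OF assms(3) _ e(2)] by auto
    then have "x \<in> C" using e by auto
    then show False using ab x by auto
  qed
  show ?thesis using that[OF ab] * by auto
qed

text \<open>
  An inequality between two measures that holds on every component of a bounded open set holds on
  the whole set.
\<close>

lemma emeasure_le_from_components:
  fixes F :: "real set"
  assumes F: "open F" "bounded F"
    and P: "sets P = sets lebesgue" "X \<in> sets lebesgue" "Y \<in> sets lebesgue"
    and comp: "\<And>a b. a < b \<Longrightarrow> {a<..<b} \<subseteq> F \<Longrightarrow> a \<notin> F \<Longrightarrow> b \<notin> F \<Longrightarrow>
      emeasure P ({a<..<b} \<inter> X) \<le> D * emeasure P ({a<..<b} \<inter> Y)"
  shows "emeasure P (F \<inter> X) \<le> D * emeasure P (F \<inter> Y)"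
proof -
  let ?C = "components F"
  have cnt: "countable ?C"
  proof (rule countable_disjoint_open_subsets)
    show "open S" if "S \<in> ?C" for S using F that open_components by blast
    show "pairwise disjnt ?C"
      using pairwise_disjoint_components[of F] by (simp add: pairwise_def disjnt_def)
  qed
  have op: "C \<in> sets lebesgue" if "C \<in> ?C" for C
    using F that open_components[of F] by (simp add: borel_open)
  have eq: "emeasure P (F \<inter> Z) = (\<integral>\<^sup>+C. emeasure P (C \<inter> Z) \<partial>count_space ?C)"
    if "Z \<in> sets lebesgue" for Z
  proof -
    have "F \<inter> Z = (\<Union>C\<in>?C. C \<inter> Z)" using Union_components[of F] by blast
    moreover have "disjoint_family_on (\<lambda>C. C \<inter> Z) ?C"
      using pairwise_disjoint_components[of F] by (auto simp: disjoint_family_on_def pairwise_def)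
    ultimately show ?thesis
      using emeasure_UN_countable[of ?C "\<lambda>C. C \<inter> Z" P] cnt op that P by auto
  qed
  have "(\<integral>\<^sup>+C. emeasure P (C \<inter> X) \<partial>count_space ?C)
      \<le> (\<integral>\<^sup>+C. D * emeasure P (C \<inter> Y) \<partial>count_space ?C)"
  proof (rule nn_integral_mono)
    fix C assume "C \<in> space (count_space ?C)"
    then have C: "C \<in> ?C" by simp
    obtain a b where ab: "a < b" "C = {a<..<b}" "a \<notin> F" "b \<notin> F"
      by (rule open_bounded_real_components[OF F C])
    moreover have "C \<subseteq> F" using C in_components_subset by blast
    ultimately show "emeasure P (C \<inter> X) \<le> D * emeasure P (C \<inter> Y)"
      using comp[of a b] by simp
  qed
  also have "\<dots> = D * (\<integral>\<^sup>+C. emeasure P (C \<inter> Y) \<partial>count_space ?C)"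
    by (rule nn_integral_cmult) simp
  finally show ?thesis using eq P by simp
qed

section \<open>Rising sun sets\<close>

text \<open>
  The level set \<open>{M\<^sup>+ \<chi>\<^sub>E > \<theta>}\<close> of the one-sided maximal function of a characteristic function.
\<close>

definition sun :: "real \<Rightarrow> real set \<Rightarrow> real set" where
  "sun \<theta> E = {x. \<exists>y>x. \<theta> * (y - x) < measure lebesgue (E \<inter> {x<..<y})}"

lemma measure_Int_greaterThanLessThan:
  fixes E :: "real set"
  assumes E: "E \<in> lmeasurable" and "x \<le> y"
  shows "measure lebesgue (E \<inter> {x<..<y}) =
    measure lebesgue (E \<inter> {..y}) - measure lebesgue (E \<inter> {..x})"
proof -
  have m: "E \<inter> {..x} \<in> lmeasurable" "E \<inter> {..y} \<in> lmeasurable" for x y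
    using E by (auto intro: fmeasurable_Int_fmeasurable)
  have "measure lebesgue (E \<inter> {x<..<y}) = measure lebesgue (E \<inter> {x<..y})"
  proof (rule measure_negligible_symdiff)
    show "negligible ((E \<inter> {x<..y} - E \<inter> {x<..<y}) \<union> (E \<inter> {x<..<y} - E \<inter> {x<..y}))"
      by (rule negligible_subset[of "{y}"]) auto
    show "E \<inter> {x<..y} \<in> lmeasurable"
      using E by (auto intro: fmeasurable_Int_fmeasurable)
  qed
  also have "E \<inter> {x<..y} = E \<inter> {..y} - E \<inter> {..x}" by auto
  also have "measure lebesgue \<dots> = measure lebesgue (E \<inter> {..y}) - measure lebesgue (E \<inter> {..x})"
    using m assms(2) by (intro measurable_measure_Diff) auto
  finally show ?thesis .
qed

lemma measure_Int_atMost_lipschitz: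
  fixes E :: "real set"
  assumes E: "E \<in> lmeasurable" and "x \<le> y"
  shows "measure lebesgue (E \<inter> {..x}) \<le> measure lebesgue (E \<inter> {..y})"
    "measure lebesgue (E \<inter> {..y}) - measure lebesgue (E \<inter> {..x}) \<le> y - x"
proof -
  have "measure lebesgue (E \<inter> {x<..<y}) \<le> measure lebesgue {x<..<y}"
    using E by (intro measure_mono_fmeasurable) auto
  moreover have "0 \<le> measure lebesgue (E \<inter> {x<..<y})" by simp
  ultimately show "measure lebesgue (E \<inter> {..x}) \<le> measure lebesgue (E \<inter> {..y})"
    "measure lebesgue (E \<inter> {..y}) - measure lebesgue (E \<inter> {..x}) \<le> y - x"
    using measure_Int_greaterThanLessThan[OF assms] assms(2) by auto
qed

lemma continuous_measure_Int_atMost: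
  fixes E :: "real set"
  assumes E: "E \<in> lmeasurable"
  shows "continuous_on S (\<lambda>x. measure lebesgue (E \<inter> {..x}))"
proof (rule continuous_onI)
  fix x e :: real assume "e > 0"
  have "dist (measure lebesgue (E \<inter> {..x'})) (measure lebesgue (E \<inter> {..x})) \<le> dist x' x" for x'
    using measure_Int_atMost_lipschitz[OF E, of x x'] measure_Int_atMost_lipschitz[OF E, of x' x]
    by (cases "x \<le> x'") (auto simp: dist_real_def)
  then show "\<exists>d>0. \<forall>x'\<in>S. dist x' x < d \<longrightarrow>
      dist (measure lebesgue (E \<inter> {..x'})) (measure lebesgue (E \<inter> {..x})) \<le> e"
    using \<open>e > 0\<close> by (meson less_imp_le order_trans)
qed

lemma sun_iff:
  assumes E: "E \<in> lmeasurable"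
  shows "x \<in> sun \<theta> E \<longleftrightarrow>
    (\<exists>y>x. measure lebesgue (E \<inter> {..x}) - \<theta> * x < measure lebesgue (E \<inter> {..y}) - \<theta> * y)"
proof -
  have "\<theta> * (y - x) < measure lebesgue (E \<inter> {x<..<y}) \<longleftrightarrow>
    measure lebesgue (E \<inter> {..x}) - \<theta> * x < measure lebesgue (E \<inter> {..y}) - \<theta> * y" if "x < y" for y
    using measure_Int_greaterThanLessThan[OF E, of x y] that by (simp add: algebra_simps) linarith
  then show ?thesis by (auto simp: sun_def)
qed

lemma open_sun:
  assumes E: "E \<in> lmeasurable"
  shows "open (sun \<theta> E)"
proof -
  define \<phi> where "\<phi> x = measure lebesgue (E \<inter> {..x}) - \<theta> * x" for x
  have c: "continuous_on UNIV \<phi>"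
    unfolding \<phi>_def by (intro continuous_intros continuous_measure_Int_atMost E)
  have "sun \<theta> E = (\<Union>y. {x. \<phi> x < \<phi> y} \<inter> {..<y})"
    using sun_iff[OF E] by (auto simp: \<phi>_def)
  also have "open \<dots>"
    using c by (intro open_UN ballI open_Int open_Collect_less) auto
  finally show ?thesis .
qed

lemma sun_subset:
  assumes E: "E \<in> lmeasurable" "E \<subseteq> {b<..<c}" and "\<theta> > 0"
  shows "sun \<theta> E \<subseteq> {b - measure lebesgue E / \<theta><..<c}"
proof
  fix x assume "x \<in> sun \<theta> E"
  then obtain y where y: "x < y" "\<theta> * (y - x) < measure lebesgue (E \<inter> {x<..<y})"
    by (auto simp: sun_def)
  have pos: "0 < measure lebesgue (E \<inter> {x<..<y})"
    using mult_pos_pos[OF assms(3), of "y - x"] y by linarith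
  then have ne: "E \<inter> {x<..<y} \<noteq> {}" by (metis less_irrefl measure_empty)
  then have "x < c" "b < y" using assms(2) by auto
  have "measure lebesgue (E \<inter> {x<..<y}) \<le> measure lebesgue E"
    using E by (intro measure_mono_fmeasurable) auto
  then have "\<theta> * (y - x) < measure lebesgue E" using y by linarith
  then have "y - x < measure lebesgue E / \<theta>" using assms(3) by (simp add: field_simps)
  then show "x \<in> {b - measure lebesgue E / \<theta><..<c}"
    using \<open>x < c\<close> \<open>b < y\<close> by auto
qed

lemma bounded_sun:
  assumes E: "E \<in> lmeasurable" "bounded E" and "\<theta> > 0"
  shows "bounded (sun \<theta> E)"
proof -
  obtain b c where "E \<subseteq> {b<..<c}"
  proof -
    obtain B where "\<forall>x\<in>E. norm x < B" using E(2) bounded_pos_less by blast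
    then have "E \<subseteq> {-B<..<B}" by (auto simp: abs_less_iff)
    then show ?thesis using that by blast
  qed
  then show ?thesis
    using sun_subset[OF E(1) _ assms(3), of b c] bounded_subset bounded_box[of _ c]
    by (metis box_real(1))
qed

lemma subset_sun_open:
  assumes "open E" "\<theta> < 1"
  shows "E \<subseteq> sun \<theta> E"
proof
  fix x assume "x \<in> E"
  then obtain e where e: "e > 0" "ball x e \<subseteq> E"
    using openE[OF assms(1)] by blast
  have "{x<..<x + e} \<subseteq> ball x e" by (auto simp: dist_real_def)
  then have "E \<inter> {x<..<x + e} = {x<..<x + e}" using e(2) by blast
  then have "\<theta> * ((x + e) - x) < measure lebesgue (E \<inter> {x<..<x+e})"
    using e assms(2) by simp
  then show "x \<in> sun \<theta> E" using e(1) unfolding sun_def by (auto intro!: exI[of _ "x + e"])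
qed

lemma sun_mono:
  assumes "E \<subseteq> E'" "E \<in> sets lebesgue" "E' \<in> sets lebesgue"
  shows "sun \<theta> E \<subseteq> sun \<theta> E'"
proof
  fix x assume "x \<in> sun \<theta> E"
  then obtain y where y: "x < y" "\<theta> * (y - x) < measure lebesgue (E \<inter> {x<..<y})"
    by (auto simp: sun_def)
  have "E' \<inter> {x<..<y} \<in> lmeasurable"
    by (metis assms(3) fmeasurable_Int_fmeasurable inf.commute lmeasurable_interval(2) box_real(1))
  then have "measure lebesgue (E \<inter> {x<..<y}) \<le> measure lebesgue (E' \<inter> {x<..<y})"
    using assms by (intro measure_mono_fmeasurable) auto
  then show "x \<in> sun \<theta> E'" using y unfolding sun_def by force
qed

lemma open_sun_lebesgue:
  assumes E: "E \<in> sets lebesgue"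
  shows "open (sun \<theta> E)"
proof -
  have El: "E \<inter> {- real n<..<real n} \<in> sets lebesgue" for n using E by auto
  have "sun \<theta> E = (\<Union>n. sun \<theta> (E \<inter> {- real n<..<real n}))"
  proof (intro antisym subsetI)
    fix x assume "x \<in> sun \<theta> E"
    then obtain y where y: "x < y" "\<theta> * (y - x) < measure lebesgue (E \<inter> {x<..<y})"
      by (auto simp: sun_def)
    obtain n where "max (- x) y < real n" using reals_Archimedean2 by blast
    then have "E \<inter> {x<..<y} = (E \<inter> {- real n<..<real n}) \<inter> {x<..<y}" by auto
    then have "x \<in> sun \<theta> (E \<inter> {- real n<..<real n})" using y by (auto simp: sun_def)
    then show "x \<in> (\<Union>n. sun \<theta> (E \<inter> {- real n<..<real n}))" by blast
  qed (use sun_mono[OF Int_lower1 El E] in blast)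
  moreover have "open (sun \<theta> (E \<inter> {- real n<..<real n}))" for n
    using lmeasurable_subset_interval[OF El] by (intro open_sun) blast
  ultimately show ?thesis by auto
qed

text \<open>F. Riesz's rising sun lemma: at a component, the density of \<open>E\<close> is at least \<open>\<theta>\<close> on every
  terminal piece and at most \<open>\<theta>\<close> on every initial piece.\<close>

lemma sun_component_right:
  assumes E: "E \<in> lmeasurable" and I: "{a<..<b} \<subseteq> sun \<theta> E" "b \<notin> sun \<theta> E" and x: "a \<le> x" "x < b"
  shows "\<theta> * (b - x) \<le> measure lebesgue (E \<inter> {x<..<b})"
proof -
  define \<phi> where "\<phi> x = measure lebesgue (E \<inter> {..x}) - \<theta> * x" for x
  have c: "continuous_on S \<phi>" for S
    unfolding \<phi>_def by (intro continuous_intros continuous_measure_Int_atMost E)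
  have iff: "x \<in> sun \<theta> E \<longleftrightarrow> (\<exists>y>x. \<phi> x < \<phi> y)" for x
    using sun_iff[OF E] by (simp add: \<phi>_def)
  have *: "\<phi> z \<le> \<phi> b" if z: "a < z" "z < b" for z
  proof -
    obtain m where m: "m \<in> {z..b}" "\<And>y. y \<in> {z..b} \<Longrightarrow> \<phi> y \<le> \<phi> m"
      using continuous_attains_sup[of "{z..b}" \<phi>] c z by fastforce
    have "m = b"
    proof (rule ccontr)
      assume "m \<noteq> b"
      then have "m \<in> sun \<theta> E" using m(1) z I(1) by auto
      then obtain y where y: "m < y" "\<phi> m < \<phi> y" using iff by auto
      then have "b < y" using m by (meson atLeastAtMost_iff leI less_imp_le not_less order_trans)
      moreover have "\<phi> b < \<phi> y" using y m(2)[of b] z by auto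
      ultimately show False using I(2) iff by auto
    qed
    then show ?thesis using m(2)[of z] z by auto
  qed
  have "\<phi> x \<le> \<phi> b"
  proof (cases "a < x")
    case False
    then have "x = a" using x by simp
    have "continuous (at_right a) \<phi>"
      using c[of UNIV] by (simp add: continuous_on_eq_continuous_at continuous_at_imp_continuous_within)
    then have "(\<phi> \<longlongrightarrow> \<phi> a) (at_right a)" by (simp add: continuous_within)
    moreover have "\<forall>\<^sub>F z in at_right a. \<phi> z \<le> \<phi> b"
      unfolding eventually_at_right_field using * x \<open>x = a\<close> by (intro exI[of _ b]) auto
    ultimately show ?thesis
      using \<open>x = a\<close> by (intro tendsto_upperbound[of \<phi> _ "at_right a"]) auto
  qed (use * x in auto)
  then show ?thesis
    using measure_Int_greaterThanLessThan[OF E, of x b] x by (simp add: \<phi>_def algebra_simps)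
qed

lemma sun_complement_left:
  assumes E: "E \<in> lmeasurable" and "a \<notin> sun \<theta> E" "a < y"
  shows "measure lebesgue (E \<inter> {a<..<y}) \<le> \<theta> * (y - a)"
  using assms by (force simp: sun_def not_less)

section \<open>Halving arguments on an interval\<close>

text \<open>
  Suppose that \<open>E\<close> has density at least \<open>\<theta>\<close> in every terminal piece of an interval, and that \<open>P\<close> of
  an interval is controlled by \<open>P\<close> of the part of \<open>E\<close> in an adjacent interval to its right as soon
  as that part is large.  Then \<open>P\<close> of the whole interval is controlled by \<open>P\<close> of \<open>E\<close>: the interval
  is cut at the points where the remaining measure of \<open>E\<close> has been halved.
\<close>

lemma emeasure_le_by_halving_right:
  fixes P :: "real measure" and D :: ennreal
  assumes P: "sets P = sets lebesgue" "\<And>x. emeasure P {x} = 0"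
    and E: "E \<in> sets lebesgue" and "\<alpha> < \<beta>" and \<theta>: "\<theta> > 0"
    and dens: "\<And>x. \<alpha> \<le> x \<Longrightarrow> x < \<beta> \<Longrightarrow> \<theta> * (\<beta> - x) \<le> measure lebesgue (E \<inter> {x<..<\<beta>})"
    and step: "\<And>a b c. \<alpha> \<le> a \<Longrightarrow> a < b \<Longrightarrow> b < c \<Longrightarrow> c \<le> \<beta> \<Longrightarrow>
      \<theta> / 4 * (c - a) \<le> measure lebesgue (E \<inter> {b<..<c}) \<Longrightarrow>
      emeasure P {a<..<b} \<le> D * emeasure P (E \<inter> {b<..<c})"
  shows "emeasure P {\<alpha><..<\<beta>} \<le> D * emeasure P (E \<inter> {\<alpha><..<\<beta>})"
proof -
  define E' where "E' = E \<inter> {\<alpha><..<\<beta>}"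
  have E': "E' \<in> lmeasurable" unfolding E'_def
    by (metis E fmeasurable_Int_fmeasurable inf.commute lmeasurable_interval(2) box_real(1))
  define \<psi> where "\<psi> x = measure lebesgue (E' \<inter> {..\<beta>}) - measure lebesgue (E' \<inter> {..x})" for x
  have \<psi>: "measure lebesgue (E \<inter> {x<..<y}) = \<psi> x - \<psi> y" if "\<alpha> \<le> x" "x \<le> y" "y \<le> \<beta>" for x y
  proof -
    have "E \<inter> {x<..<y} = E' \<inter> {x<..<y}" using that by (auto simp: E'_def)
    then show ?thesis
      using measure_Int_greaterThanLessThan[OF E' that(2)] by (simp add: \<psi>_def)
  qed
  have \<psi>\<beta>: "\<psi> \<beta> = 0" by (simp add: \<psi>_def)
  have dens': "\<theta> * (\<beta> - x) \<le> \<psi> x" if "\<alpha> \<le> x" "x < \<beta>" for x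
    using dens[OF that] \<psi>[of x \<beta>] that \<psi>\<beta> by simp
  have anti: "\<psi> y \<le> \<psi> x" if "x \<le> y" for x y
    using measure_Int_atMost_lipschitz(1)[OF E' that] by (simp add: \<psi>_def)
  have cont: "continuous_on S \<psi>" for S
    unfolding \<psi>_def by (intro continuous_intros continuous_measure_Int_atMost E')
  define V where "V = \<psi> \<alpha>"
  have V: "V > 0" using dens'[of \<alpha>] mult_pos_pos[OF \<theta>, of "\<beta> - \<alpha>"] \<open>\<alpha> < \<beta>\<close> by (simp add: V_def)
  have "\<exists>x. \<alpha> \<le> x \<and> x \<le> \<beta> \<and> \<psi> x = V / 2 ^ k" for k :: nat
  proof -
    have "V / 2 ^ k \<le> V" using V by (simp add: divide_le_eq)
    then show ?thesis
      using IVT2'[of \<psi> \<beta> "V / 2 ^ k" \<alpha>] V \<psi>\<beta> \<open>\<alpha> < \<beta>\<close> cont by (auto simp: V_def)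
  qed
  then obtain Y where Y: "\<And>k. \<alpha> \<le> Y k \<and> Y k \<le> \<beta> \<and> \<psi> (Y k) = V / 2 ^ k" by metis
  define X where "X k = (if k = 0 then \<alpha> else Y k)" for k :: nat
  have X: "\<alpha> \<le> X k" "X k < \<beta>" "\<psi> (X k) = V / 2 ^ k" for k
  proof -
    show "\<alpha> \<le> X k" "\<psi> (X k) = V / 2 ^ k" using Y \<open>\<alpha> < \<beta>\<close> by (auto simp: X_def V_def)
    moreover have "X k \<le> \<beta>" using Y \<open>\<alpha> < \<beta>\<close> by (auto simp: X_def)
    ultimately show "X k < \<beta>" 
      using \<psi>\<beta> V by (metis divide_eq_0_iff less_irrefl order_less_le power_not_zero zero_neq_numeral)
  qed
  have Xs: "X k < X (Suc k)" for k
  proof (rule ccontr)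
    assume "\<not> X k < X (Suc k)"
    then have "\<psi> (X k) \<le> \<psi> (X (Suc k))" using anti by simp
    then show False using X V by (simp add: field_simps)
  qed
  have cover: "{\<alpha><..<\<beta>} \<subseteq> (\<Union>k. {X k<..X (Suc k)})"
  proof
    fix x assume x: "x \<in> {\<alpha><..<\<beta>}"
    then have pos: "\<psi> x > 0" using dens'[of x] mult_pos_pos[OF \<theta>, of "\<beta> - x"] by simp
    obtain n where "V * (1/2) ^ n < \<psi> x"
      using real_arch_pow_inv[of "\<psi> x / V" "1/2"] pos V by (auto simp: field_simps)
    then have "\<psi> (X n) < \<psi> x" using X by (simp add: power_divide)
    then have ex: "x \<le> X n" using anti[of "X n" x] by linarith
    define m where "m = (LEAST n. x \<le> X n)"
    have m: "x \<le> X m" unfolding m_def using ex by (rule LeastI)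
    have "m \<noteq> 0" using m x by (auto simp: X_def intro: ccontr)
    then obtain k where k: "m = Suc k" by (cases m) auto
    have "\<not> x \<le> X k" using not_less_Least[of k "\<lambda>n. x \<le> X n"] k unfolding m_def by simp
    then show "x \<in> (\<Union>k. {X k<..X (Suc k)})" using m k by (auto simp: not_le)
  qed
  have dj: "disjoint_family (\<lambda>k. E \<inter> {X (Suc k)<..<X (Suc (Suc k))})"
  proof -
    have "strict_mono X" using Xs by (simp add: strict_mono_Suc_iff)
    then have "X (Suc (Suc i)) \<le> X (Suc j)" if "i < j" for i j
      using that by (simp add: strict_mono_less_eq)
    then show ?thesis
      by (force simp: disjoint_family_on_def neq_iff)
  qed
  have "emeasure P {\<alpha><..<\<beta>} \<le> emeasure P (\<Union>k. {X k<..X (Suc k)})"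
    using cover P by (intro emeasure_mono) auto
  also have "\<dots> \<le> (\<Sum>k. emeasure P {X k<..X (Suc k)})"
    using P by (intro emeasure_subadditive_countably) auto
  also have "\<dots> \<le> (\<Sum>k. D * emeasure P (E \<inter> {X (Suc k)<..<X (Suc (Suc k))}))"
  proof (intro suminf_le)
    fix k
    have "emeasure P {X k<..X (Suc k)} = emeasure P ({X k<..<X (Suc k)} \<union> {X (Suc k)})"
      using Xs[of k] by (intro arg_cong[where f="emeasure P"]) auto
    also have "\<dots> = emeasure P {X k<..<X (Suc k)}"
      using P by (intro emeasure_Un_null_set) (auto simp: null_sets_def)
    also have "\<dots> \<le> D * emeasure P (E \<inter> {X (Suc k)<..<X (Suc (Suc k))})"
    proof (rule step)
      have "measure lebesgue (E \<inter> {X (Suc k)<..<X (Suc (Suc k))}) = V / 2 ^ k / 4"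
        using \<psi>[of "X (Suc k)" "X (Suc (Suc k))"] X Xs[of "Suc k"] by (simp add: less_imp_le field_simps)
      moreover have "\<theta> * (X (Suc (Suc k)) - X k) \<le> V / 2 ^ k"
      proof -
        have "\<theta> * (X (Suc (Suc k)) - X k) \<le> \<theta> * (\<beta> - X k)"
          using X(2)[of "Suc (Suc k)"] \<theta> by simp
        then show ?thesis using dens'[of "X k"] X by force
      qed
      ultimately show "\<theta> / 4 * (X (Suc (Suc k)) - X k)
          \<le> measure lebesgue (E \<inter> {X (Suc k)<..<X (Suc (Suc k))})" by simp
    qed (use X Xs X(2)[THEN less_imp_le] in auto)
    finally show "emeasure P {X k<..X (Suc k)} \<le> D * emeasure P (E \<inter> {X (Suc k)<..<X (Suc (Suc k))})" .
  qed auto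
  also have "\<dots> = D * (\<Sum>k. emeasure P (E \<inter> {X (Suc k)<..<X (Suc (Suc k))}))"
    by simp
  also have "(\<Sum>k. emeasure P (E \<inter> {X (Suc k)<..<X (Suc (Suc k))})) =
      emeasure P (\<Union>k. E \<inter> {X (Suc k)<..<X (Suc (Suc k))})"
    using dj P E by (intro suminf_emeasure) auto
  also have "\<dots> \<le> emeasure P (E \<inter> {\<alpha><..<\<beta>})"
  proof (intro emeasure_mono)
    show "(\<Union>k. E \<inter> {X (Suc k)<..<X (Suc (Suc k))}) \<subseteq> E \<inter> {\<alpha><..<\<beta>}"
      using X by (force intro: less_trans le_less_trans)
  qed (use P E in auto)
  finally show ?thesis by (simp add: mult_left_mono)
qed

lemma emeasure_le_by_halving_left:
  fixes P :: "real measure" and D :: ennreal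
  assumes P: "sets P = sets lebesgue" "\<And>x. emeasure P {x} = 0"
    and E: "E \<in> sets lebesgue" and "\<alpha> < \<beta>" and \<theta>: "\<theta> > 0"
    and dens: "\<And>x. \<alpha> < x \<Longrightarrow> x \<le> \<beta> \<Longrightarrow> \<theta> * (x - \<alpha>) \<le> measure lebesgue (E \<inter> {\<alpha><..<x})"
    and step: "\<And>a b c. \<alpha> \<le> a \<Longrightarrow> a < b \<Longrightarrow> b < c \<Longrightarrow> c \<le> \<beta> \<Longrightarrow>
      \<theta> / 4 * (c - a) \<le> measure lebesgue (E \<inter> {a<..<b}) \<Longrightarrow>
      emeasure P {b<..<c} \<le> D * emeasure P (E \<inter> {a<..<b})"
  shows "emeasure P {\<alpha><..<\<beta>} \<le> D * emeasure P (E \<inter> {\<alpha><..<\<beta>})"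
proof -
  define Q where "Q = distr P lebesgue uminus"
  have mP: "uminus \<in> P \<rightarrow>\<^sub>M lebesgue"
    using measurable_uminus_lebesgue measurable_cong_sets[OF P(1) refl, of lebesgue] by blast
  have [simp]: "space P = UNIV" using sets_eq_imp_space_eq[OF P(1)] by simp
  have Q: "emeasure Q X = emeasure P (uminus -` X)" if "X \<in> sets lebesgue" for X
    using that mP by (simp add: Q_def emeasure_distr)
  have vi: "uminus -` {a<..<b} = {-b<..<-a}" for a b :: real by auto
  have vi': "uminus -` (uminus -` E \<inter> {a<..<b}) = E \<inter> {-b<..<-a}" for a b :: real by auto
  have E': "uminus -` E \<in> sets lebesgue" using E by (rule vimage_uminus_sets_lebesgue)
  have m': "measure lebesgue (uminus -` E \<inter> {a<..<b}) = measure lebesgue (E \<inter> {-b<..<-a})" for a b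
  proof -
    have "uminus -` E \<inter> {a<..<b} \<in> sets lebesgue" using E' by auto
    from measure_lebesgue_uminus[OF this] show ?thesis unfolding vi' by simp
  qed
  have QE: "emeasure Q (uminus -` E \<inter> {a<..<b}) = emeasure P (E \<inter> {-b<..<-a})" for a b
  proof -
    have "uminus -` E \<inter> {a<..<b} \<in> sets lebesgue" using E' by auto
    from Q[OF this] show ?thesis unfolding vi' .
  qed
  have "emeasure Q {-\<beta><..<-\<alpha>} \<le> D * emeasure Q (uminus -` E \<inter> {-\<beta><..<-\<alpha>})"
  proof (rule emeasure_le_by_halving_right[where \<theta>=\<theta>])
    show "sets Q = sets lebesgue" by (simp add: Q_def)
    show "emeasure Q {x} = 0" for x
    proof -
      have "uminus -` {x} = {-x}" by auto
      then show ?thesis using Q[of "{x}"] P(2) by simp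
    qed
    show "\<theta> * (- \<alpha> - x) \<le> measure lebesgue (uminus -` E \<inter> {x<..<- \<alpha>})"
      if "- \<beta> \<le> x" "x < - \<alpha>" for x
      using dens[of "-x"] that m'[of x "-\<alpha>"] by (simp add: algebra_simps)
    show "emeasure Q {a<..<b} \<le> D * emeasure Q (uminus -` E \<inter> {b<..<c})"
      if "- \<beta> \<le> a" "a < b" "b < c" "c \<le> - \<alpha>"
        "\<theta> / 4 * (c - a) \<le> measure lebesgue (uminus -` E \<inter> {b<..<c})" for a b c
      using step[of "-c" "-b" "-a"] that by (simp add: m' QE Q vi algebra_simps)
  qed (use E' \<open>\<alpha> < \<beta>\<close> \<theta> in auto)
  then show ?thesis by (simp add: Q QE vi)
qed

section \<open>Pairs of measures with the one-sided Muckenhoupt property\<close>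

text \<open>Outer regularity inside an interval, for finite measures absolutely continuous with respect to
  Lebesgue measure; it reduces the weak type inequality to open sets.\<close>

lemma outer_regular_ac:
  fixes P :: "real measure"
  assumes "finite_measure P" "sets P = sets lebesgue" "absolutely_continuous lebesgue P"
    and S: "S \<in> sets lebesgue" "S \<subseteq> {A<..<B}" and "e > 0"
  obtains U where "open U" "S \<subseteq> U" "U \<subseteq> {A<..<B}" "measure P U < measure P S + e"
proof -
  interpret finite_measure P by fact
  have "\<exists>T. open T \<and> S \<subseteq> T \<and> T - S \<in> lmeasurable \<and>
      emeasure lebesgue (T - S) < ennreal (1 / Suc n)" for n
    using sets_lebesgue_outer_open[OF S(1), of "1 / Suc n"]
    by (metis of_nat_0_less_iff zero_less_Suc zero_less_divide_1_iff)
  then obtain T where T: "\<And>n. open (T n)" "\<And>n. S \<subseteq> T n" "\<And>n. T n - S \<in> lmeasurable"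
    "\<And>n. emeasure lebesgue (T n - S) < ennreal (1 / Suc n)" by metis
  define U where "U n = (\<Inter>i\<le>n. T i) \<inter> {A<..<B}" for n
  have U: "open (U n)" "S \<subseteq> U n" "U n \<subseteq> {A<..<B}" for n
    using T(1,2) S(2) by (auto simp: U_def intro!: open_Int open_INT)
  have Ul: "U n \<in> sets lebesgue" for n using U(1) by (simp add: borel_open)
  have dec: "decseq U" by (force simp: U_def decseq_def)
  have "emeasure lebesgue ((\<Inter>n. U n) - S) = 0"
  proof (rule ccontr)
    assume ne: "emeasure lebesgue ((\<Inter>n. U n) - S) \<noteq> 0"
    have le: "emeasure lebesgue ((\<Inter>n. U n) - S) \<le> ennreal (1 / Suc n)" for n
    proof -
      have "emeasure lebesgue ((\<Inter>n. U n) - S) \<le> emeasure lebesgue (T n - S)"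
        using T(3)[of n] by (intro emeasure_mono) (auto simp: U_def)
      then show ?thesis using T(4)[of n] by simp
    qed
    then obtain r where r: "emeasure lebesgue ((\<Inter>n. U n) - S) = ennreal r" "r > 0"
      using ne by (metis ennreal_cases ennreal_eq_0_iff ennreal_neq_top le not_le order_trans top.extremum_uniqueI)
    obtain n where "1 / Suc n < r" using r(2) by (metis nat_approx_posE)
    then show False using le[of n] r by (simp add: ennreal_le_iff2 not_le)
  qed
  then have "(\<Inter>n. U n) - S \<in> null_sets lebesgue"
    using Ul S by (auto simp: null_sets_def intro!: sets.Diff)
  then have "(\<Inter>n. U n) - S \<in> null_sets P"
    using assms(3) unfolding absolutely_continuous_def by blast
  then have "measure P (S \<union> ((\<Inter>n. U n) - S)) = measure P S"
    using S(1) assms(2) by (intro measure_Un_null_set) auto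
  moreover have "S \<union> ((\<Inter>n. U n) - S) = (\<Inter>n. U n)" using U(2) by blast
  ultimately have "measure P (\<Inter>n. U n) = measure P S" by simp
  moreover have "(\<lambda>n. measure P (U n)) \<longlonglongrightarrow> measure P (\<Inter>n. U n)"
    using dec Ul assms(2) by (intro finite_Lim_measure_decseq) auto
  ultimately have "\<forall>\<^sub>F n in sequentially. measure P (U n) < measure P S + e"
    using \<open>e > 0\<close> by (intro order_tendstoD(2)[where y = "measure P S"]) auto
  then obtain n where "measure P (U n) < measure P S + e"
    by (auto simp: eventually_sequentially)
  then show ?thesis using U that by blast
qed

text \<open>
  Constants depending on \<open>p\<close> and \<open>K\<close> only, where \<open>K\<close> is the constant of the hypotheses of
  \<open>Ap_plus_pair\<close>: the factor \<open>D\<close> in \<open>N(F) \<le> D N(F - E)\<close> for rising sun sets \<open>F\<close> of \<open>E\<close> at level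
  \<open>1/2\<close>; the exponent \<open>g\<close>, defined by \<open>1 - 1/D = 2\<^bsup>-g\<^esup>\<close>, with which \<open>N(E)\<close> decays in terms of \<open>|E|\<close>;
  the amount by which \<open>p\<close> can be lowered; and the factor in the resulting inequality.
\<close>

definition doubling_const :: "real \<Rightarrow> real \<Rightarrow> real" where
  "doubling_const p K = (K\<^sup>2 * 8 powr p) powr (1 / (p - 1))"

definition decay_exponent :: "real \<Rightarrow> real \<Rightarrow> real" where
  "decay_exponent p K = - log 2 (1 - 1 / doubling_const p K)"

definition exponent_gain :: "real \<Rightarrow> real \<Rightarrow> real" where
  "exponent_gain p K = min p (decay_exponent p K * (p - 1)) / 2"

definition gain_const :: "real \<Rightarrow> real \<Rightarrow> real" where
  "gain_const p K = K\<^sup>2 * (4 powr (decay_exponent p K * (p - 1)) * (1 + 2 powr p) + 4 powr p)"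

lemma doubling_const_gt_1:
  assumes "1 < p" "1 \<le> K"
  shows "1 < doubling_const p K"
proof -
  have "1 < (8::real) powr p" using assms by (intro gr_one_powr) auto
  also have "\<dots> \<le> K\<^sup>2 * 8 powr p"
    using assms(2) mult_right_mono[of 1 "K\<^sup>2" "8 powr p"] by simp
  finally have "1 < K\<^sup>2 * 8 powr p" .
  then show ?thesis unfolding doubling_const_def using assms by (intro gr_one_powr) auto
qed

lemma decay_exponent_pos:
  assumes "1 < p" "1 \<le> K"
  shows "0 < decay_exponent p K"
  using doubling_const_gt_1[OF assms] by (simp add: decay_exponent_def)

lemma exponent_gain_bounds:
  assumes "1 < p" "1 \<le> K"
  shows "0 < exponent_gain p K" "exponent_gain p K < p"
  using decay_exponent_pos[OF assms] assms by (auto simp: exponent_gain_def min_def)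

text \<open>
  Two finite measures, abstracting \<open>w dt\<close> and \<open>w\<^bsup>1-p'\<^esup> dt\<close> on a bounded interval for \<open>w\<close> in
  \<open>A\<^sub>p\<^sup>+\<close>.  The measures may be carried by a larger set than the interval \<open>(A,B)\<close>, but the inequalities
  concern subsets of \<open>(A,B)\<close> only.  Hoelder's inequality is needed up to a constant, which is
  taken to be the same as in the Muckenhoupt condition.
\<close>

locale Ap_plus_pair = M: finite_measure M + N: finite_measure N
  for M N :: "real measure" +
  fixes A B p K :: real
  assumes sets_M: "sets M = sets lebesgue" and sets_N: "sets N = sets lebesgue"
    and ac_M: "absolutely_continuous lebesgue M" and ac_N: "absolutely_continuous lebesgue N"
    and p: "1 < p" and K: "1 \<le> K"
    and holder: "\<And>S. S \<in> sets lebesgue \<Longrightarrow> S \<subseteq> {A<..<B} \<Longrightarrow>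
      measure lebesgue S powr p \<le> K * measure M S * measure N S powr (p - 1)"
    and Ap: "\<And>a b c. A \<le> a \<Longrightarrow> a < b \<Longrightarrow> b < c \<Longrightarrow> c \<le> B \<Longrightarrow>
      measure M {a<..<b} * measure N {b<..<c} powr (p - 1) \<le> K * (c - a) powr p"
begin

abbreviation "D \<equiv> doubling_const p K"
abbreviation "g \<equiv> decay_exponent p K"
abbreviation "\<gamma> \<equiv> exponent_gain p K"

lemmas [simp] = sets_M sets_N

lemma emeasure_singleton: "emeasure M {x} = 0" "emeasure N {x} = 0"
proof -
  have "{x} \<in> null_sets lebesgue" by (simp add: null_sets_def)
  then have "{x} \<in> null_sets M" "{x} \<in> null_sets N"
    using ac_M ac_N unfolding absolutely_continuous_def by blast+
  then show "emeasure M {x} = 0" "emeasure N {x} = 0" by (simp_all add: null_setsD1)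
qed

lemma measure_split_le: "measure M {a<..<b} \<le> measure M {a<..<b1} + measure M {b1<..<b}"
proof -
  have null: "{b1} \<in> null_sets M" using emeasure_singleton by (simp add: null_sets_def)
  have s: "{x<..<y} \<in> sets M" for x y :: real by simp
  have "measure M {a<..<b} \<le> measure M (({a<..<b1} \<union> {b1<..<b}) \<union> {b1})"
  proof (rule M.finite_measure_mono)
    show "{a<..<b} \<subseteq> ({a<..<b1} \<union> {b1<..<b}) \<union> {b1}" by fastforce
    show "({a<..<b1} \<union> {b1<..<b}) \<union> {b1} \<in> sets M"
      using s null by (meson null_setsD2 sets.Un)
  qed
  also have "\<dots> = measure M ({a<..<b1} \<union> {b1<..<b})"
    using s null by (intro measure_Un_null_set sets.Un)
  also have "\<dots> \<le> measure M {a<..<b1} + measure M {b1<..<b}"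
    using s by (intro measure_Un_le)
  finally show ?thesis .
qed

text \<open>A small \<open>N\<close>-measure of \<open>E\<close> improves the density inequality.\<close>

lemma density_le_gain:
  assumes abc: "A \<le> a" "a < b" "b < c" "c \<le> B"
    and E: "E \<in> sets lebesgue" "E \<subseteq> {b<..<c}"
    and q: "0 \<le> q" "measure N E \<le> q * measure N {b<..<c}"
  shows "measure M {a<..<b} * measure lebesgue E powr p
    \<le> q powr (p - 1) * (K\<^sup>2 * measure M E * (c - a) powr p)"
proof -
  have sub: "{b<..<c} \<subseteq> {A<..<B}" using abc by auto
  have "measure M {a<..<b} * measure lebesgue E powr p
      \<le> measure M {a<..<b} * (K * measure M E * measure N E powr (p - 1))"
    using holder[OF E(1) order_trans[OF E(2) sub]] by (intro mult_left_mono) auto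
  also have "\<dots> \<le> measure M {a<..<b} * (K * measure M E * (q * measure N {b<..<c}) powr (p - 1))"
    using q p K by (intro mult_left_mono powr_mono2) auto
  also have "\<dots> = q powr (p - 1) * K * measure M E *
      (measure M {a<..<b} * measure N {b<..<c} powr (p - 1))"
    using q by (simp add: powr_mult algebra_simps)
  also have "\<dots> \<le> q powr (p - 1) * K * measure M E * (K * (c - a) powr p)"
    using Ap[OF abc] K by (intro mult_left_mono) auto
  finally show ?thesis by (simp add: power2_eq_square algebra_simps)
qed

lemma density_le:
  assumes "A \<le> a" "a < b" "b < c" "c \<le> B" "E \<in> sets lebesgue" "E \<subseteq> {b<..<c}"
  shows "measure M {a<..<b} * measure lebesgue E powr p \<le> K\<^sup>2 * measure M E * (c - a) powr p"
  using density_le_gain[OF assms, of 1] assms N.finite_measure_mono[of E "{b<..<c}"] by simp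

text \<open>The dual form: \<open>N\<close> of an interval is controlled by \<open>N\<close> of any large subset of an interval
  adjacent to its left.\<close>

lemma measure_N_le_left:
  assumes abc: "A \<le> a" "a < b" "b < c" "c \<le> B"
    and S: "S \<in> sets lebesgue" "S \<subseteq> {a<..<b}" "1 / 8 * (c - a) \<le> measure lebesgue S"
  shows "measure N {b<..<c} \<le> D * measure N S"
proof -
  let ?n = "measure N {b<..<c}"
  have sub: "{a<..<b} \<subseteq> {A<..<B}" using abc by auto
  have "(1 / 8 * (c - a)) powr p * ?n powr (p - 1) \<le> measure lebesgue S powr p * ?n powr (p - 1)"
    using S abc p by (intro mult_right_mono powr_mono2) auto
  also have "\<dots> \<le> K * measure M S * measure N S powr (p - 1) * ?n powr (p - 1)"
    using holder[OF S(1) order_trans[OF S(2) sub]] by (intro mult_right_mono) auto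
  also have "\<dots> \<le> K * measure M {a<..<b} * measure N S powr (p - 1) * ?n powr (p - 1)"
    using S K by (intro mult_right_mono mult_left_mono M.finite_measure_mono) auto
  also have "\<dots> = K * measure N S powr (p - 1) * (measure M {a<..<b} * ?n powr (p - 1))"
    by (simp add: algebra_simps)
  also have "\<dots> \<le> K * measure N S powr (p - 1) * (K * (c - a) powr p)"
    using Ap[OF abc] K by (intro mult_left_mono) auto
  finally have "(c - a) powr p * ?n powr (p - 1)
      \<le> (c - a) powr p * (K\<^sup>2 * 8 powr p * measure N S powr (p - 1))"
    using abc by (simp add: powr_mult powr_divide field_simps power2_eq_square)
  then have "?n powr (p - 1) \<le> K\<^sup>2 * 8 powr p * measure N S powr (p - 1)"
    using abc by (simp add: mult_le_cancel_left_pos)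
  then have "(?n powr (p - 1)) powr (1 / (p - 1))
      \<le> (K\<^sup>2 * 8 powr p * measure N S powr (p - 1)) powr (1 / (p - 1))"
    using p by (intro powr_mono2) auto
  then show ?thesis
    using p by (simp add: powr_powr powr_mult doubling_const_def)
qed

text \<open>
  The complement of \<open>E\<close> has density at least \<open>1/2\<close> on every initial piece of a component of the rising
  sun set at level \<open>1/2\<close>.  Hence halving towards the left endpoint shows that it carries a fixed
  proportion of \<open>N\<close>.
\<close>

lemma measure_N_sun:
  assumes bc: "A \<le> b" "c \<le> B" and E: "open E" "E \<subseteq> {b<..<c}" "sun (1/2) E \<subseteq> {b<..<c}"
  shows "measure N E \<le> (1 - 1 / D) * measure N (sun (1/2) E)"
proof -
  let ?F = "sun (1/2) E"
  have El: "E \<in> sets lebesgue" using E(1) by (simp add: borel_open)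
  have cE: "- E \<in> sets lebesgue" using sets.compl_sets[OF El] by (simp add: Compl_eq_Diff_UNIV)
  have E': "E \<in> lmeasurable" using lmeasurable_subset_interval[OF El E(2)] .
  have F: "open ?F" using open_sun[OF E'] .
  have Fl: "?F \<in> sets lebesgue" using F by (simp add: borel_open)
  have bF: "bounded ?F" using E(3) bounded_box[of b c] by (metis bounded_subset box_real(1))
  have D1: "1 < D" using doubling_const_gt_1 p K .
  have "emeasure N (?F \<inter> UNIV) \<le> ennreal D * emeasure N (?F \<inter> (- E))"
  proof (rule emeasure_le_from_components[OF F bF])
    fix \<alpha> \<beta> assume I: "\<alpha> < \<beta>" "{\<alpha><..<\<beta>} \<subseteq> ?F" "\<alpha> \<notin> ?F" "\<beta> \<notin> ?F"
    then have ab: "b \<le> \<alpha>" "\<beta> \<le> c" 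
      using E(3) greaterThanLessThan_subseteq_greaterThanLessThan[of \<alpha> \<beta> b c] by auto
    have "emeasure N {\<alpha><..<\<beta>} \<le> ennreal D * emeasure N ((- E) \<inter> {\<alpha><..<\<beta>})"
    proof (rule emeasure_le_by_halving_left[where \<theta> = "1/2"])
      show "1/2 * (x - \<alpha>) \<le> measure lebesgue (- E \<inter> {\<alpha><..<x})" if "\<alpha> < x" "x \<le> \<beta>" for x
      proof -
        have "- E \<inter> {\<alpha><..<x} = {\<alpha><..<x} - E \<inter> {\<alpha><..<x}" by auto
        then have "measure lebesgue (- E \<inter> {\<alpha><..<x}) = (x - \<alpha>) - measure lebesgue (E \<inter> {\<alpha><..<x})"
          using El that
          by (simp add: measurable_measure_Diff[of "{\<alpha><..<x}"] lmeasurable_interval sets.Int)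
        then show ?thesis
          using sun_complement_left[OF E' I(3) that(1)] by simp
      qed
      show "emeasure N {b'<..<c'} \<le> ennreal D * emeasure N (- E \<inter> {a'<..<b'})"
        if "\<alpha> \<le> a'" "a' < b'" "b' < c'" "c' \<le> \<beta>"
          "1 / 2 / 4 * (c' - a') \<le> measure lebesgue (- E \<inter> {a'<..<b'})" for a' b' c'
      proof -
        have "measure N {b'<..<c'} \<le> D * measure N (- E \<inter> {a'<..<b'})"
          using that ab bc cE by (intro measure_N_le_left) auto
        then show ?thesis
          using D1 by (simp add: N.emeasure_eq_measure flip: ennreal_mult)
      qed
    qed (use I cE emeasure_singleton in auto)
    then show "emeasure N ({\<alpha><..<\<beta>} \<inter> UNIV) \<le> ennreal D * emeasure N ({\<alpha><..<\<beta>} \<inter> - E)"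
      by (simp add: Int_commute)
  qed (use cE in auto)
  then have "measure N ?F \<le> D * measure N (?F - E)"
    using D1 by (simp add: N.emeasure_eq_measure Diff_eq flip: ennreal_mult)
  also have "measure N (?F - E) = measure N ?F - measure N E"
    using El Fl subset_sun_open[OF E(1), of "1/2"] by (intro N.finite_measure_Diff) auto
  finally have "measure N ?F \<le> D * (measure N ?F - measure N E)" .
  then show ?thesis using D1 by (simp add: field_simps)
qed

lemma measure_lebesgue_sun:
  assumes E: "E \<in> lmeasurable" "bounded E"
  shows "measure lebesgue (sun (1/2) E) \<le> 2 * measure lebesgue E" "sun (1/2) E \<in> lmeasurable"
proof -
  let ?F = "sun (1/2) E"
  have F: "open ?F" "bounded ?F" using open_sun[OF E(1)] bounded_sun[OF E] by auto
  show Fl: "?F \<in> lmeasurable" using F by (simp add: lmeasurable_open)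
  have "emeasure lebesgue (?F \<inter> UNIV) \<le> 2 * emeasure lebesgue (?F \<inter> E)"
  proof (rule emeasure_le_from_components[OF F])
    fix \<alpha> \<beta> assume I: "\<alpha> < \<beta>" "{\<alpha><..<\<beta>} \<subseteq> ?F" "\<alpha> \<notin> ?F" "\<beta> \<notin> ?F"
    have "1/2 * (\<beta> - \<alpha>) \<le> measure lebesgue (E \<inter> {\<alpha><..<\<beta>})"
      using sun_component_right[OF E(1) I(2) I(4)] I(1) by blast
    moreover have "{\<alpha><..<\<beta>} \<inter> E \<in> lmeasurable"
      using E by (intro fmeasurable_Int_fmeasurable) auto
    ultimately show "emeasure lebesgue ({\<alpha><..<\<beta>} \<inter> UNIV) \<le> 2 * emeasure lebesgue ({\<alpha><..<\<beta>} \<inter> E)"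
      using I(1) by (simp add: emeasure_eq_measure2 Int_commute ennreal_le_iff flip: ennreal_numeral ennreal_mult)
  qed (use E in auto)
  also have "\<dots> \<le> 2 * emeasure lebesgue E"
    using E by (intro mult_left_mono emeasure_mono) auto
  finally show "measure lebesgue ?F \<le> 2 * measure lebesgue E"
    using E Fl by (simp add: emeasure_eq_measure2 ennreal_le_iff flip: ennreal_numeral ennreal_mult)
qed

text \<open>
  One passes \<open>m\<close> times from a set to its rising sun set.  Each passage at most doubles the Lebesgue
  measure and moves the left end by at most twice the measure, which gives the factor
  \<open>2\<^bsup>m+1\<^esup> - 2\<close>.
\<close>

lemma measure_N_decay_nat:
  assumes "A \<le> b" "c \<le> B"
  shows "open E \<Longrightarrow> E \<subseteq> {b'<..<c} \<Longrightarrow> b + (2 ^ Suc m - 2) * measure lebesgue E \<le> b' \<Longrightarrow>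
    measure N E \<le> (1 - 1 / D) ^ m * measure N {b<..<c}"
proof (induction m arbitrary: E b')
  case 0
  then show ?case using N.finite_measure_mono[of E "{b<..<c}"] by force
next
  case (Suc m)
  let ?F = "sun (1/2) E"
  have El: "E \<in> lmeasurable" using Suc.prems lmeasurable_subset_interval by (simp add: borel_open)
  have bE: "bounded E" using Suc.prems(2) bounded_box[of b' c] by (metis bounded_subset box_real(1))
  have F: "?F \<subseteq> {b' - 2 * measure lebesgue E<..<c}"
    using sun_subset[OF El Suc.prems(2), of "1/2"] by (simp add: mult.commute)
  have pow: "(2::real) \<le> 2 ^ Suc m"
  proof -
    have "(1::real) \<le> 2 ^ m" by simp
    then show ?thesis unfolding power_Suc by linarith
  qed
  have "b + (2 ^ Suc m - 2) * measure lebesgue ?F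
      \<le> b + (2 ^ Suc m - 2) * (2 * measure lebesgue E)"
    using measure_lebesgue_sun(1)[OF El bE] pow by (intro add_left_mono mult_left_mono) auto
  also have "\<dots> \<le> b' - 2 * measure lebesgue E" using Suc.prems(3) by (simp add: algebra_simps)
  finally have *: "b + (2 ^ Suc m - 2) * measure lebesgue ?F \<le> b' - 2 * measure lebesgue E" .
  have z0: "0 \<le> (2 ^ Suc m - 2) * measure lebesgue ?F" using pow by (intro mult_nonneg_nonneg) auto
  have z1: "0 \<le> (2 ^ Suc (Suc m) - 2) * measure lebesgue E"
  proof (intro mult_nonneg_nonneg)
    have "(1::real) \<le> 2 ^ m" by simp
    then have "(2::real) \<le> 4 * 2 ^ m" by linarith
    then show "(0::real) \<le> 2 ^ Suc (Suc m) - 2" by simp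
  qed simp
  have "measure N E \<le> (1 - 1 / D) * measure N ?F"
  proof (rule measure_N_sun[OF assms Suc.prems(1)])
    have "b \<le> b' - 2 * measure lebesgue E" "b \<le> b'" using * z0 z1 Suc.prems(3) by linarith+
    then show "?F \<subseteq> {b<..<c}" "E \<subseteq> {b<..<c}" using F Suc.prems(2) by force+
  qed
  also have "\<dots> \<le> (1 - 1 / D) * ((1 - 1 / D) ^ m * measure N {b<..<c})"
    using Suc.IH[OF open_sun[OF El] F *] doubling_const_gt_1[OF p K] by (intro mult_left_mono) auto
  finally show ?case by simp
qed

text \<open>If \<open>E\<close> lies to the right of \<open>b'\<close>, then \<open>N(E)\<close> decays like a power of \<open>|E| / (b' - b)\<close>.\<close>

lemma measure_N_decay:
  assumes bc: "A \<le> b" "b < b'" "b' < c" "c \<le> B" and E: "open E" "E \<subseteq> {b'<..<c}"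
  shows "measure N E \<le> (4 * measure lebesgue E / (b' - b)) powr g * measure N {b<..<c}"
proof -
  let ?e = "measure lebesgue E"
  have El: "E \<in> lmeasurable" using E lmeasurable_subset_interval by (simp add: borel_open)
  have g: "0 < g" using decay_exponent_pos p K .
  define q where "q = ?e / (b' - b)"
  consider "?e = 0" | "q > 1/2" | "0 < q" "q \<le> 1/2"
  proof -
    have "q > 0" if "?e \<noteq> 0"
      using that bc measure_nonneg[of lebesgue E] by (simp add: q_def less_le)
    then show ?thesis using that by linarith
  qed
  then show ?thesis
  proof cases
    case 1
    then have "E \<in> null_sets lebesgue" using El by (auto simp: null_sets_def emeasure_eq_measure2)
    then have "E \<in> null_sets N" using ac_N unfolding absolutely_continuous_def by blast
    then show ?thesis by (simp add: measure_def null_sets_def)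
  next
    case 2
    then have "1 \<le> (4 * q) powr g" using g by (intro ge_one_powr_ge_zero) auto
    moreover have "measure N E \<le> measure N {b<..<c}"
      using E bc by (intro N.finite_measure_mono) auto
    ultimately have "1 * measure N E \<le> (4 * q) powr g * measure N {b<..<c}"
      by (intro mult_mono) auto
    then show ?thesis by (simp add: q_def)
  next
    case 3
    \<comment> \<open>The passage to the rising sun set can be repeated \<open>n - 2\<close> times before it leaves \<open>(b,c)\<close>.\<close>
    define n where "n = (LEAST n. 1 < 2 ^ n * q)"
    obtain n0 where "1 / q < 2 ^ n0" using real_arch_pow[of 2 "1/q"] by auto
    then have "1 < 2 ^ n0 * q" using 3 by (simp add: field_simps)
    then have n: "1 < 2 ^ n * q" unfolding n_def by (rule LeastI)
    have n': "2 ^ k * q \<le> 1" if "k < n" for k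
      using not_less_Least[of k "\<lambda>n. 1 < 2 ^ n * q"] that unfolding n_def by simp
    have "n \<noteq> 0" by (rule notI) (use n 3 in simp)
    moreover have "n \<noteq> 1" by (rule notI) (use n 3 in simp)
    ultimately obtain m where m: "n = Suc (Suc m)" by (metis One_nat_def not0_implies_Suc)
    have m1: "2 ^ Suc m * q \<le> 1" using n'[of "Suc m"] m by simp
    have "measure N E \<le> (1 - 1 / D) ^ m * measure N {b<..<c}"
    proof (rule measure_N_decay_nat[OF bc(1,4) E])
      have "(2 ^ Suc m - 2) * ?e \<le> 2 ^ Suc m * ?e" by (intro mult_right_mono) auto
      also have "\<dots> \<le> b' - b" using m1 bc by (simp add: q_def field_simps)
      finally show "b + (2 ^ Suc m - 2) * ?e \<le> b'" by simp
    qed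
    also have "(1 - 1 / D) ^ m \<le> (4 * q) powr g"
    proof -
      have D1: "0 < 1 - 1 / D" using doubling_const_gt_1[OF p K] by simp
      have "1 - 1 / D = 2 powr (- g)" using D1 by (simp add: decay_exponent_def)
      then have "(1 - 1 / D) ^ m = (2 powr (- g)) powr m" using D1 by (simp add: powr_realpow)
      also have "\<dots> = (2 powr (- real m)) powr g" by (simp add: powr_powr mult.commute)
      also have "2 powr (- real m) = 1 / 2 ^ m"
        by (simp add: powr_minus powr_realpow divide_inverse)
      also have "(1 / 2 ^ m) powr g \<le> (4 * q) powr g"
        using n m 3 g by (intro powr_mono2) (auto simp: field_simps)
      finally show ?thesis .
    qed
    finally show ?thesis by (simp add: q_def mult_right_mono)
  qed
qed

end

context Ap_plus_pair
begin

text \<open>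
  The density inequality holds with the smaller exponent \<open>p - \<gamma>\<close>.  With \<open>d = sqrt (|E| (c - a))\<close>, cut
  \<open>(a,b)\<close> at \<open>b - d\<close> and \<open>E\<close> at \<open>b + d\<close>.  The left part of \<open>(a,b)\<close> has distance at least \<open>d\<close> from \<open>E\<close>, which
  makes \<open>N(E)\<close> relatively small.  For the right part of \<open>(a,b)\<close>, either half of \<open>E\<close> lies beyond \<open>b + d\<close>, and
  the same reason applies, or half of \<open>E\<close> lies before \<open>b + d\<close>, and then \<open>(a,c)\<close> may be replaced with an
  interval of length at most \<open>2 d\<close>.
\<close>

lemma density_le_power_gain:
  assumes abc: "A \<le> a" "a < b" "b < c" "c \<le> B" and E: "open E" "E \<subseteq> {b<..<c}"
  shows "measure M {a<..<b} * measure lebesgue E powr (p - \<gamma>)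
    \<le> gain_const p K * measure M E * (c - a) powr (p - \<gamma>)"
proof (cases "measure lebesgue E = 0")
  case True
  moreover have "0 \<le> gain_const p K" by (simp add: gain_const_def)
  ultimately show ?thesis by simp
next
  case False
  let ?e = "measure lebesgue E" and ?L = "c - a"
  define G where "G = g * (p - 1)"
  define Q where "Q = K\<^sup>2 * measure M E * ?L powr p"
  define \<tau> where "\<tau> = ?e / ?L"
  define d where "d = sqrt (?e * ?L)"
  have g: "0 < g" using decay_exponent_pos p K .
  have G: "0 < G" using g p by (simp add: G_def)
  have El: "E \<in> sets lebesgue" using E(1) by (simp add: borel_open)
  have e: "0 < ?e" using False by (simp add: less_le)
  have "?e \<le> measure lebesgue {b<..<c}"
    using El E(2) by (intro measure_mono_fmeasurable) auto
  then have eL: "?e \<le> ?L" using abc by simp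
  have L: "0 < ?L" using abc by simp
  have \<tau>: "0 < \<tau>" "\<tau> \<le> 1" using e eL L by (auto simp: \<tau>_def)
  have d: "0 < d" using e L by (simp add: d_def)
  have ed: "?e / d = \<tau> powr (1/2)" 
  proof -
    have "(?e / d)\<^sup>2 = \<tau>" using e L by (simp add: d_def \<tau>_def power_divide power2_eq_square)
    then have "?e / d = sqrt \<tau>" using e d by (metis abs_of_pos divide_pos_pos real_sqrt_abs)
    then show ?thesis using \<tau> by (simp add: powr_half_sqrt)
  qed
  have dL: "d = \<tau> powr (1/2) * ?L"
  proof -
    have "d\<^sup>2 = \<tau> * ?L\<^sup>2" using e L by (simp add: d_def \<tau>_def power2_eq_square)
    then have "d = sqrt (\<tau> * ?L\<^sup>2)" using d by (metis abs_of_pos real_sqrt_abs)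
    then show ?thesis using \<tau> L by (simp add: powr_half_sqrt real_sqrt_mult)
  qed
  have Q: "0 \<le> Q" by (simp add: Q_def)
  have far: "measure M {a'<..<b'} * measure lebesgue S powr p \<le> (4 powr G * \<tau> powr (G/2)) * Q"
    if h: "a \<le> a'" "a' < b'" "b' < b2" "b2 < c" "d \<le> b2 - b'" "open S" "S \<subseteq> E" "S \<subseteq> {b2<..<c}"
    for a' b' b2 S
  proof -
    have Sl: "S \<in> sets lebesgue" using h by (simp add: borel_open)
    have Se: "measure lebesgue S \<le> ?e"
      using h(7) Sl El lmeasurable_subset_interval[OF El E(2)] by (intro measure_mono_fmeasurable)
    have "measure N S \<le> (4 * measure lebesgue S / (b2 - b')) powr g * measure N {b'<..<c}"
      using h abc by (intro measure_N_decay) auto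
    also have "\<dots> \<le> (4 * (?e / d)) powr g * measure N {b'<..<c}"
    proof (intro mult_right_mono powr_mono2)
      have "measure lebesgue S / (b2 - b') \<le> ?e / d" using h Se d e by (intro frac_le) auto
      then show "4 * measure lebesgue S / (b2 - b') \<le> 4 * (?e / d)" by simp
    qed (use g h d in auto)
    finally have N: "measure N S \<le> (4 * (?e / d)) powr g * measure N {b'<..<c}" .
    have "measure M {a'<..<b'} * measure lebesgue S powr p
        \<le> ((4 * (?e / d)) powr g) powr (p - 1) * (K\<^sup>2 * measure M S * (c - a') powr p)"
      using h abc Sl N by (intro density_le_gain) auto
    also have "\<dots> \<le> ((4 * (?e / d)) powr g) powr (p - 1) * Q"
      unfolding Q_def using h El abc p
      by (intro mult_left_mono mult_mono M.finite_measure_mono powr_mono2) auto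
    also have "((4 * (?e / d)) powr g) powr (p - 1) = 4 powr G * \<tau> powr (G/2)"
      by (simp add: ed powr_powr powr_mult G_def)
    finally show ?thesis .
  qed
  define b1 where "b1 = max a (b - d)"
  have 1: "measure M {a<..<b1} * ?e powr p \<le> (4 powr G * \<tau> powr (G/2)) * Q"
  proof (cases "a < b1")
    case True
    then show ?thesis using far[of a b1 b E] E abc d by (auto simp: b1_def)
  qed (use Q in auto)
  define E1 where "E1 = E \<inter> {b<..<b + d}"
  define E2 where "E2 = E \<inter> {b + d<..<c}"
  have E12: "open E1" "open E2" "E1 \<subseteq> E" "E2 \<subseteq> E" using E by (auto simp: E1_def E2_def)
  have E12l: "E1 \<in> sets lebesgue" "E2 \<in> sets lebesgue" using E12 by (simp_all add: borel_open)
  have "?e \<le> measure lebesgue ((E1 \<union> E2) \<union> {b + d})"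
  proof (rule measure_mono_fmeasurable)
    show "E \<subseteq> (E1 \<union> E2) \<union> {b + d}" using E(2) by (force simp: E1_def E2_def)
    have "E1 \<in> lmeasurable" "E2 \<in> lmeasurable"
      using E12 E12l lmeasurable_subset_interval E(2) by (meson order_trans)+
    then show "(E1 \<union> E2) \<union> {b + d} \<in> lmeasurable" by (intro fmeasurable.Un) (auto simp: fmeasurable_def)
  qed (rule El)
  also have "\<dots> = measure lebesgue (E1 \<union> E2)"
    using E12l by (intro measure_Un_null_set) auto
  also have "\<dots> \<le> measure lebesgue E1 + measure lebesgue E2"
    using E12l by (intro measure_Un_le) auto
  finally have "?e / 2 \<le> measure lebesgue E1 \<or> ?e / 2 \<le> measure lebesgue E2" by linarith
  then have 2: "measure M {b1<..<b} * ?e powr p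
      \<le> (4 powr p * \<tau> powr (p/2) + 2 powr p * (4 powr G * \<tau> powr (G/2))) * Q"
  proof
    assume h: "?e / 2 \<le> measure lebesgue E1"
    define b2 where "b2 = min c (b + d)"
    have "measure M {b1<..<b} * ?e powr p = 2 powr p * (measure M {b1<..<b} * (?e / 2) powr p)"
      using e by (simp add: powr_divide)
    also have "\<dots> \<le> 2 powr p * (measure M {b1<..<b} * measure lebesgue E1 powr p)"
      using h p e by (intro mult_left_mono powr_mono2) auto
    also have "measure M {b1<..<b} * measure lebesgue E1 powr p
        \<le> K\<^sup>2 * measure M E1 * (b2 - b1) powr p"
    proof (rule density_le)
      show "E1 \<subseteq> {b<..<b2}" using E(2) by (auto simp: E1_def b2_def)
    qed (use abc d E12l in \<open>auto simp: b1_def b2_def\<close>)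
    also have "\<dots> \<le> K\<^sup>2 * measure M E * (2 * d) powr p"
      using E12 El p abc d
      by (intro mult_mono mult_left_mono M.finite_measure_mono powr_mono2) (auto simp: b1_def b2_def)
    also have "\<dots> = 2 powr p * \<tau> powr (p/2) * Q"
      using L by (simp add: dL Q_def powr_mult powr_powr)
    also have "2 powr p * (2 powr p * \<tau> powr (p/2) * Q) = 4 powr p * \<tau> powr (p/2) * Q"
      by (simp flip: powr_mult add: mult.assoc[symmetric])
    also have "\<dots> \<le> (4 powr p * \<tau> powr (p/2) + 2 powr p * (4 powr G * \<tau> powr (G/2))) * Q"
      using Q by (intro mult_right_mono) auto
    finally show ?thesis by simp
  next
    assume h: "?e / 2 \<le> measure lebesgue E2"
    then have "E2 \<noteq> {}" using e by auto
    then have bd: "b + d < c" by (force simp: E2_def)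
    have "measure M {b1<..<b} * ?e powr p = 2 powr p * (measure M {b1<..<b} * (?e / 2) powr p)"
      using e by (simp add: powr_divide)
    also have "\<dots> \<le> 2 powr p * (measure M {b1<..<b} * measure lebesgue E2 powr p)"
      using h p e by (intro mult_left_mono powr_mono2) auto
    also have "\<dots> \<le> 2 powr p * ((4 powr G * \<tau> powr (G/2)) * Q)"
      using abc d bd E12 by (intro mult_left_mono far[of b1 b "b + d" E2]) (auto simp: b1_def E2_def)
    also have "\<dots> \<le> (4 powr p * \<tau> powr (p/2) + 2 powr p * (4 powr G * \<tau> powr (G/2))) * Q"
      using Q by (simp add: algebra_simps)
    finally show ?thesis .
  qed
  have \<gamma>: "\<tau> powr (G/2) \<le> \<tau> powr \<gamma>" "\<tau> powr (p/2) \<le> \<tau> powr \<gamma>"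
    using \<tau> by (auto intro!: powr_mono' simp: exponent_gain_def G_def)
  have "measure M {a<..<b} * ?e powr p
      \<le> (measure M {a<..<b1} + measure M {b1<..<b}) * ?e powr p"
    using measure_split_le by (intro mult_right_mono) auto
  also have "\<dots> \<le> ((4 powr G * \<tau> powr (G/2)) + (4 powr p * \<tau> powr (p/2) + 2 powr p * (4 powr G * \<tau> powr (G/2)))) * Q"
    using 1 2 by (simp add: distrib_right)
  also have "\<dots> \<le> ((4 powr G * \<tau> powr \<gamma>) + (4 powr p * \<tau> powr \<gamma> + 2 powr p * (4 powr G * \<tau> powr \<gamma>))) * Q"
    using \<gamma> Q by (intro mult_right_mono add_mono mult_left_mono) auto
  also have "\<dots> = \<tau> powr \<gamma> * (gain_const p K * measure M E * ?L powr p)"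
    by (simp add: gain_const_def Q_def G_def algebra_simps)
  finally have "measure M {a<..<b} * ?e powr p \<le> \<tau> powr \<gamma> * (gain_const p K * measure M E * ?L powr p)" .
  then have "measure M {a<..<b} * ?e powr p * ?e powr (-\<gamma>)
      \<le> \<tau> powr \<gamma> * (gain_const p K * measure M E * ?L powr p) * ?e powr (-\<gamma>)"
    by (intro mult_right_mono) auto
  also have "\<dots> = gain_const p K * measure M E * (?L powr p * ?L powr (-\<gamma>))"
    using e L by (simp add: \<tau>_def powr_divide powr_minus field_simps)
  finally show ?thesis using e L by (simp add: mult.assoc flip: powr_add)
qed

text \<open>The restricted weak type inequality with the improved exponent, with a constant that does not
  depend on the interval.\<close>

lemma restricted_weak_type_open:
  assumes E: "open E" "E \<subseteq> {A<..<B}" and \<theta>: "0 < \<theta>"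
  shows "emeasure M (sun \<theta> E \<inter> {A<..<B})
    \<le> ennreal (gain_const p K * (4 / \<theta>) powr (p - \<gamma>)) * emeasure M E"
proof -
  let ?D = "gain_const p K * (4 / \<theta>) powr (p - \<gamma>)" and ?F = "sun \<theta> E"
  have C: "0 \<le> gain_const p K" by (simp add: gain_const_def)
  have El: "E \<in> sets lebesgue" using E(1) by (simp add: borel_open)
  have E': "E \<in> lmeasurable" using lmeasurable_subset_interval[OF El E(2)] .
  have bE: "bounded E" using E(2) bounded_box[of A B] by (metis bounded_subset box_real(1))
  have F: "open ?F" "bounded ?F" using open_sun[OF E'] bounded_sun[OF E' bE \<theta>] .
  have FB: "?F \<subseteq> {..<B}" using sun_subset[OF E' E(2) \<theta>] by auto
  have "emeasure M (?F \<inter> {A<..<B}) \<le> ennreal ?D * emeasure M (?F \<inter> E)"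
  proof (rule emeasure_le_from_components[OF F])
    fix \<alpha> \<beta> assume I: "\<alpha> < \<beta>" "{\<alpha><..<\<beta>} \<subseteq> ?F" "\<alpha> \<notin> ?F" "\<beta> \<notin> ?F"
    have "\<beta> \<le> B"
    proof (rule ccontr)
      assume "\<not> \<beta> \<le> B"
      then have "max ((\<alpha> + \<beta>)/2) B \<in> {\<alpha><..<\<beta>}" using I(1) by (auto simp: less_max_iff_disj)
      then show False using I(2) FB by force
    qed
    show "emeasure M ({\<alpha><..<\<beta>} \<inter> {A<..<B}) \<le> ennreal ?D * emeasure M ({\<alpha><..<\<beta>} \<inter> E)"
    proof (cases "max \<alpha> A < \<beta>")
      case False
      then have "{\<alpha><..<\<beta>} \<inter> {A<..<B} = {}" by (auto simp: max_def split: if_splits)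
      then show ?thesis by simp
    next
      case True
      define a0 where "a0 = max \<alpha> A"
      have "emeasure M {a0<..<\<beta>} \<le> ennreal ?D * emeasure M (E \<inter> {a0<..<\<beta>})"
      proof (rule emeasure_le_by_halving_right[where \<theta> = \<theta>])
        show "\<theta> * (\<beta> - x) \<le> measure lebesgue (E \<inter> {x<..<\<beta>})" if "a0 \<le> x" "x < \<beta>" for x
          using sun_component_right[OF E' I(2) I(4)] that by (simp add: a0_def)
        show "emeasure M {a<..<b} \<le> ennreal ?D * emeasure M (E \<inter> {b<..<c})"
          if h: "a0 \<le> a" "a < b" "b < c" "c \<le> \<beta>" "\<theta> / 4 * (c - a) \<le> measure lebesgue (E \<inter> {b<..<c})"
          for a b c
        proof -
          have "measure M {a<..<b} * (\<theta> / 4 * (c - a)) powr (p - \<gamma>)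
              \<le> measure M {a<..<b} * measure lebesgue (E \<inter> {b<..<c}) powr (p - \<gamma>)"
            using h \<theta> exponent_gain_bounds[OF p K] by (intro mult_left_mono powr_mono2) auto
          also have "\<dots> \<le> gain_const p K * measure M (E \<inter> {b<..<c}) * (c - a) powr (p - \<gamma>)"
            using h \<open>\<beta> \<le> B\<close> E by (intro density_le_power_gain) (auto simp: a0_def)
          finally have *: "measure M {a<..<b} * (\<theta> / 4 * (c - a)) powr (p - \<gamma>)
              \<le> gain_const p K * measure M (E \<inter> {b<..<c}) * (c - a) powr (p - \<gamma>)" .
          have "(\<theta> / 4 * (c - a)) powr (p - \<gamma>) = (\<theta> / 4) powr (p - \<gamma>) * (c - a) powr (p - \<gamma>)"
            by (rule powr_mult)
          then have "(measure M {a<..<b} * (\<theta> / 4) powr (p - \<gamma>)) * (c - a) powr (p - \<gamma>)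
              \<le> (gain_const p K * measure M (E \<inter> {b<..<c})) * (c - a) powr (p - \<gamma>)"
            using * by (simp only: mult.assoc)
          moreover have "0 < (c - a) powr (p - \<gamma>)" using h by simp
          ultimately have "measure M {a<..<b} * (\<theta> / 4) powr (p - \<gamma>)
              \<le> gain_const p K * measure M (E \<inter> {b<..<c})"
            by (rule mult_right_le_imp_le)
          then have "measure M {a<..<b} \<le> ?D * measure M (E \<inter> {b<..<c})"
            using \<theta> by (simp add: powr_divide field_simps)
          then show ?thesis
            using C by (simp add: M.emeasure_eq_measure ennreal_le_iff flip: ennreal_mult)
        qed
      qed (use True El \<theta> emeasure_singleton in \<open>auto simp: a0_def\<close>)
      also have "emeasure M (E \<inter> {a0<..<\<beta>}) \<le> emeasure M ({\<alpha><..<\<beta>} \<inter> E)"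
        using El by (intro emeasure_mono) (auto simp: a0_def)
      also have "{a0<..<\<beta>} = {\<alpha><..<\<beta>} \<inter> {A<..<B}" using \<open>\<beta> \<le> B\<close> by (auto simp: a0_def)
      finally show ?thesis by (simp add: mult_left_mono)
    qed
  qed (use El in auto)
  also have "\<dots> \<le> ennreal ?D * emeasure M E"
    using El by (intro mult_left_mono emeasure_mono) auto
  finally show ?thesis .
qed

text \<open>The same for measurable sets, by outer regularity.\<close>

lemma restricted_weak_type:
  assumes E: "E \<in> sets lebesgue" "E \<subseteq> {A<..<B}" and \<theta>: "0 < \<theta>"
  shows "emeasure M (sun \<theta> E \<inter> {A<..<B})
    \<le> ennreal (gain_const p K * (4 / \<theta>) powr (p - \<gamma>)) * emeasure M E"
proof -
  let ?D = "gain_const p K * (4 / \<theta>) powr (p - \<gamma>)"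
  have D: "0 \<le> ?D" by (simp add: gain_const_def)
  have "measure M (sun \<theta> E \<inter> {A<..<B}) \<le> ?D * measure M E"
  proof (rule field_le_epsilon)
    fix e :: real assume "0 < e"
    define e' where "e' = e / (?D + 1)"
    have "0 < e'" using \<open>0 < e\<close> D by (simp add: e'_def)
    then obtain U where U: "open U" "E \<subseteq> U" "U \<subseteq> {A<..<B}" "measure M U < measure M E + e'"
      using outer_regular_ac[OF M.finite_measure_axioms sets_M ac_M E] by metis
    have Ul: "U \<in> sets lebesgue" using U by (simp add: borel_open)
    have sl: "sun \<theta> U \<in> sets lebesgue"
      using open_sun[OF lmeasurable_subset_interval[OF Ul U(3)]] by (simp add: borel_open)
    have "measure M (sun \<theta> E \<inter> {A<..<B}) \<le> measure M (sun \<theta> U \<inter> {A<..<B})"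
      using sun_mono[OF U(2) E(1) Ul] sl by (intro M.finite_measure_mono) auto
    also have "\<dots> \<le> ?D * measure M U"
      using restricted_weak_type_open[OF U(1,3) \<theta>] D
      by (simp add: M.emeasure_eq_measure ennreal_le_iff flip: ennreal_mult)
    also have "\<dots> \<le> ?D * (measure M E + e')" using U(4) D by (intro mult_left_mono) auto
    also have "\<dots> \<le> ?D * measure M E + e"
    proof -
      have "?D * e' \<le> (?D + 1) * e'" using \<open>0 < e'\<close> by simp
      also have "\<dots> = e" using D by (simp add: e'_def)
      finally show ?thesis by (simp add: distrib_left)
    qed
    finally show "measure M (sun \<theta> E \<inter> {A<..<B}) \<le> ?D * measure M E + e" .
  qed
  then show ?thesis
    using D by (simp add: M.emeasure_eq_measure ennreal_le_iff flip: ennreal_mult)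
qed

end

section \<open>From weights to measures\<close>

lemma ennreal_powr_ennreal: "0 \<le> x \<Longrightarrow> ennreal_powr (ennreal x) r = ennreal (x powr r)"
  by (simp add: ennreal_powr_def)

lemma ennreal_powr_mono:
  assumes "x \<le> y" "0 \<le> r"
  shows "ennreal_powr x r \<le> ennreal_powr y r"
proof (cases "y = \<infinity>")
  case False
  then have "x \<noteq> \<infinity>" using assms(1) by (auto simp: top_unique)
  moreover have "enn2real x \<le> enn2real y"
    using assms(1) False by (intro enn2real_mono) (auto simp: less_top)
  ultimately show ?thesis
    using False assms(2) by (auto simp: ennreal_powr_def intro!: ennreal_leI powr_mono2)
qed (simp add: ennreal_powr_def)

lemma ennreal_powr_eq_0_iff: "ennreal_powr x r = 0 \<longleftrightarrow> x = 0"
  by (cases x) (auto simp: ennreal_powr_def ennreal_eq_0_iff)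

lemma nn_integral_pos_on:
  assumes f: "f \<in> borel_measurable lebesgue" and S: "S \<in> sets lebesgue" "emeasure lebesgue S \<noteq> 0"
    and pos: "AE t in lebesgue. t \<in> S \<longrightarrow> 0 < f t"
  shows "(\<integral>\<^sup>+t\<in>S. ennreal (f t) \<partial>lebesgue) \<noteq> 0"
proof
  assume "(\<integral>\<^sup>+t\<in>S. ennreal (f t) \<partial>lebesgue) = 0"
  then have "AE t in lebesgue. ennreal (f t) * indicator S t = 0"
    using f S by (subst (asm) nn_integral_0_iff_AE) auto
  then have "AE t in lebesgue. t \<notin> S"
    using pos by eventually_elim (auto split: split_indicator_asm simp: ennreal_eq_0_iff)
  then show False using S AE_iff_null_sets[of S lebesgue] by (auto simp: null_sets_def)
qed

text \<open>Hoelder's inequality for characteristic functions, up to the factor \<open>2\<^sup>p\<close>: the pointwise bound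
  \<open>1 \<le> w / \<lambda> + \<lambda>\<^bsup>1/(p-1)\<^esup> w\<^bsup>-1/(p-1)\<^esup>\<close> is integrated and \<open>\<lambda>\<close> is optimized.\<close>

lemma holder_weight:
  fixes w :: "real \<Rightarrow> real"
  assumes w: "w \<in> borel_measurable lebesgue" and S: "S \<in> lmeasurable" and p: "1 < p"
    and pos: "AE t in lebesgue. t \<in> S \<longrightarrow> 0 < w t"
    and W: "(\<integral>\<^sup>+t\<in>S. ennreal (w t) \<partial>lebesgue) = ennreal W" "0 \<le> W"
    and V: "(\<integral>\<^sup>+t\<in>S. ennreal (w t powr (1 - conj_exponent p)) \<partial>lebesgue) = ennreal V" "0 \<le> V"
  shows "measure lebesgue S powr p \<le> 2 powr p * W * V powr (p - 1)"
proof (cases "measure lebesgue S = 0")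
  case False
  have ce: "1 - conj_exponent p = - (1 / (p - 1))"
    using p by (simp add: conj_exponent_def field_simps)
  have ne: "emeasure lebesgue S \<noteq> 0" using False by (auto simp: measure_def)
  have Sl: "S \<in> sets lebesgue" using S by auto
  have "W \<noteq> 0" using nn_integral_pos_on[OF w Sl ne pos] W by auto
  moreover have "V \<noteq> 0"
  proof -
    have "AE t in lebesgue. t \<in> S \<longrightarrow> 0 < w t powr (1 - conj_exponent p)"
      using pos by eventually_elim auto
    then show ?thesis using nn_integral_pos_on[OF _ Sl ne, of "\<lambda>t. w t powr (1 - conj_exponent p)"] w V
      by auto
  qed
  ultimately have WV: "0 < W" "0 < V" using W V by auto
  have le: "measure lebesgue S \<le> W / l + l powr (1 / (p - 1)) * V" if l: "0 < l" for l
  proof -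
    have "emeasure lebesgue S = (\<integral>\<^sup>+t. indicator S t \<partial>lebesgue)" using S by simp
    also have "\<dots> \<le> (\<integral>\<^sup>+t. ennreal (1 / l) * (ennreal (w t) * indicator S t) +
        ennreal (l powr (1 / (p - 1))) * (ennreal (w t powr (1 - conj_exponent p)) * indicator S t) \<partial>lebesgue)"
    proof (rule nn_integral_mono_AE)
      show "AE t in lebesgue. indicator S t \<le> ennreal (1 / l) * (ennreal (w t) * indicator S t) +
        ennreal (l powr (1 / (p - 1))) * (ennreal (w t powr (1 - conj_exponent p)) * indicator S t)"
        using pos
      proof eventually_elim
        case (elim t)
        show ?case
        proof (cases "t \<in> S")
          case True
          then have wt: "0 < w t" using elim by simp
          have "1 \<le> 1 / l * w t + l powr (1 / (p - 1)) * w t powr (1 - conj_exponent p)"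
          proof (cases "l \<le> w t")
            case True
            then have "1 \<le> 1 / l * w t" using l by simp
            then show ?thesis by (intro add_increasing2) auto
          next
            case False
            have "1 = l powr (1 / (p - 1)) * l powr (1 - conj_exponent p)"
              unfolding ce using l by (simp flip: powr_add)
            also have "\<dots> \<le> l powr (1 / (p - 1)) * w t powr (1 - conj_exponent p)"
              unfolding ce using False wt p by (intro mult_left_mono powr_mono2') auto
            finally show ?thesis using l wt by (intro add_increasing) auto
          qed
          then show ?thesis using True l wt
            by (simp add: ennreal_le_iff flip: ennreal_mult ennreal_plus ennreal_1)
        qed simp
      qed
    qed
    also have "\<dots> = ennreal (1 / l) * ennreal W + ennreal (l powr (1 / (p - 1))) * ennreal V"
      using w Sl by (subst nn_integral_add) (auto simp: nn_integral_cmult W(1) V(1))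
    also have "\<dots> = ennreal (W / l + l powr (1 / (p - 1)) * V)"
      using l WV by (simp flip: ennreal_mult ennreal_plus)
    finally have "ennreal (measure lebesgue S) \<le> ennreal (W / l + l powr (1 / (p - 1)) * V)"
      using S by (simp only: emeasure_eq_measure2)
    moreover have "0 \<le> W / l + l powr (1 / (p - 1)) * V" using l WV by simp
    ultimately show ?thesis by (simp only: ennreal_le_iff)
  qed
  \<comment> \<open>This choice makes both summands equal.\<close>
  define l where "l = (W / V) powr ((p - 1) / p)"
  have l: "0 < l" using WV by (simp add: l_def)
  have e1: "W / l = W powr (1 / p) * V powr ((p - 1) / p)"
  proof -
    have "W / l = W powr 1 * W powr (- ((p - 1) / p)) * V powr ((p - 1) / p)"
      using WV by (simp add: l_def powr_divide powr_minus field_simps)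
    also have "W powr 1 * W powr (- ((p - 1) / p)) = W powr (1 / p)"
      using p by (simp only: powr_add[symmetric]) (simp add: diff_divide_distrib)
    finally show ?thesis .
  qed
  have e2: "l powr (1 / (p - 1)) * V = W powr (1 / p) * V powr ((p - 1) / p)"
  proof -
    have "l powr (1 / (p - 1)) * V = W powr (1 / p) * (V powr (- (1 / p)) * V powr 1)"
      using WV p by (simp add: l_def powr_powr powr_divide powr_minus field_simps)
    also have "V powr (- (1 / p)) * V powr 1 = V powr ((p - 1) / p)"
      using p by (simp only: powr_add[symmetric]) (simp add: diff_divide_distrib)
    finally show ?thesis .
  qed
  have "measure lebesgue S \<le> 2 * (W powr (1 / p) * V powr ((p - 1) / p))"
    using le[OF l] e1 e2 by simp
  then have "measure lebesgue S powr p \<le> (2 * (W powr (1 / p) * V powr ((p - 1) / p))) powr p"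
    using p by (intro powr_mono2) auto
  also have "\<dots> = 2 powr p * W * V powr (p - 1)"
    using p WV by (simp add: powr_mult powr_powr)
  finally show ?thesis .
qed (use W V p in simp)

text \<open>
  The \<open>A\<^sub>p\<^sup>+\<close> condition on an open interval \<open>J\<close> of the line, with explicit constant.  It is used
  for the positive half-line and, after reflection, for the negative one.
\<close>

definition Ap_plus_on :: "real set \<Rightarrow> real \<Rightarrow> real \<Rightarrow> (real \<Rightarrow> real) \<Rightarrow> bool" where
  "Ap_plus_on J p K w \<longleftrightarrow> w \<in> borel_measurable lebesgue \<and> (AE t in lebesgue. t \<in> J \<longrightarrow> 0 < w t) \<and>
    (\<forall>a b c. a \<in> J \<longrightarrow> c \<in> J \<longrightarrow> a < b \<longrightarrow> b < c \<longrightarrow>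
      (\<integral>\<^sup>+t\<in>{a..b}. ennreal (w t) \<partial>lebesgue)
      * ennreal_powr (\<integral>\<^sup>+t\<in>{b..c}. ennreal (w t powr (1 - conj_exponent p)) \<partial>lebesgue) (p - 1)
      \<le> ennreal (K * (c - a) powr p))"

text \<open>Both integrals in the condition are nonzero, since \<open>w > 0\<close> almost everywhere; as their product is
  finite, so is each of them.\<close>

lemma Ap_plus_on_finite:
  assumes ap: "Ap_plus_on J p K w" and J: "open J" "is_interval J" and p: "1 < p"
    and ab: "a \<in> J" "b \<in> J"
  shows "(\<integral>\<^sup>+t\<in>{a..b}. ennreal (w t) \<partial>lebesgue) < \<infinity>"
    "(\<integral>\<^sup>+t\<in>{a..b}. ennreal (w t powr (1 - conj_exponent p)) \<partial>lebesgue) < \<infinity>"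
proof -
  have "(\<integral>\<^sup>+t\<in>{a..b}. ennreal (w t) \<partial>lebesgue) < \<infinity> \<and>
    (\<integral>\<^sup>+t\<in>{a..b}. ennreal (w t powr (1 - conj_exponent p)) \<partial>lebesgue) < \<infinity>"
  proof (cases "a < b")
    case False
    then have "{a..b} = {} \<or> {a..b} = {a}" by auto
    then have "{a..b} \<in> null_sets lebesgue" by (auto simp: null_sets_def)
    then show ?thesis by (simp add: nn_integral_null_set)
  next
    case True
    have w: "w \<in> borel_measurable lebesgue" and pos: "AE t in lebesgue. t \<in> J \<longrightarrow> 0 < w t"
      using ap by (auto simp: Ap_plus_on_def)
    have sub: "{x..y} \<subseteq> J" if "x \<in> J" "y \<in> J" for x y
      using mem_is_interval_1_I[OF J(2) that] by auto
    obtain e1 where e1: "0 < e1" "ball a e1 \<subseteq> J" by (rule openE[OF J(1) ab(1)])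
    obtain e2 where e2: "0 < e2" "ball b e2 \<subseteq> J" by (rule openE[OF J(1) ab(2)])
    define a' where "a' = a - e1 / 2"
    define c' where "c' = b + e2 / 2"
    have "a' \<in> ball a e1" "c' \<in> ball b e2" using e1 e2 by (auto simp: a'_def c'_def dist_real_def)
    then have J': "a' \<in> J" "c' \<in> J" using e1 e2 by blast+
    have lt: "a' < a" "b < c'" using e1 e2 by (auto simp: a'_def c'_def)
    have m: "(\<lambda>t. w t powr (1 - conj_exponent p)) \<in> borel_measurable lebesgue" using w by measurable
    have W0: "(\<integral>\<^sup>+t\<in>{x..y}. ennreal (w t) \<partial>lebesgue) \<noteq> 0"
      and V0: "(\<integral>\<^sup>+t\<in>{x..y}. ennreal (w t powr (1 - conj_exponent p)) \<partial>lebesgue) \<noteq> 0"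
      if "x \<in> J" "y \<in> J" "x < y" for x y
    proof -
      have "AE t in lebesgue. t \<in> {x..y} \<longrightarrow> 0 < w t"
        using pos sub[OF that(1,2)] by (auto elim!: eventually_mono)
      moreover from this have "AE t in lebesgue. t \<in> {x..y} \<longrightarrow> 0 < w t powr (1 - conj_exponent p)"
        by eventually_elim auto
      moreover have "{x..y} \<in> sets lebesgue" "emeasure lebesgue {x..y} \<noteq> 0"
        using that by (auto simp: ennreal_eq_0_iff)
      ultimately show "(\<integral>\<^sup>+t\<in>{x..y}. ennreal (w t) \<partial>lebesgue) \<noteq> 0"
        "(\<integral>\<^sup>+t\<in>{x..y}. ennreal (w t powr (1 - conj_exponent p)) \<partial>lebesgue) \<noteq> 0"
        using nn_integral_pos_on[OF w] nn_integral_pos_on[OF m] by blast+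
    qed
    have bound: "(\<integral>\<^sup>+t\<in>{x..y}. ennreal (w t) \<partial>lebesgue)
      * ennreal_powr (\<integral>\<^sup>+t\<in>{y..z}. ennreal (w t powr (1 - conj_exponent p)) \<partial>lebesgue) (p - 1)
      \<le> ennreal (K * (z - x) powr p)" if "x \<in> J" "z \<in> J" "x < y" "y < z" for x y z
      using ap that unfolding Ap_plus_on_def by blast
    have "(\<integral>\<^sup>+t\<in>{a..b}. ennreal (w t) \<partial>lebesgue)
      * ennreal_powr (\<integral>\<^sup>+t\<in>{b..c'}. ennreal (w t powr (1 - conj_exponent p)) \<partial>lebesgue) (p - 1) < \<infinity>"
      using bound[OF ab(1) J'(2) True lt(2)] by (rule le_less_trans) simp
    moreover have "(\<integral>\<^sup>+t\<in>{a'..a}. ennreal (w t) \<partial>lebesgue)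
      * ennreal_powr (\<integral>\<^sup>+t\<in>{a..b}. ennreal (w t powr (1 - conj_exponent p)) \<partial>lebesgue) (p - 1) < \<infinity>"
      using bound[OF J'(1) ab(2) lt(1) True] by (rule le_less_trans) simp
    moreover have "ennreal_powr (\<integral>\<^sup>+t\<in>{b..c'}. ennreal (w t powr (1 - conj_exponent p)) \<partial>lebesgue) (p - 1) \<noteq> 0"
      using V0[OF ab(2) J'(2) lt(2)] by (simp add: ennreal_powr_eq_0_iff)
    ultimately show ?thesis
      using W0[OF J'(1) ab(1) lt(1)]
      by (auto simp: ennreal_mult_less_top ennreal_powr_def less_top[symmetric])
  qed
  then show "(\<integral>\<^sup>+t\<in>{a..b}. ennreal (w t) \<partial>lebesgue) < \<infinity>"
    "(\<integral>\<^sup>+t\<in>{a..b}. ennreal (w t powr (1 - conj_exponent p)) \<partial>lebesgue) < \<infinity>" by auto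
qed

lemma emeasure_density_indicator:
  assumes "f \<in> borel_measurable lebesgue" "T \<in> sets lebesgue" "S \<in> sets lebesgue" "S \<subseteq> T"
  shows "emeasure (density lebesgue (\<lambda>t. ennreal (f t) * indicator T t)) S = (\<integral>\<^sup>+t\<in>S. ennreal (f t) \<partial>lebesgue)"
proof -
  have "emeasure (density lebesgue (\<lambda>t. ennreal (f t) * indicator T t)) S
      = (\<integral>\<^sup>+t. ennreal (f t) * indicator T t * indicator S t \<partial>lebesgue)"
    using assms by (intro emeasure_density) auto
  also have "\<dots> = (\<integral>\<^sup>+t\<in>S. ennreal (f t) \<partial>lebesgue)"
    using assms(4) by (intro nn_integral_cong) (auto split: split_indicator)
  finally show ?thesis .
qed

lemma Ap_plus_pair_of_weight:
  assumes ap: "Ap_plus_on J p K w" and J: "open J" "is_interval J" and p: "1 < p" and K: "2 powr p \<le> K"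
    and AB: "A \<in> J" "B \<in> J"
  shows "Ap_plus_pair (density lebesgue (\<lambda>t. ennreal (w t) * indicator {A..B} t))
    (density lebesgue (\<lambda>t. ennreal (w t powr (1 - conj_exponent p)) * indicator {A..B} t)) A B p K"
    (is "Ap_plus_pair ?M ?N A B p K")
proof -
  have w: "w \<in> borel_measurable lebesgue" and pos: "AE t in lebesgue. t \<in> J \<longrightarrow> 0 < w t"
    using ap by (auto simp: Ap_plus_on_def)
  have sub: "{A..B} \<subseteq> J" using mem_is_interval_1_I[OF J(2) AB] by auto
  define v where "v = (\<lambda>t. w t powr (1 - conj_exponent p))"
  have v: "v \<in> borel_measurable lebesgue" using w unfolding v_def by measurable
  have emM: "emeasure ?M S = (\<integral>\<^sup>+t\<in>S. ennreal (w t) \<partial>lebesgue)"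
    and emN: "emeasure ?N S = (\<integral>\<^sup>+t\<in>S. ennreal (v t) \<partial>lebesgue)"
    if "S \<in> sets lebesgue" "S \<subseteq> {A..B}" for S
    using emeasure_density_indicator[OF w _ that] emeasure_density_indicator[OF v _ that]
    by (simp_all add: v_def)
  have fin: "(\<integral>\<^sup>+t\<in>{A..B}. ennreal (w t) \<partial>lebesgue) < \<infinity>" "(\<integral>\<^sup>+t\<in>{A..B}. ennreal (v t) \<partial>lebesgue) < \<infinity>"
    using Ap_plus_on_finite[OF ap J p AB] by (auto simp: v_def)
  have ind: "{A..B} \<in> sets lebesgue" by simp
  have "emeasure ?M UNIV = (\<integral>\<^sup>+t. ennreal (w t) * indicator {A..B} t * indicator UNIV t \<partial>lebesgue)"
    using w 
    by (intro emeasure_density borel_measurable_times_ennreal borel_measurable_indicator[OF ind]) auto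
  then interpret M: finite_measure ?M
    using fin(1) by (intro finite_measureI) auto
  have "emeasure ?N UNIV = (\<integral>\<^sup>+t. ennreal (v t) * indicator {A..B} t * indicator UNIV t \<partial>lebesgue)"
    unfolding v_def using v[unfolded v_def] 
    by (intro emeasure_density borel_measurable_times_ennreal borel_measurable_indicator[OF ind]) auto
  then interpret N: finite_measure ?N
    using fin(2) by (intro finite_measureI) auto
  have p1: "1 \<le> K" using K p ge_one_powr_ge_zero[of 2 p] by linarith
  show ?thesis
  proof
    show "absolutely_continuous lebesgue ?M" "absolutely_continuous lebesgue ?N"
      using w v[unfolded v_def]
      by (auto intro!: absolutely_continuousI_density borel_measurable_times_ennreal
          borel_measurable_indicator[OF ind])
    show "measure lebesgue S powr p \<le> K * measure ?M S * measure ?N S powr (p - 1)"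
      if S: "S \<in> sets lebesgue" "S \<subseteq> {A<..<B}" for S
    proof -
      have SAB: "S \<subseteq> {A..B}" using S(2) by auto
      have Sm: "S \<in> lmeasurable" using S by (rule lmeasurable_subset_interval)
      have "measure lebesgue S powr p \<le> 2 powr p * measure ?M S * measure ?N S powr (p - 1)"
      proof (rule holder_weight[OF w Sm p])
        show "AE t in lebesgue. t \<in> S \<longrightarrow> 0 < w t" using pos SAB sub by (auto elim!: eventually_mono)
        show "(\<integral>\<^sup>+t\<in>S. ennreal (w t) \<partial>lebesgue) = ennreal (measure ?M S)"
          using emM[OF S(1) SAB] M.emeasure_eq_measure by simp
        show "(\<integral>\<^sup>+t\<in>S. ennreal (w t powr (1 - conj_exponent p)) \<partial>lebesgue) = ennreal (measure ?N S)"
          using emN[OF S(1) SAB] N.emeasure_eq_measure by (simp add: v_def)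
      qed auto
      also have "\<dots> \<le> K * measure ?M S * measure ?N S powr (p - 1)"
        using K by (intro mult_right_mono) auto
      finally show ?thesis .
    qed
    show "measure ?M {a<..<b} * measure ?N {b<..<c} powr (p - 1) \<le> K * (c - a) powr p"
      if h: "A \<le> a" "a < b" "b < c" "c \<le> B" for a b c
    proof -
      have aJ: "a \<in> J" "c \<in> J" using h sub by auto
      have "ennreal (measure ?M {a<..<b}) \<le> (\<integral>\<^sup>+t\<in>{a..b}. ennreal (w t) \<partial>lebesgue)"
        unfolding M.emeasure_eq_measure[symmetric] using h
        by (subst emM) (auto intro!: nn_integral_mono split: split_indicator)
      moreover have "ennreal (measure ?N {b<..<c}) \<le> (\<integral>\<^sup>+t\<in>{b..c}. ennreal (v t) \<partial>lebesgue)"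
        unfolding N.emeasure_eq_measure[symmetric] using h
        by (subst emN) (auto intro!: nn_integral_mono split: split_indicator)
      then have "ennreal (measure ?N {b<..<c} powr (p - 1))
          \<le> ennreal_powr (\<integral>\<^sup>+t\<in>{b..c}. ennreal (v t) \<partial>lebesgue) (p - 1)"
        using ennreal_powr_mono[of "ennreal (measure ?N {b<..<c})" _ "p - 1"] p
        by (simp add: ennreal_powr_ennreal)
      ultimately have "ennreal (measure ?M {a<..<b}) * ennreal (measure ?N {b<..<c} powr (p - 1))
        \<le> (\<integral>\<^sup>+t\<in>{a..b}. ennreal (w t) \<partial>lebesgue) * ennreal_powr (\<integral>\<^sup>+t\<in>{b..c}. ennreal (v t) \<partial>lebesgue) (p - 1)"
        by (rule mult_mono) auto
      also have "\<dots> \<le> ennreal (K * (c - a) powr p)"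
        using ap aJ h(2,3) unfolding Ap_plus_on_def v_def by blast
      finally show ?thesis
        using p1 by (simp add: ennreal_le_iff flip: ennreal_mult)
    qed
  qed (use p p1 in auto)
qed

text \<open>The constant in the weak type inequality does not depend on the compact subinterval, so \<open>J\<close> can
  be exhausted by such intervals.\<close>

lemma restricted_weak_type_on:
  assumes ap: "Ap_plus_on J p K w" and J: "open J" "is_interval J" and p: "1 < p" and K: "2 powr p \<le> K"
    and X: "\<And>n::nat. X n \<in> J" "\<And>n. Y n \<in> J" "decseq X" "incseq Y" "J \<subseteq> (\<Union>n. {X n<..<Y n})"
    and E: "E \<in> sets lebesgue" "E \<subseteq> J" and \<theta>: "0 < \<theta>"
  shows "emeasure (density lebesgue (\<lambda>t. ennreal (w t))) (sun \<theta> E \<inter> J)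
    \<le> ennreal (gain_const p K * (4 / \<theta>) powr (p - exponent_gain p K))
      * emeasure (density lebesgue (\<lambda>t. ennreal (w t))) E"
proof -
  let ?\<mu> = "density lebesgue (\<lambda>t. ennreal (w t))"
  let ?C = "ennreal (gain_const p K * (4 / \<theta>) powr (p - exponent_gain p K))"
  have w: "w \<in> borel_measurable lebesgue" using ap by (auto simp: Ap_plus_on_def)
  define E' where "E' n = E \<inter> {X n<..<Y n}" for n
  define F where "F n = sun \<theta> (E' n) \<inter> {X n<..<Y n}" for n
  have E'l: "E' n \<in> sets lebesgue" for n using E by (auto simp: E'_def)
  have inc: "incseq (\<lambda>n. {X n<..<Y n})"
    using X(3,4) unfolding incseq_def decseq_def by (force intro: less_le_trans le_less_trans)
  have incE: "incseq E'" using inc unfolding incseq_def E'_def by blast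
  have sl: "sun \<theta> (E' n) \<in> sets lebesgue" for n
  proof -
    have "E' n \<in> lmeasurable"
      by (rule lmeasurable_subset_interval[OF E'l]) (auto simp: E'_def)
    then show ?thesis using open_sun by (simp add: borel_open)
  qed
  then have Fl: "F n \<in> sets lebesgue" for n by (auto simp: F_def)
  have incF: "incseq F"
  proof (rule incseq_SucI)
    fix n
    have "sun \<theta> (E' n) \<subseteq> sun \<theta> (E' (Suc n))"
      using incE E'l by (intro sun_mono) (auto simp: incseq_Suc_iff)
    then show "F n \<subseteq> F (Suc n)" using inc unfolding F_def incseq_Suc_iff by blast
  qed
  have "sun \<theta> E \<inter> J \<subseteq> (\<Union>n. F n)"
  proof
    fix x assume x: "x \<in> sun \<theta> E \<inter> J"
    then obtain y where y: "x < y" "\<theta> * (y - x) < measure lebesgue (E \<inter> {x<..<y})"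
      by (auto simp: sun_def)
    have "(\<Union>n. E' n) = E" using X(5) E(2) by (auto simp: E'_def)
    then have "(\<Union>n. E' n \<inter> {x<..<y}) = E \<inter> {x<..<y}" by blast
    moreover have "(\<lambda>n. measure lebesgue (E' n \<inter> {x<..<y})) \<longlonglongrightarrow> measure lebesgue (\<Union>n. E' n \<inter> {x<..<y})"
    proof (rule Lim_measure_incseq)
      show "range (\<lambda>n. E' n \<inter> {x<..<y}) \<subseteq> sets lebesgue" using E'l by auto
      show "incseq (\<lambda>n. E' n \<inter> {x<..<y})" using incE unfolding incseq_def by blast
      have "emeasure lebesgue (\<Union>n. E' n \<inter> {x<..<y}) \<le> emeasure lebesgue {x<..<y}"
        by (intro emeasure_mono) auto
      then show "emeasure lebesgue (\<Union>n. E' n \<inter> {x<..<y}) \<noteq> \<infinity>"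
        using y(1) by (auto simp: top_unique)
    qed
    ultimately have "\<forall>\<^sub>F n in sequentially. \<theta> * (y - x) < measure lebesgue (E' n \<inter> {x<..<y})"
      using y(2) by (intro order_tendstoD(1)) auto
    then obtain n where n: "\<And>m. n \<le> m \<Longrightarrow> \<theta> * (y - x) < measure lebesgue (E' m \<inter> {x<..<y})"
      by (auto simp: eventually_sequentially)
    obtain m where "x \<in> {X m<..<Y m}" using x X(5) by blast
    then have "x \<in> {X (max n m)<..<Y (max n m)}" using inc unfolding incseq_def by (meson max.cobounded2 subsetD)
    moreover have "x \<in> sun \<theta> (E' (max n m))" using n[of "max n m"] y(1) by (auto simp: sun_def)
    ultimately show "x \<in> (\<Union>n. F n)" by (auto simp: F_def)
  qed
  then have "emeasure ?\<mu> (sun \<theta> E \<inter> J) \<le> emeasure ?\<mu> (\<Union>n. F n)"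
    using Fl by (intro emeasure_mono) auto
  also have "\<dots> = (SUP n. emeasure ?\<mu> (F n))"
    using Fl incF by (intro SUP_emeasure_incseq[symmetric]) auto
  also have "\<dots> \<le> ?C * emeasure ?\<mu> E"
  proof (rule SUP_least)
    fix n
    let ?M = "density lebesgue (\<lambda>t. ennreal (w t) * indicator {X n..Y n} t)"
    interpret Ap_plus_pair ?M
      "density lebesgue (\<lambda>t. ennreal (w t powr (1 - conj_exponent p)) * indicator {X n..Y n} t)" "X n" "Y n" p K
      by (rule Ap_plus_pair_of_weight[OF ap J p K X(1,2)])
    have eq: "emeasure ?\<mu> S = emeasure ?M S" if "S \<in> sets lebesgue" "S \<subseteq> {X n<..<Y n}" for S
    proof -
      have "S \<subseteq> {X n..Y n}" using that(2) by auto
      then have "emeasure ?M S = (\<integral>\<^sup>+t\<in>S. ennreal (w t) \<partial>lebesgue)"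
        by (intro emeasure_density_indicator w that) auto
      moreover have "emeasure ?\<mu> S = (\<integral>\<^sup>+t\<in>S. ennreal (w t) \<partial>lebesgue)"
        using w that(1) by (intro emeasure_density) auto
      ultimately show ?thesis by simp
    qed
    have "emeasure ?M (F n) \<le> ?C * emeasure ?M (E' n)"
      unfolding F_def using restricted_weak_type[OF E'l _ \<theta>] by (simp add: E'_def)
    then have "emeasure ?\<mu> (F n) \<le> ?C * emeasure ?\<mu> (E' n)"
      using eq[OF Fl] eq[OF E'l] by (simp add: F_def E'_def)
    also have "\<dots> \<le> ?C * emeasure ?\<mu> E"
      using E by (intro mult_left_mono emeasure_mono) (auto simp: E'_def)
    finally show "emeasure ?\<mu> (F n) \<le> ?C * emeasure ?\<mu> E" .
  qed
  finally show ?thesis .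
qed

section \<open>One-sided maximal operators on the half-line\<close>

lemma sigma_finite_halfline: "sigma_finite_measure halfline"
proof
  show "\<exists>A. countable A \<and> A \<subseteq> sets halfline \<and> \<Union> A = space halfline \<and> (\<forall>a\<in>A. emeasure halfline a \<noteq> \<infinity>)"
  proof (intro exI[of _ "range (\<lambda>n::nat. {0..real n})"] conjI ballI)
    show "range (\<lambda>n::nat. {0..real n}) \<subseteq> sets halfline" by (auto simp: sets_restrict_space_iff)
    show "\<Union> (range (\<lambda>n::nat. {0..real n})) = space halfline"
      using real_arch_simple by auto
    show "emeasure halfline a \<noteq> \<infinity>" if "a \<in> range (\<lambda>n::nat. {0..real n})" for a
      using that by (auto simp: emeasure_restrict_space)
  qed simp
qed

lemma measurable_id_halfline: "(\<lambda>x. x) \<in> borel_measurable halfline"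
  by (intro measurable_restrict_space1 measurable_completion) auto

text \<open>
  A common treatment of the two operators: the intervals \<open>I t h\<close> are either all \<open>[t,t+h]\<close> or all
  \<open>[t-h,t]\<close>, and \<open>maximal \<phi> t\<close> is the supremum of the averages of \<open>\<phi>\<close> over them.
\<close>

locale one_sided_intervals =
  fixes I :: "real \<Rightarrow> real \<Rightarrow> real set"
  assumes I: "(\<forall>t h. I t h = {t..t + h}) \<or> (\<forall>t h. I t h = {t - h..t})"
begin

definition maximal :: "(real \<Rightarrow> ennreal) \<Rightarrow> real \<Rightarrow> ennreal" where
  "maximal \<phi> t = (SUP h\<in>{0<..}. ennreal (1 / h) * (\<integral>\<^sup>+s\<in>I t h. \<phi> s \<partial>halfline))"

lemma interval_mono: "h \<le> h' \<Longrightarrow> I t h \<subseteq> I t h'"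
  using I by auto

lemma sets_interval: "I t h \<inter> {0..} \<in> sets halfline"
  using I by (auto simp: sets_restrict_space_iff)

lemma emeasure_interval_le:
  assumes h: "0 \<le> h"
  shows "emeasure halfline (I t h \<inter> {0..}) \<le> ennreal h"
proof -
  have "emeasure halfline (I t h \<inter> {0..}) = emeasure lebesgue (I t h \<inter> {0..})"
    by (intro emeasure_restrict_space) auto
  also have "\<dots> \<le> emeasure lebesgue (I t h)" using I by (intro emeasure_mono) auto
  also have "\<dots> = ennreal h" using I h by auto
  finally show ?thesis .
qed

lemma nn_integral_interval:
  "(\<integral>\<^sup>+s\<in>I t h. \<phi> s \<partial>halfline) = (\<integral>\<^sup>+s\<in>I t h \<inter> {0..}. \<phi> s \<partial>halfline)"
  by (intro nn_integral_cong) (auto split: split_indicator)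

text \<open>Widening an interval slightly, one sees that rational lengths suffice; this gives measurability.\<close>

lemma maximal_rational:
  "maximal \<phi> t = (SUP h\<in>{h \<in> \<rat>. 0 < h}. ennreal (1 / h) * (\<integral>\<^sup>+s\<in>I t h. \<phi> s \<partial>halfline))"
proof (rule antisym)
  show "maximal \<phi> t \<le> (SUP h\<in>{h \<in> \<rat>. 0 < h}. ennreal (1 / h) * (\<integral>\<^sup>+s\<in>I t h. \<phi> s \<partial>halfline))"
    (is "_ \<le> ?R")
    unfolding maximal_def
  proof (rule SUP_least)
    fix h :: real assume "h \<in> {0<..}"
    then have h: "0 < h" by simp
    let ?i = "\<integral>\<^sup>+s\<in>I t h. \<phi> s \<partial>halfline"
    have le: "ennreal (1 / h') * ?i \<le> ?R" if h': "h < h'" for h'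
    proof -
      obtain q where q: "q \<in> \<rat>" "h < q" "q < h'" using Rats_dense_in_real[OF h'] by auto
      have "ennreal (1 / h') * ?i \<le> ennreal (1 / q) * (\<integral>\<^sup>+s\<in>I t q. \<phi> s \<partial>halfline)"
      proof (rule mult_mono)
        show "ennreal (1 / h') \<le> ennreal (1 / q)" using q h by (intro ennreal_leI) (simp add: field_simps)
        show "?i \<le> (\<integral>\<^sup>+s\<in>I t q. \<phi> s \<partial>halfline)"
          using interval_mono[of h q t] q by (intro nn_integral_mono) (auto split: split_indicator)
      qed auto
      also have "\<dots> \<le> ?R" using q h by (intro SUP_upper) auto
      finally show ?thesis .
    qed
    show "ennreal (1 / h) * ?i \<le> ?R"
    proof (cases ?R)
      case (real R)
      have "ennreal (1 / (2 * h)) * ?i < \<infinity>" using le[of "2 * h"] h real by (simp add: le_less_trans[OF _ ennreal_less_top])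
      then obtain j where j: "?i = ennreal j" "0 \<le> j"
        using h by (cases ?i) (auto simp: ennreal_mult_less_top)
      have "j \<le> R * h' " if "h < h'" for h'
      proof -
        have "ennreal (1 / h' * j) \<le> ennreal R"
          using le[OF that] h that unfolding real(2) j(1) by (subst ennreal_mult') auto
        then show ?thesis using h that real by (simp add: ennreal_le_iff field_simps)
      qed
      then have "j \<le> R * h + e" if "0 < e" for e
      proof -
        have "j \<le> R * (h + e / (R + 1))" using that real \<open>\<And>h'. h < h' \<Longrightarrow> j \<le> R * h'\<close> by simp
        also have "\<dots> \<le> R * h + e" using that real by (simp add: field_simps)
        finally show ?thesis .
      qed
      then have "j \<le> R * h" by (rule field_le_epsilon)
      then have "1 / h * j \<le> R" using h by (simp add: field_simps)
      then have "ennreal (1 / h * j) \<le> ennreal R" by (rule ennreal_leI)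
      then show ?thesis unfolding j(1) real(2) using h by (subst ennreal_mult'[symmetric]) auto
    next
      case top
      then show ?thesis by (metis top_greatest)
    qed
  qed
  show "?R \<le> maximal \<phi> t" unfolding maximal_def by (rule SUP_subset_mono) auto
qed

lemma measurable_maximal:
  assumes \<phi>: "\<phi> \<in> borel_measurable halfline"
  shows "maximal \<phi> \<in> borel_measurable halfline"
proof -
  interpret sigma_finite_measure halfline by (rule sigma_finite_halfline)
  have *: "(\<lambda>t. \<integral>\<^sup>+s\<in>I t h. \<phi> s \<partial>halfline) \<in> borel_measurable halfline" for h
  proof (rule borel_measurable_nn_integral)
    let ?P = "halfline \<Otimes>\<^sub>M halfline"
    have fs: "fst \<in> borel_measurable ?P" "snd \<in> borel_measurable ?P"
      using measurable_compose[OF measurable_fst measurable_id_halfline]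
        measurable_compose[OF measurable_snd measurable_id_halfline] by auto
    have "{x \<in> space ?P. fst x \<le> snd x \<and> snd x \<le> fst x + h} \<in> sets ?P"
      "{x \<in> space ?P. fst x - h \<le> snd x \<and> snd x \<le> fst x} \<in> sets ?P"
      using fs by measurable
    then have s: "{x \<in> space ?P. snd x \<in> I (fst x) h} \<in> sets ?P" using I by auto
    have "(\<lambda>x. \<phi> (snd x) * indicator {x \<in> space ?P. snd x \<in> I (fst x) h} x) \<in> borel_measurable ?P"
      using s measurable_compose[OF measurable_snd \<phi>]
      by (intro borel_measurable_times_ennreal borel_measurable_indicator)
    moreover have "\<phi> (snd x) * indicator {x \<in> space ?P. snd x \<in> I (fst x) h} x =
        (case x of (t, s) \<Rightarrow> \<phi> s * indicator (I t h) s)" if "x \<in> space ?P" for x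
      using that by (auto split: split_indicator prod.split)
    ultimately show "(\<lambda>(t, s). \<phi> s * indicator (I t h) s) \<in> borel_measurable ?P"
      by (simp cong: measurable_cong)
  qed
  have "countable {h \<in> \<rat>. (0::real) < h}" using countable_rat by (rule countable_subset[rotated]) auto
  then have "(\<lambda>t. SUP h\<in>{h \<in> \<rat>. 0 < h}. ennreal (1 / h) * (\<integral>\<^sup>+s\<in>I t h. \<phi> s \<partial>halfline)) \<in> borel_measurable halfline"
    using * by (intro borel_measurable_SUP borel_measurable_times_ennreal) auto
  then show ?thesis using maximal_rational by (simp cong: measurable_cong)
qed

lemma maximal_le_sum:
  assumes E: "\<And>k::nat. E k \<in> sets halfline"
    and le: "AE s in halfline. \<phi> s \<le> a + (\<Sum>k. c k * indicator (E k) s)"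
  shows "maximal \<phi> t \<le> a + (\<Sum>k. c k * maximal (indicator (E k)) t)"
  unfolding maximal_def
proof (rule SUP_least)
  fix h :: real assume "h \<in> {0<..}"
  then have h: "0 < h" by simp
  let ?J = "I t h \<inter> {0..}"
  have "(\<integral>\<^sup>+s\<in>?J. \<phi> s \<partial>halfline)
      \<le> (\<integral>\<^sup>+s. a * indicator ?J s + (\<Sum>k. c k * (indicator (E k) s * indicator ?J s)) \<partial>halfline)"
  proof (rule nn_integral_mono_AE)
    show "AE s in halfline. \<phi> s * indicator ?J s
        \<le> a * indicator ?J s + (\<Sum>k. c k * (indicator (E k) s * indicator ?J s))"
      using le by eventually_elim (auto split: split_indicator simp: mult.assoc)
  qed
  also have "\<dots> = a * emeasure halfline ?J
      + (\<Sum>k. c k * (\<integral>\<^sup>+s. indicator (E k) s * indicator ?J s \<partial>halfline))"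
    using E sets_interval
    by (subst nn_integral_add)
      (auto simp: nn_integral_suminf nn_integral_cmult intro!: borel_measurable_suminf borel_measurable_times_ennreal)
  finally have *: "(\<integral>\<^sup>+s\<in>I t h. \<phi> s \<partial>halfline)
      \<le> a * emeasure halfline ?J + (\<Sum>k. c k * (\<integral>\<^sup>+s\<in>I t h. indicator (E k) s \<partial>halfline))"
    by (simp add: nn_integral_interval)
  have "ennreal (1 / h) * (\<integral>\<^sup>+s\<in>I t h. \<phi> s \<partial>halfline)
      \<le> ennreal (1 / h) * (a * emeasure halfline ?J + (\<Sum>k. c k * (\<integral>\<^sup>+s\<in>I t h. indicator (E k) s \<partial>halfline)))"
    by (rule mult_left_mono[OF *]) simp
  also have "\<dots> = a * (ennreal (1 / h) * emeasure halfline ?J)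
      + (\<Sum>k. c k * (ennreal (1 / h) * (\<integral>\<^sup>+s\<in>I t h. indicator (E k) s \<partial>halfline)))"
    by (simp add: distrib_left mult.left_commute flip: ennreal_suminf_cmult)
  also have "\<dots> \<le> a * 1 + (\<Sum>k. c k * (SUP h\<in>{0<..}. ennreal (1 / h) * (\<integral>\<^sup>+s\<in>I t h. indicator (E k) s \<partial>halfline)))"
  proof (intro add_mono mult_left_mono suminf_le)
    have "ennreal (1 / h) * emeasure halfline ?J \<le> ennreal (1 / h) * ennreal h"
      using emeasure_interval_le h by (intro mult_left_mono) auto
    also have "\<dots> = 1" using h by (simp flip: ennreal_mult)
    finally show "ennreal (1 / h) * emeasure halfline ?J \<le> 1" .
    show "ennreal (1 / h) * (\<integral>\<^sup>+s\<in>I t h. indicator (E k) s \<partial>halfline)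
      \<le> (SUP h\<in>{0<..}. ennreal (1 / h) * (\<integral>\<^sup>+s\<in>I t h. indicator (E k) s \<partial>halfline))" for k
      using h by (intro SUP_upper) auto
  qed auto
  finally show "ennreal (1 / h) * (\<integral>\<^sup>+s\<in>I t h. \<phi> s \<partial>halfline)
    \<le> a + (\<Sum>k. c k * (SUP h\<in>{0<..}. ennreal (1 / h) * (\<integral>\<^sup>+s\<in>I t h. indicator (E k) s \<partial>halfline)))"
    by simp
qed

text \<open>The weak type \<open>(r,r)\<close> inequality with respect to \<open>\<mu>\<close>, restricted to characteristic functions.\<close>

definition weak_type_on_indicators :: "real measure \<Rightarrow> real \<Rightarrow> real \<Rightarrow> bool" where
  "weak_type_on_indicators \<mu> r C \<longleftrightarrow> (\<forall>E\<in>sets halfline. \<forall>\<theta>>0.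
    emeasure \<mu> {t \<in> {0..}. ennreal \<theta> < maximal (indicator E) t}
      \<le> ennreal (C * \<theta> powr (- r)) * emeasure \<mu> E)"

end

section \<open>Rearrangements\<close>

lemma decreasing_rearrangement_antimono: "t \<le> t' \<Longrightarrow> decreasing_rearrangement M f t' \<le> decreasing_rearrangement M f t"
  unfolding decreasing_rearrangement_def
  by (intro Inf_superset_mono) (auto intro: order_trans ennreal_leI)

lemma decreasing_rearrangement_leI:
  "distribution_fun M f s \<le> ennreal t \<Longrightarrow> decreasing_rearrangement M f t \<le> s"
  unfolding decreasing_rearrangement_def by (rule Inf_lower) simp

text \<open>The infimum in the definition of the rearrangement is attained, because the distribution function
  is continuous from the right.\<close>

lemma distribution_fun_rearrangement_le:
  assumes f: "f \<in> borel_measurable M"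
  shows "distribution_fun M f (decreasing_rearrangement M f t) \<le> ennreal t"
proof -
  let ?S = "{s. distribution_fun M f s \<le> ennreal t}"
  have "\<infinity> \<in> ?S" by (simp add: distribution_fun_def)
  then have "?S \<noteq> {}" by blast
  then obtain X :: "nat \<Rightarrow> ennreal" where X: "decseq X" "range X \<subseteq> ?S" "Inf ?S = (INF i. X i)"
    using ennreal_Inf_countable_INF by meson
  let ?A = "\<lambda>i. {x \<in> space M. X i < f x}"
  have A: "?A i \<in> sets M" for i using f by measurable
  have "{x \<in> space M. Inf ?S < f x} = (\<Union>i. ?A i)"
    unfolding X(3) by (auto simp: INF_less_iff)
  then have "distribution_fun M f (decreasing_rearrangement M f t) = emeasure M (\<Union>i. ?A i)"
    by (simp add: distribution_fun_def decreasing_rearrangement_def)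
  also have "\<dots> = (SUP i. emeasure M (?A i))"
  proof (rule SUP_emeasure_incseq[symmetric])
    show "range ?A \<subseteq> sets M" using A by auto
    show "incseq ?A" using X(1) by (force simp: incseq_def decseq_def intro: le_less_trans)
  qed
  also have "\<dots> \<le> ennreal t"
    using X(2) by (intro SUP_least) (auto simp: distribution_fun_def)
  finally show ?thesis .
qed

text \<open>
  The function is cut into pieces supported in \<open>E\<^sub>k = {\<phi> > \<phi>\<^sup>*(t / 2\<^sup>k)}\<close>, which has measure at most
  \<open>t / 2\<^sup>k\<close>.  The weak type inequality is used for \<open>E\<^sub>k\<close> at height \<open>A / 2\<^bsup>u k\<^esup>\<close>; the exceptional
  sets then have total measure at most \<open>t\<close>.
\<close>

lemma (in one_sided_intervals) rearrangement_maximal_le: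
  fixes \<mu> :: "real measure" and r C u :: real
  assumes \<mu>: "sets \<mu> = sets halfline" "null_sets \<mu> \<subseteq> null_sets halfline"
    and wt: "weak_type_on_indicators \<mu> r C" and r: "0 < r" and C: "0 \<le> C" and u: "u * r < 1"
    and \<phi>: "\<phi> \<in> borel_measurable halfline" and t: "0 < t"
  defines "A \<equiv> ((C + 1) / (1 - 2 powr (u * r - 1))) powr (1 / r)"
  shows "decreasing_rearrangement \<mu> (maximal \<phi>) t \<le> decreasing_rearrangement \<mu> \<phi> t +
    (\<Sum>k. ennreal (A * 2 powr (- (u * real k))) * decreasing_rearrangement \<mu> \<phi> (t / 2 ^ Suc k))"
proof -
  let ?g = "decreasing_rearrangement \<mu> \<phi>"
  have sp: "space \<mu> = {0..}" using sets_eq_imp_space_eq[OF \<mu>(1)] by simp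
  have \<phi>': "\<phi> \<in> borel_measurable \<mu>" using \<phi> measurable_cong_sets[OF \<mu>(1) refl] by blast
  define x where "x = 2 powr (u * r - 1)"
  have x: "0 < x" "x < 1" using u powr_less_mono[of "u * r - 1" 0 2] by (auto simp: x_def)
  have A0: "0 < A" using C x by (simp add: A_def x_def[symmetric])
  have Ar: "A powr (- r) = (1 - x) / (C + 1)"
    using r C x by (simp add: A_def x_def[symmetric] powr_powr powr_minus)
  define s where "s k = A * 2 powr (- (u * real k))" for k :: nat
  have s: "0 < s k" for k using A0 by (simp add: s_def)
  define E where "E k = {y \<in> space \<mu>. ?g (t / 2 ^ k) < \<phi> y}" for k :: nat
  have El: "E k \<in> sets halfline" for k
  proof -
    have "E k \<in> sets \<mu>" unfolding E_def using \<phi>' by measurable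
    then show ?thesis by (simp only: \<mu>(1))
  qed
  have Em: "emeasure \<mu> (E k) \<le> ennreal (t / 2 ^ k)" for k
    using distribution_fun_rearrangement_le[OF \<phi>', of "t / 2 ^ k"] by (simp add: distribution_fun_def E_def)
  have null: "(\<Inter>k. E k) \<in> null_sets halfline"
  proof -
    have "emeasure \<mu> (\<Inter>k. E k) \<le> ennreal (t / 2 ^ k)" for k
    proof -
      have "emeasure \<mu> (\<Inter>k. E k) \<le> emeasure \<mu> (E k)"
        using El \<mu>(1) by (intro emeasure_mono) auto
      then show ?thesis using Em order_trans by blast
    qed
    moreover have "(\<lambda>k. ennreal (t / 2 ^ k)) \<longlonglongrightarrow> ennreal 0"
      by (intro tendsto_ennrealI LIMSEQ_divide_realpow_zero) auto
    ultimately have "emeasure \<mu> (\<Inter>k. E k) \<le> ennreal 0"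
      by (intro LIMSEQ_le_const) auto
    then have "(\<Inter>k. E k) \<in> null_sets \<mu>" using El \<mu>(1) by (intro null_setsI) auto
    then show ?thesis using \<mu>(2) by blast
  qed
  have "AE y in halfline. \<phi> y \<le> ?g t + (\<Sum>k. ?g (t / 2 ^ Suc k) * indicator (E k) y)"
    using AE_not_in[OF null] AE_space
  proof eventually_elim
    case (elim y)
    then have y: "y \<in> space \<mu>" using sp by simp
    from elim obtain k where k: "y \<notin> E k" by auto
    define m where "m = (LEAST k. y \<notin> E k)"
    have m: "y \<notin> E m" unfolding m_def using k by (rule LeastI)
    show ?case
    proof (cases m)
      case 0
      then have "\<phi> y \<le> ?g t" using m y by (simp add: E_def not_less)
      then show ?thesis by (simp add: add_increasing2)
    next
      case (Suc j)
      then have "y \<in> E j" using not_less_Least[of j "\<lambda>k. y \<notin> E k"] unfolding m_def by simp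
      moreover have "\<phi> y \<le> ?g (t / 2 ^ Suc j)" using m y Suc by (simp add: E_def not_less)
      ultimately have "\<phi> y \<le> (\<Sum>k\<in>{j}. ?g (t / 2 ^ Suc k) * indicator (E k) y)" by simp
      also have "\<dots> \<le> (\<Sum>k. ?g (t / 2 ^ Suc k) * indicator (E k) y)" by (intro sum_le_suminf) auto
      finally show ?thesis by (simp add: add_increasing)
    qed
  qed
  from maximal_le_sum[OF El this]
  have le: "maximal \<phi> y \<le> ?g t + (\<Sum>k. ?g (t / 2 ^ Suc k) * maximal (indicator (E k)) y)" for y .
  define G where "G = ?g t + (\<Sum>k. ennreal (s k) * ?g (t / 2 ^ Suc k))"
  define B where "B k = {y \<in> {0..}. ennreal (s k) < maximal (indicator (E k)) y}" for k
  have Bl: "B k \<in> sets \<mu>" for k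
  proof -
    have "maximal (indicator (E k)) \<in> borel_measurable halfline"
      using El by (intro measurable_maximal) auto
    then have "{y \<in> space halfline. ennreal (s k) < maximal (indicator (E k)) y} \<in> sets halfline"
      by measurable
    then show ?thesis using \<mu>(1) by (simp add: B_def)
  qed
  have "{y \<in> space \<mu>. G < maximal \<phi> y} \<subseteq> (\<Union>k. B k)"
  proof
    fix y assume y: "y \<in> {y \<in> space \<mu>. G < maximal \<phi> y}"
    show "y \<in> (\<Union>k. B k)"
    proof (rule ccontr)
      assume "y \<notin> (\<Union>k. B k)"
      then have "maximal (indicator (E k)) y \<le> ennreal (s k)" for k
        using y sp by (auto simp: B_def not_less)
      then have "(\<Sum>k. ?g (t / 2 ^ Suc k) * maximal (indicator (E k)) y) \<le> (\<Sum>k. ennreal (s k) * ?g (t / 2 ^ Suc k))"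
        by (intro suminf_le) (auto simp: mult.commute intro: mult_right_mono)
      then have "maximal \<phi> y \<le> G" using le[of y] unfolding G_def by (meson add_left_mono order_trans)
      then show False using y by (simp add: leD)
    qed
  qed
  then have "distribution_fun \<mu> (maximal \<phi>) G \<le> emeasure \<mu> (\<Union>k. B k)"
    unfolding distribution_fun_def using Bl by (intro emeasure_mono) auto
  also have "\<dots> \<le> (\<Sum>k. emeasure \<mu> (B k))" using Bl by (intro emeasure_subadditive_countably) auto
  also have "\<dots> \<le> (\<Sum>k. ennreal (t * (1 - x) * x ^ k))"
  proof (intro suminf_le)
    fix k
    have "emeasure \<mu> (B k) \<le> ennreal (C * s k powr (- r)) * emeasure \<mu> (E k)"
      using wt El s unfolding weak_type_on_indicators_def B_def by blast
    also have "\<dots> \<le> ennreal (C * s k powr (- r)) * ennreal (t / 2 ^ k)" by (intro mult_left_mono Em) simp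
    also have "\<dots> = ennreal (C * s k powr (- r) * (t / 2 ^ k))" using t C by (simp flip: ennreal_mult)
    also have "\<dots> \<le> ennreal (t * (1 - x) * x ^ k)"
    proof (rule ennreal_leI)
      have "x ^ k = 2 powr ((u * r - 1) * real k)"
        using x by (simp add: x_def powr_powr flip: powr_realpow)
      also have "(u * r - 1) * real k = u * real k * r - real k" by (simp add: algebra_simps)
      also have "2 powr \<dots> = 2 powr (u * real k * r) / 2 ^ k" by (simp add: powr_diff powr_realpow)
      finally have xk: "x ^ k = 2 powr (u * real k * r) / 2 ^ k" .
      have "s k powr (- r) = A powr (- r) * 2 powr (u * real k * r)"
        using A0 by (simp add: s_def powr_mult powr_powr)
      then have "C * s k powr (- r) * (t / 2 ^ k) = (C / (C + 1)) * (t * (1 - x) * x ^ k)"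
        unfolding Ar xk by (simp add: divide_inverse mult_ac)
      also have "\<dots> \<le> 1 * (t * (1 - x) * x ^ k)"
        using C t x by (intro mult_right_mono) auto
      finally show "C * s k powr (- r) * (t / 2 ^ k) \<le> t * (1 - x) * x ^ k" by simp
    qed
    finally show "emeasure \<mu> (B k) \<le> ennreal (t * (1 - x) * x ^ k)" .
  qed auto
  also have "\<dots> = ennreal (t * (1 - x) * (1 / (1 - x)))"
  proof (rule suminf_ennreal_eq)
    show "(\<lambda>k. t * (1 - x) * x ^ k) sums (t * (1 - x) * (1 / (1 - x)))"
      using x by (intro sums_mult geometric_sums) auto
  qed (use t x in auto)
  also have "\<dots> = ennreal t" using x by simp
  finally show ?thesis unfolding G_def s_def by (rule decreasing_rearrangement_leI)
qed

section \<open>Weights on the half-line\<close>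

text \<open>A weight on the half-line as a function on the whole line.\<close>

definition extend_zero :: "(real \<Rightarrow> real) \<Rightarrow> real \<Rightarrow> real" where
  "extend_zero w t = (if t \<in> {0..} then w t else 0)"

lemma weightD:
  assumes "weight w"
  shows "w \<in> borel_measurable halfline" "AE t in halfline. 0 < w t"
  using assms unfolding weight_def by blast+

lemma extend_zero_measurable: "weight w \<Longrightarrow> extend_zero w \<in> borel_measurable lebesgue"
  unfolding extend_zero_def using borel_measurable_if[of "{0..}" w] weightD(1) by simp

lemma extend_zero_pos:
  assumes "weight w"
  shows "AE t in lebesgue. t \<in> {0<..} \<longrightarrow> 0 < extend_zero w t"
proof -
  have "{0..} \<inter> space lebesgue \<in> sets (lebesgue :: real measure)" by simp
  from weightD(2)[OF assms, unfolded AE_restrict_space_iff[OF this]]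
  show ?thesis by eventually_elim (simp add: extend_zero_def)
qed

lemma nn_integral_extend_zero:
  assumes "S \<subseteq> {0..}"
  shows "(\<integral>\<^sup>+t\<in>S. F (w t) \<partial>halfline) = (\<integral>\<^sup>+t\<in>S. F (extend_zero w t) \<partial>lebesgue)"
proof -
  have "(\<integral>\<^sup>+t\<in>S. F (w t) \<partial>halfline) = (\<integral>\<^sup>+t. F (w t) * indicator S t * indicator {0..} t \<partial>lebesgue)"
    by (subst nn_integral_restrict_space) auto
  also have "\<dots> = (\<integral>\<^sup>+t\<in>S. F (extend_zero w t) \<partial>lebesgue)"
    using assms by (intro nn_integral_cong) (auto simp: extend_zero_def split: split_indicator)
  finally show ?thesis .
qed

lemma sets_halfline: "S \<in> sets halfline \<longleftrightarrow> S \<in> sets lebesgue \<and> S \<subseteq> {0..}"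
  by (subst sets_restrict_space_iff) auto

lemma emeasure_weighted_measure:
  assumes "weight w" "S \<in> sets halfline"
  shows "emeasure (weighted_measure w) S = (\<integral>\<^sup>+t\<in>S. ennreal (extend_zero w t) \<partial>lebesgue)"
proof -
  have "emeasure (weighted_measure w) S = (\<integral>\<^sup>+t\<in>S. ennreal (w t) \<partial>halfline)"
    unfolding weighted_measure_def using assms(2) weightD(1)[OF assms(1)] by (intro emeasure_density) auto
  then show ?thesis using nn_integral_extend_zero[of S ennreal] assms(2) by (simp add: sets_halfline)
qed

lemma null_sets_weighted_measure:
  assumes w: "weight w"
  shows "null_sets (weighted_measure w) \<subseteq> null_sets halfline"
proof
  fix X assume "X \<in> null_sets (weighted_measure w)"
  then have X: "X \<in> sets halfline" "AE t in halfline. t \<in> X \<longrightarrow> ennreal (w t) = 0"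
    using weightD(1)[OF w] unfolding weighted_measure_def by (simp_all add: null_sets_density_iff)
  from X(2) weightD(2)[OF w] have "AE t in halfline. t \<notin> X" by eventually_elim (auto simp: ennreal_eq_0_iff)
  then show "X \<in> null_sets halfline" using X(1) by (simp add: AE_iff_null_sets)
qed

lemma SUP_finite_bound:
  fixes F :: "'a \<Rightarrow> ennreal"
  assumes "(SUP x\<in>X. F x) < \<infinity>"
  obtains K where "0 \<le> K" "\<And>x. x \<in> X \<Longrightarrow> F x \<le> ennreal K"
proof -
  obtain K where K: "0 \<le> K" "(SUP x\<in>X. F x) = ennreal K"
    using assms by (cases "SUP x\<in>X. F x") auto
  then have "F x \<le> ennreal K" if "x \<in> X" for x using SUP_upper[OF that, of F] by simp
  with K(1) show ?thesis using that by blast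
qed

lemma mult_le_from_normalized:
  assumes d: "0 < d" and K: "0 \<le> K" "K \<le> K'" and le: "ennreal (1 / d) * W * V \<le> ennreal K"
  shows "W * V \<le> ennreal (K' * d)"
proof -
  have "W * V = ennreal d * (ennreal (1 / d) * W * V)"
    using d by (simp add: mult.assoc[symmetric] flip: ennreal_mult)
  also have "\<dots> \<le> ennreal d * ennreal K" using le by (rule mult_left_mono) simp
  also have "\<dots> \<le> ennreal (K' * d)" 
    using d K by (simp add: mult.commute ennreal_leI mult_right_mono flip: ennreal_mult)
  finally show ?thesis .
qed

lemma Ap_plus_on_extend_zero:
  assumes w: "w \<in> Ap_plus p"
  obtains K where "2 powr p \<le> K" "Ap_plus_on {0<..} p K (extend_zero w)"
proof -
  have wt: "weight w" using w by (simp add: Ap_plus_def)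
  obtain K0 where K0: "0 \<le> K0" "\<And>abc. abc \<in> {(a, b, c). 0 \<le> a \<and> a < b \<and> b < c} \<Longrightarrow>
    (case abc of (a, b, c) \<Rightarrow> ennreal (1 / (c - a) powr p)
        * (\<integral>\<^sup>+t\<in>{a..b}. ennreal (w t) \<partial>halfline)
        * ennreal_powr (\<integral>\<^sup>+t\<in>{b..c}. ennreal (w t powr (1 - conj_exponent p)) \<partial>halfline) (p - 1)) \<le> ennreal K0"
    using SUP_finite_bound[of "\<lambda>abc. case abc of (a, b, c) \<Rightarrow> ennreal (1 / (c - a) powr p)
        * (\<integral>\<^sup>+t\<in>{a..b}. ennreal (w t) \<partial>halfline)
        * ennreal_powr (\<integral>\<^sup>+t\<in>{b..c}. ennreal (w t powr (1 - conj_exponent p)) \<partial>halfline) (p - 1)"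
        "{(a, b, c). 0 \<le> a \<and> a < b \<and> b < c}"] w
    unfolding Ap_plus_def by blast
  let ?K = "max K0 (2 powr p)"
  have "Ap_plus_on {0<..} p ?K (extend_zero w)"
    unfolding Ap_plus_on_def
  proof (intro conjI allI impI)
    fix a b c :: real assume h: "a \<in> {0<..}" "c \<in> {0<..}" "a < b" "b < c"
    have "ennreal (1 / (c - a) powr p)
        * (\<integral>\<^sup>+t\<in>{a..b}. ennreal (w t) \<partial>halfline)
        * ennreal_powr (\<integral>\<^sup>+t\<in>{b..c}. ennreal (w t powr (1 - conj_exponent p)) \<partial>halfline) (p - 1) \<le> ennreal K0"
      using K0(2)[of "(a, b, c)"] h by simp
    moreover have "{a..b} \<subseteq> {0..}" "{b..c} \<subseteq> {0..}" using h by auto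
    ultimately have "ennreal (1 / (c - a) powr p)
        * (\<integral>\<^sup>+t\<in>{a..b}. ennreal (extend_zero w t) \<partial>lebesgue)
        * ennreal_powr (\<integral>\<^sup>+t\<in>{b..c}. ennreal (extend_zero w t powr (1 - conj_exponent p)) \<partial>lebesgue) (p - 1)
        \<le> ennreal K0"
      using nn_integral_extend_zero[of "{a..b}" ennreal w]
        nn_integral_extend_zero[of "{b..c}" "\<lambda>x. ennreal (x powr (1 - conj_exponent p))" w] by simp
    then show "(\<integral>\<^sup>+t\<in>{a..b}. ennreal (extend_zero w t) \<partial>lebesgue)
        * ennreal_powr (\<integral>\<^sup>+t\<in>{b..c}. ennreal (extend_zero w t powr (1 - conj_exponent p)) \<partial>lebesgue) (p - 1)
        \<le> ennreal (?K * (c - a) powr p)"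
      using h K0(1) by (intro mult_le_from_normalized[of "(c - a) powr p" K0]) auto
  qed (use extend_zero_measurable[OF wt] extend_zero_pos[OF wt] in auto)
  then show ?thesis by (intro that[of ?K]) auto
qed

text \<open>The reflection \<open>t \<mapsto> -t\<close> turns \<open>A\<^sub>p\<^sup>-\<close> on the half-line into \<open>A\<^sub>p\<^sup>+\<close> on the negative
  half-line.\<close>

lemma Ap_plus_on_reflect_extend_zero:
  assumes w: "w \<in> Ap_minus p"
  obtains K where "2 powr p \<le> K" "Ap_plus_on {..<0} p K (\<lambda>t. extend_zero w (- t))"
proof -
  have wt: "weight w" using w by (simp add: Ap_minus_def)
  have wm: "extend_zero w \<in> borel_measurable lebesgue" using extend_zero_measurable[OF wt] .
  obtain K0 where K0: "0 \<le> K0" "\<And>abc. abc \<in> {(a, b, c). 0 \<le> a \<and> a < b \<and> b < c} \<Longrightarrow>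
    (case abc of (a, b, c) \<Rightarrow> ennreal (1 / (c - a) powr p)
        * (\<integral>\<^sup>+t\<in>{b..c}. ennreal (w t) \<partial>halfline)
        * ennreal_powr (\<integral>\<^sup>+t\<in>{a..b}. ennreal (w t powr (1 - conj_exponent p)) \<partial>halfline) (p - 1)) \<le> ennreal K0"
    using SUP_finite_bound[of "\<lambda>abc. case abc of (a, b, c) \<Rightarrow> ennreal (1 / (c - a) powr p)
        * (\<integral>\<^sup>+t\<in>{b..c}. ennreal (w t) \<partial>halfline)
        * ennreal_powr (\<integral>\<^sup>+t\<in>{a..b}. ennreal (w t powr (1 - conj_exponent p)) \<partial>halfline) (p - 1)"
        "{(a, b, c). 0 \<le> a \<and> a < b \<and> b < c}"] w
    unfolding Ap_minus_def by blast
  let ?K = "max K0 (2 powr p)"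
  have refl: "(\<integral>\<^sup>+t\<in>{x..y}. F (extend_zero w (- t)) \<partial>lebesgue) = (\<integral>\<^sup>+t\<in>{-y..-x}. F (extend_zero w t) \<partial>lebesgue)"
    if F: "F \<in> borel_measurable borel" for F :: "real \<Rightarrow> ennreal" and x y
  proof -
    have "(\<lambda>t. F (extend_zero w t) * indicator {-y..-x} t) \<in> borel_measurable lebesgue"
      using measurable_compose[OF wm F] by (intro borel_measurable_times_ennreal borel_measurable_indicator) auto
    from nn_integral_lebesgue_uminus[OF this]
    have "(\<integral>\<^sup>+t\<in>{-y..-x}. F (extend_zero w t) \<partial>lebesgue)
        = (\<integral>\<^sup>+t. F (extend_zero w (- t)) * indicator {-y..-x} (- t) \<partial>lebesgue)" by simp
    also have "\<dots> = (\<integral>\<^sup>+t\<in>{x..y}. F (extend_zero w (- t)) \<partial>lebesgue)"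
      by (intro nn_integral_cong) (auto split: split_indicator)
    finally show ?thesis by simp
  qed
  have "Ap_plus_on {..<0} p ?K (\<lambda>t. extend_zero w (- t))"
    unfolding Ap_plus_on_def
  proof (intro conjI allI impI)
    show "(\<lambda>t. extend_zero w (- t)) \<in> borel_measurable lebesgue"
      using measurable_compose[OF measurable_uminus_lebesgue wm] .
    have "AE t in distr lebesgue lebesgue uminus. t \<in> {0<..} \<longrightarrow> 0 < extend_zero w t"
      using extend_zero_pos[OF wt] unfolding lebesgue_distr_uminus .
    from AE_distrD[OF measurable_uminus_lebesgue this]
    show "AE t in lebesgue. t \<in> {..<0} \<longrightarrow> 0 < extend_zero w (- t)" by simp
    fix a b c :: real assume h: "a \<in> {..<0}" "c \<in> {..<0}" "a < b" "b < c"
    have "ennreal (1 / (-a - (-c)) powr p)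
        * (\<integral>\<^sup>+t\<in>{-b..-a}. ennreal (w t) \<partial>halfline)
        * ennreal_powr (\<integral>\<^sup>+t\<in>{-c..-b}. ennreal (w t powr (1 - conj_exponent p)) \<partial>halfline) (p - 1) \<le> ennreal K0"
      using K0(2)[of "(-c, -b, -a)"] h by simp
    moreover have "{-b..-a} \<subseteq> {0..}" "{-c..-b} \<subseteq> {0..}" using h by auto
    ultimately have "ennreal (1 / (c - a) powr p)
        * (\<integral>\<^sup>+t\<in>{a..b}. ennreal (extend_zero w (- t)) \<partial>lebesgue)
        * ennreal_powr (\<integral>\<^sup>+t\<in>{b..c}. ennreal (extend_zero w (- t) powr (1 - conj_exponent p)) \<partial>lebesgue) (p - 1)
        \<le> ennreal K0"
      using nn_integral_extend_zero[of "{-b..-a}" ennreal w] refl[of ennreal a b]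
        nn_integral_extend_zero[of "{-c..-b}" "\<lambda>x. ennreal (x powr (1 - conj_exponent p))" w]
        refl[of "\<lambda>x. ennreal (x powr (1 - conj_exponent p))" b c]
      by (simp add: minus_diff_commute)
    then show "(\<integral>\<^sup>+t\<in>{a..b}. ennreal (extend_zero w (- t)) \<partial>lebesgue)
        * ennreal_powr (\<integral>\<^sup>+t\<in>{b..c}. ennreal (extend_zero w (- t) powr (1 - conj_exponent p)) \<partial>lebesgue) (p - 1)
        \<le> ennreal (?K * (c - a) powr p)"
      using h K0(1) by (intro mult_le_from_normalized[of "(c - a) powr p" K0]) auto
  qed
  then show ?thesis by (intro that[of ?K]) auto
qed

lemma (in one_sided_intervals) maximal_indicator_gt:
  assumes E: "E \<in> sets halfline" and \<theta>: "0 < \<theta>" and gt: "ennreal \<theta> < maximal (indicator E) t"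
  obtains h where "0 < h" "\<theta> * h < measure lebesgue (E \<inter> I t h)"
proof -
  obtain h where h: "0 < h" "ennreal \<theta> < ennreal (1 / h) * (\<integral>\<^sup>+s\<in>I t h. indicator E s \<partial>halfline)"
    using gt unfolding maximal_def less_SUP_iff by auto
  have El: "E \<in> sets lebesgue" "E \<subseteq> {0..}" using E by (auto simp: sets_halfline)
  have Il: "I t h \<in> lmeasurable" using I by auto
  have fin: "E \<inter> I t h \<in> lmeasurable" using fmeasurable_Int_fmeasurable[OF Il El(1)] by (simp add: Int_commute)
  have "(\<integral>\<^sup>+s\<in>I t h. indicator E s \<partial>halfline) = (\<integral>\<^sup>+s. indicator (E \<inter> I t h) s \<partial>halfline)"
    by (intro nn_integral_cong) (auto split: split_indicator)
  also have "\<dots> = emeasure halfline (E \<inter> I t h)"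
    using El fin by (intro nn_integral_indicator) (auto simp: sets_halfline)
  also have "\<dots> = emeasure lebesgue (E \<inter> I t h)"
    using El by (intro emeasure_restrict_space) auto
  also have "\<dots> = ennreal (measure lebesgue (E \<inter> I t h))" using fin by (simp add: emeasure_eq_measure2)
  finally have "ennreal \<theta> < ennreal (1 / h * measure lebesgue (E \<inter> I t h))"
    using h by (subst ennreal_mult') auto
  then have "\<theta> < 1 / h * measure lebesgue (E \<inter> I t h)" using \<theta> by (simp add: ennreal_less_iff)
  then show ?thesis using h(1) by (intro that[of h]) (simp_all add: field_simps)
qed

interpretation plus: one_sided_intervals "\<lambda>t h. {t..t + h}"
  by standard simp

interpretation minus: one_sided_intervals "\<lambda>t h. {t - h..t}"
  by standard simp

text \<open>The point \<open>0\<close>, which belongs to the half-line but not to \<open>(0,\<infinity>)\<close>, carries no mass.\<close>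

lemma emeasure_weighted_le:
  assumes w: "weight w" and S: "S \<in> sets halfline" and T: "T \<in> sets lebesgue" "S \<subseteq> insert 0 T"
  shows "emeasure (weighted_measure w) S \<le> emeasure (density lebesgue (\<lambda>t. ennreal (extend_zero w t))) T"
proof -
  have wm: "extend_zero w \<in> borel_measurable lebesgue" using extend_zero_measurable[OF w] .
  have "AE t in lebesgue. t \<notin> {0::real}" by (rule AE_not_in) (simp add: null_sets_def)
  then have "AE t in lebesgue. ennreal (extend_zero w t) * indicator S t \<le> ennreal (extend_zero w t) * indicator T t"
    by eventually_elim (use T in \<open>auto split: split_indicator\<close>)
  then have "emeasure (weighted_measure w) S \<le> (\<integral>\<^sup>+t\<in>T. ennreal (extend_zero w t) \<partial>lebesgue)"
    unfolding emeasure_weighted_measure[OF w S] by (rule nn_integral_mono_AE)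
  also have "\<dots> = emeasure (density lebesgue (\<lambda>t. ennreal (extend_zero w t))) T"
    using wm T by (intro emeasure_density[symmetric]) auto
  finally show ?thesis .
qed

lemma exhaust_positive:
  "{0<..} \<subseteq> (\<Union>n. {1 / real (Suc n)<..<real (Suc (Suc n))})"
proof
  fix x :: real assume "x \<in> {0<..}"
  then have x: "0 < x" by simp
  obtain m where m: "1 / real (Suc m) < x" using x nat_approx_posE by blast
  obtain n where n: "x < real n" using reals_Archimedean2 by blast
  have "1 / real (Suc (max m n)) \<le> 1 / real (Suc m)" by (intro divide_left_mono) auto
  then have "x \<in> {1 / real (Suc (max m n))<..<real (Suc (Suc (max m n)))}" using m n by auto
  then show "x \<in> (\<Union>n. {1 / real (Suc n)<..<real (Suc (Suc n))})" by blast
qed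

lemma weak_type_plus:
  assumes w: "w \<in> Ap_plus p" and p: "1 < p"
  obtains r C where "0 < r" "r < p" "0 \<le> C" "plus.weak_type_on_indicators (weighted_measure w) r C"
proof -
  have wt: "weight w" using w by (simp add: Ap_plus_def)
  obtain K where K: "2 powr p \<le> K" "Ap_plus_on {0<..} p K (extend_zero w)"
    by (rule Ap_plus_on_extend_zero[OF w])
  have K1: "1 \<le> K" using K(1) p ge_one_powr_ge_zero[of 2 p] by linarith
  define r where "r = p - exponent_gain p K"
  define C where "C = gain_const p K * 4 powr r"
  have r: "0 < r" "r < p" using exponent_gain_bounds[OF p K1] by (auto simp: r_def)
  have C: "0 \<le> C" by (simp add: C_def gain_const_def)
  have "plus.weak_type_on_indicators (weighted_measure w) r C"
    unfolding plus.weak_type_on_indicators_def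
  proof (intro ballI allI impI)
    fix E :: "real set" and \<theta> :: real
    assume E: "E \<in> sets halfline" and \<theta>: "0 < \<theta>"
    let ?S = "{t \<in> {0..}. ennreal \<theta> < plus.maximal (indicator E) t}"
    let ?\<mu> = "density lebesgue (\<lambda>t. ennreal (extend_zero w t))"
    define E' where "E' = E \<inter> {0<..}"
    have El: "E \<in> sets lebesgue" "E \<subseteq> {0..}" using E by (auto simp: sets_halfline)
    have E': "E' \<in> sets lebesgue" "E' \<subseteq> {0<..}" using El by (auto simp: E'_def)
    have "plus.maximal (indicator E) \<in> borel_measurable halfline"
      using E by (intro plus.measurable_maximal) auto
    then have "{t \<in> space halfline. ennreal \<theta> < plus.maximal (indicator E) t} \<in> sets halfline" by measurable
    then have S: "?S \<in> sets halfline" by simp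
    have sub: "?S \<subseteq> insert 0 (sun \<theta> E' \<inter> {0<..})"
    proof
      fix t assume t: "t \<in> ?S"
      then obtain h where h: "0 < h" "\<theta> * h < measure lebesgue (E \<inter> {t..t + h})"
        using plus.maximal_indicator_gt[OF E \<theta>] by blast
      have "measure lebesgue (E' \<inter> {t<..<t + h}) = measure lebesgue (E \<inter> {t..t + h})"
      proof (rule measure_lebesgue_cong_finite[of _ "{0, t, t + h}"])
        show "E \<inter> {t..t + h} \<in> lmeasurable"
          using fmeasurable_Int_fmeasurable[of "{t..t + h}" lebesgue E] El by (simp add: Int_commute)
      qed (use El in \<open>auto simp: E'_def\<close>)
      then have "t \<in> sun \<theta> E'" using h unfolding sun_def by (auto intro!: exI[of _ "t + h"])
      then show "t \<in> insert 0 (sun \<theta> E' \<inter> {0<..})" using t by auto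
    qed
    have T: "sun \<theta> E' \<inter> {0<..} \<in> sets lebesgue"
      using open_sun_lebesgue[OF E'(1)] by (simp add: borel_open)
    have "emeasure (weighted_measure w) ?S \<le> emeasure ?\<mu> (sun \<theta> E' \<inter> {0<..})"
      by (rule emeasure_weighted_le[OF wt S T sub])
    also have "\<dots> \<le> ennreal (gain_const p K * (4 / \<theta>) powr (p - exponent_gain p K)) * emeasure ?\<mu> E'"
    proof (rule restricted_weak_type_on[OF K(2) _ _ p K(1) _ _ _ _ exhaust_positive E' \<theta>])
      show "decseq (\<lambda>n. 1 / real (Suc n))" by (auto simp: decseq_def frac_le)
      show "incseq (\<lambda>n. real (Suc (Suc n)))" by (auto simp: incseq_def)
    qed (auto simp: is_interval_oi)
    also have "gain_const p K * (4 / \<theta>) powr (p - exponent_gain p K) = C * \<theta> powr (- r)"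
      unfolding r_def[symmetric] C_def by (simp add: powr_divide powr_minus_divide)
    also have "emeasure ?\<mu> E' \<le> emeasure (weighted_measure w) E"
    proof -
      have "emeasure ?\<mu> E' = (\<integral>\<^sup>+t\<in>E'. ennreal (extend_zero w t) \<partial>lebesgue)"
        using E' extend_zero_measurable[OF wt] by (intro emeasure_density) auto
      also have "\<dots> \<le> (\<integral>\<^sup>+t\<in>E. ennreal (extend_zero w t) \<partial>lebesgue)"
        by (intro nn_integral_mono) (auto simp: E'_def split: split_indicator)
      finally show ?thesis by (simp add: emeasure_weighted_measure[OF wt E])
    qed
    finally show "emeasure (weighted_measure w) ?S
        \<le> ennreal (C * \<theta> powr (- r)) * emeasure (weighted_measure w) E"
      by (simp add: mult_left_mono)
  qed
  then show ?thesis using that r C by blast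
qed

lemma weak_type_minus:
  assumes w: "w \<in> Ap_minus p" and p: "1 < p"
  obtains r C where "0 < r" "r < p" "0 \<le> C" "minus.weak_type_on_indicators (weighted_measure w) r C"
proof -
  have wt: "weight w" using w by (simp add: Ap_minus_def)
  have wm: "extend_zero w \<in> borel_measurable lebesgue" using extend_zero_measurable[OF wt] .
  obtain K where K: "2 powr p \<le> K" "Ap_plus_on {..<0} p K (\<lambda>t. extend_zero w (- t))"
    by (rule Ap_plus_on_reflect_extend_zero[OF w])
  have K1: "1 \<le> K" using K(1) p ge_one_powr_ge_zero[of 2 p] by linarith
  define r where "r = p - exponent_gain p K"
  define C where "C = gain_const p K * 4 powr r"
  have r: "0 < r" "r < p" using exponent_gain_bounds[OF p K1] by (auto simp: r_def)
  have C: "0 \<le> C" by (simp add: C_def gain_const_def)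
  let ?\<mu> = "density lebesgue (\<lambda>t. ennreal (extend_zero w t))"
  let ?\<mu>' = "density lebesgue (\<lambda>t. ennreal (extend_zero w (- t)))"
  have refl: "emeasure ?\<mu>' X = emeasure ?\<mu> (uminus -` X)" if X: "X \<in> sets lebesgue" for X
  proof -
    have "(\<lambda>t. ennreal (extend_zero w (- t)) * indicator X t) \<in> borel_measurable lebesgue"
      using measurable_compose[OF measurable_uminus_lebesgue wm] X
      by (intro borel_measurable_times_ennreal borel_measurable_indicator) auto
    from nn_integral_lebesgue_uminus[OF this]
    have "emeasure ?\<mu>' X = (\<integral>\<^sup>+t. ennreal (extend_zero w t) * indicator X (- t) \<partial>lebesgue)"
      using measurable_compose[OF measurable_uminus_lebesgue wm] X by (subst emeasure_density) auto
    also have "\<dots> = (\<integral>\<^sup>+t\<in>uminus -` X. ennreal (extend_zero w t) \<partial>lebesgue)"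
      by (intro nn_integral_cong) (auto split: split_indicator)
    also have "\<dots> = emeasure ?\<mu> (uminus -` X)"
      using wm vimage_uminus_sets_lebesgue[OF X] by (intro emeasure_density[symmetric]) auto
    finally show ?thesis .
  qed
  have "minus.weak_type_on_indicators (weighted_measure w) r C"
    unfolding minus.weak_type_on_indicators_def
  proof (intro ballI allI impI)
    fix E :: "real set" and \<theta> :: real
    assume E: "E \<in> sets halfline" and \<theta>: "0 < \<theta>"
    let ?S = "{t \<in> {0..}. ennreal \<theta> < minus.maximal (indicator E) t}"
    define E' where "E' = uminus -` (E \<inter> {0<..})"
    have El: "E \<in> sets lebesgue" "E \<subseteq> {0..}" using E by (auto simp: sets_halfline)
    have E0: "E \<inter> {0<..} \<in> sets lebesgue" using El by auto
    have E': "E' \<in> sets lebesgue" "E' \<subseteq> {..<0}"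
      using vimage_uminus_sets_lebesgue[OF E0] by (auto simp: E'_def)
    have EE: "uminus -` E' = E \<inter> {0<..}" by (auto simp: E'_def)
    let ?T = "sun \<theta> E' \<inter> {..<0}"
    have T: "?T \<in> sets lebesgue"
      using open_sun_lebesgue[OF E'(1)] by (simp add: borel_open)
    have "minus.maximal (indicator E) \<in> borel_measurable halfline"
      using E by (intro minus.measurable_maximal) auto
    then have "{t \<in> space halfline. ennreal \<theta> < minus.maximal (indicator E) t} \<in> sets halfline" by measurable
    then have S: "?S \<in> sets halfline" by simp
    have sub: "?S \<subseteq> insert 0 (uminus -` ?T)"
    proof
      fix t assume t: "t \<in> ?S"
      then obtain h where h: "0 < h" "\<theta> * h < measure lebesgue (E \<inter> {t - h..t})"
        using minus.maximal_indicator_gt[OF E \<theta>] by blast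
      have s: "E \<inter> {0<..} \<inter> {t - h<..<t} \<in> sets lebesgue" using E0 by auto
      have "measure lebesgue (E' \<inter> {- t<..<- t + h}) = measure lebesgue (uminus -` (E \<inter> {0<..} \<inter> {t - h<..<t}))"
        by (rule arg_cong[where f = "measure lebesgue"]) (auto simp: E'_def)
      also have "\<dots> = measure lebesgue (E \<inter> {0<..} \<inter> {t - h<..<t})"
        by (rule measure_lebesgue_uminus[OF s])
      also have "\<dots> = measure lebesgue (E \<inter> {t - h..t})"
      proof (rule measure_lebesgue_cong_finite[of _ "{0, t, t - h}"])
        show "E \<inter> {t - h..t} \<in> lmeasurable"
          using fmeasurable_Int_fmeasurable[of "{t - h..t}" lebesgue E] El by (simp add: Int_commute)
      qed (use El in auto)
      finally have "- t \<in> sun \<theta> E'" using h unfolding sun_def by (auto intro!: exI[of _ "- t + h"])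
      then show "t \<in> insert 0 (uminus -` ?T)" using t by auto
    qed
    have "emeasure (weighted_measure w) ?S \<le> emeasure ?\<mu> (uminus -` ?T)"
      by (rule emeasure_weighted_le[OF wt S vimage_uminus_sets_lebesgue[OF T] sub])
    also have "\<dots> = emeasure ?\<mu>' ?T" using refl[OF T] by simp
    also have "\<dots> \<le> ennreal (gain_const p K * (4 / \<theta>) powr (p - exponent_gain p K)) * emeasure ?\<mu>' E'"
    proof (rule restricted_weak_type_on[OF K(2) _ _ p K(1) _ _ _ _ _ E' \<theta>])
      show "decseq (\<lambda>n. - real (Suc (Suc n)))" by (auto simp: decseq_def)
      show "incseq (\<lambda>n. - (1 / real (Suc n)))" by (auto simp: incseq_def frac_le)
      show "{..<0} \<subseteq> (\<Union>n. {- real (Suc (Suc n))<..<- (1 / real (Suc n))})"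
      proof
        fix x :: real assume "x \<in> {..<0}"
        then have "- x \<in> (\<Union>n. {1 / real (Suc n)<..<real (Suc (Suc n))})"
          by (intro subsetD[OF exhaust_positive]) simp
        then obtain n where "- x \<in> {1 / real (Suc n)<..<real (Suc (Suc n))}" by blast
        then have "x \<in> {- real (Suc (Suc n))<..<- (1 / real (Suc n))}" by simp
        then show "x \<in> (\<Union>n. {- real (Suc (Suc n))<..<- (1 / real (Suc n))})" by blast
      qed
    qed (auto simp: is_interval_io)
    also have "gain_const p K * (4 / \<theta>) powr (p - exponent_gain p K) = C * \<theta> powr (- r)"
      unfolding r_def[symmetric] C_def by (simp add: powr_divide powr_minus_divide)
    also have "emeasure ?\<mu>' E' \<le> emeasure (weighted_measure w) E"
    proof -
      have "emeasure ?\<mu>' E' = emeasure ?\<mu> (E \<inter> {0<..})" using refl[OF E'(1)] by (simp only: EE)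
      also have "\<dots> = (\<integral>\<^sup>+t\<in>E \<inter> {0<..}. ennreal (extend_zero w t) \<partial>lebesgue)"
        using E0 wm by (intro emeasure_density) auto
      also have "\<dots> \<le> (\<integral>\<^sup>+t\<in>E. ennreal (extend_zero w t) \<partial>lebesgue)"
        by (intro nn_integral_mono) (auto split: split_indicator)
      finally show ?thesis by (simp add: emeasure_weighted_measure[OF wt E])
    qed
    finally show "emeasure (weighted_measure w) ?S
        \<le> ennreal (C * \<theta> powr (- r)) * emeasure (weighted_measure w) E"
      by (simp add: mult_left_mono)
  qed
  then show ?thesis using that r C by blast
qed

section \<open>Function norms and dilations\<close>

context banach_function_norm
begin

lemma norm_cong_AE:
  assumes "f \<in> borel_measurable M" "g \<in> borel_measurable M" "AE x in M. f x = g x"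
  shows "\<rho> f = \<rho> g"
  using assms by (intro antisym norm_mono) (auto elim!: eventually_mono)

lemma norm_zero: "\<rho> (\<lambda>_. 0) = 0"
  by (subst norm_eq_0_iff) auto

lemma norm_suminf:
  fixes F :: "nat \<Rightarrow> 'a \<Rightarrow> ennreal"
  assumes F: "\<And>i. F i \<in> borel_measurable M"
  shows "\<rho> (\<lambda>x. \<Sum>i. F i x) \<le> (\<Sum>i. \<rho> (F i))"
proof -
  have Fm: "(\<lambda>x. \<Sum>i<n. F i x) \<in> borel_measurable M" for n :: nat
    using F by (intro borel_measurable_sum) auto
  have fin: "\<rho> (\<lambda>x. \<Sum>i<n. F i x) \<le> (\<Sum>i<n. \<rho> (F i))" for n
  proof (induction n)
    case (Suc n)
    have "\<rho> (\<lambda>x. (\<Sum>i<n. F i x) + F n x) \<le> \<rho> (\<lambda>x. \<Sum>i<n. F i x) + \<rho> (F n)"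
      by (rule norm_triangle[OF Fm F])
    also have "\<dots> \<le> (\<Sum>i<n. \<rho> (F i)) + \<rho> (F n)" using Suc by (rule add_right_mono)
    finally show ?case by simp
  qed (simp add: norm_zero)
  have "(\<lambda>n. \<rho> (\<lambda>x. \<Sum>i<n. F i x)) \<longlonglongrightarrow> \<rho> (\<lambda>x. \<Sum>i. F i x)"
  proof (rule norm_Fatou[OF Fm])
    show "(\<lambda>x. \<Sum>i. F i x) \<in> borel_measurable M" by (intro borel_measurable_suminf_order F)
    show "AE x in M. incseq (\<lambda>n. \<Sum>i<n. F i x) \<and> (\<lambda>n. \<Sum>i<n. F i x) \<longlonglongrightarrow> (\<Sum>i. F i x)"
      by (intro AE_I2 conjI incseq_SucI summable_LIMSEQ summableI) simp
  qed
  then show ?thesis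
    by (rule LIMSEQ_le_const2)
      (use fin sum_le_suminf[of "\<lambda>i. \<rho> (F i)"] in
        \<open>meson finite_lessThan order_trans summableI zero_le\<close>)
qed

end

lemma antimono_measurable_halfline:
  fixes g :: "real \<Rightarrow> ennreal"
  assumes g: "antimono g"
  shows "g \<in> borel_measurable halfline"
proof (rule borel_measurableI_greater)
  fix y
  have "is_interval {x. y < g x}"
    unfolding is_interval_1 using g by (auto simp: antimono_def intro: less_le_trans)
  then have "{x. y < g x} \<in> sets lebesgue" using real_interval_borel_measurable by simp
  then have "{0..} \<inter> {x. y < g x} \<in> sets halfline" by (auto simp: sets_halfline)
  then show "{x \<in> space halfline. y < g x} \<in> sets halfline" by (simp add: Int_def)
qed

lemma AE_halfline_pos: "AE s in halfline. (0::real) < s"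
proof -
  have "{0} \<in> null_sets halfline" by (simp add: null_sets_def sets_halfline emeasure_restrict_space)
  from AE_not_in[OF this] AE_space show ?thesis by eventually_elim auto
qed

text \<open>A decreasing function of finite norm is finite, except possibly at \<open>0\<close>.\<close>

lemma antimono_norm_finite:
  assumes \<rho>: "banach_function_norm halfline \<rho>" and g: "antimono g" and fin: "\<rho> g < \<infinity>" and t: "0 < t"
  shows "g t < \<infinity>"
proof (rule ccontr)
  assume "\<not> g t < \<infinity>"
  then have gt: "g t = \<infinity>" by (metis infinity_ennreal_def less_top)
  interpret banach_function_norm halfline \<rho> by fact
  let ?i = "indicator {0..t} :: real \<Rightarrow> ennreal"
  have s: "{0..t} \<in> sets halfline" by (simp add: sets_halfline)
  have im: "?i \<in> borel_measurable halfline" using s by simp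
  have le: "ennreal (real n) * \<rho> ?i \<le> \<rho> g" for n :: nat
  proof -
    have "ennreal (real n) * \<rho> ?i = \<rho> (\<lambda>x. ennreal (real n) * ?i x)"
      using norm_scale[OF im, of "real n"] by simp
    also have "\<dots> \<le> \<rho> g"
    proof (rule norm_mono)
      show "AE x in halfline. ennreal (real n) * ?i x \<le> g x"
      proof (rule AE_I2)
        fix x
        have "g x = \<infinity>" if "x \<le> t" using g that gt by (metis antimonoD top.extremum_unique infinity_ennreal_def)
        then show "ennreal (real n) * ?i x \<le> g x" by (auto split: split_indicator)
      qed
    qed (use im antimono_measurable_halfline[OF g] in auto)
    finally show ?thesis .
  qed
  have "\<rho> ?i \<noteq> 0"
  proof
    assume "\<rho> ?i = 0"
    then have "AE x in halfline. ?i x = 0" using norm_eq_0_iff[OF im] by simp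
    then have "AE x in halfline. x \<notin> {0..t}" by eventually_elim (auto split: split_indicator_asm)
    then have "emeasure halfline {0..t} = 0" using s AE_iff_null_sets by (metis null_setsD1)
    then show False using t by (simp add: emeasure_restrict_space ennreal_eq_0_iff)
  qed
  moreover obtain G where G: "\<rho> g = ennreal G" "0 \<le> G" using fin by (cases "\<rho> g") auto
  moreover have "\<rho> ?i \<le> ennreal G" using le[of 1] G by simp
  ultimately obtain i where i: "\<rho> ?i = ennreal i" "0 < i"
    by (cases "\<rho> ?i") (auto simp: ennreal_eq_0_iff top_unique not_le)
  obtain n where "G < real n * i" using reals_Archimedean3[OF i(2)] by blast
  moreover have "ennreal (real n * i) \<le> ennreal G" using le[of n] i G by (simp add: ennreal_mult)
  ultimately show False using G(2) by (simp add: ennreal_le_iff)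
qed

text \<open>
  The dilation norm is a supremum over complex-valued functions.  It applies to a decreasing
  \<open>[0,\<infinity>]\<close>-valued function of finite norm, since this is finite almost everywhere.
\<close>

lemma norm_dilation_le:
  assumes \<rho>: "banach_function_norm halfline \<rho>" and g: "antimono g" and fin: "\<rho> g < \<infinity>" and \<tau>: "0 < \<tau>"
  shows "\<rho> (\<lambda>s. g (s / \<tau>)) \<le> dilation_norm \<rho> \<tau> * \<rho> g"
proof -
  interpret banach_function_norm halfline \<rho> by fact
  have gd: "antimono (\<lambda>s. g (s / \<tau>))"
    using g \<tau> by (auto simp: antimono_def divide_right_mono)
  have gm: "g \<in> borel_measurable halfline" and gdm: "(\<lambda>s. g (s / \<tau>)) \<in> borel_measurable halfline"
    using antimono_measurable_halfline g gd by blast+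
  obtain R where R: "\<rho> g = ennreal R" "0 \<le> R" using fin by (cases "\<rho> g") auto
  show ?thesis
  proof (cases "R = 0")
    case True
    then have "AE s in halfline. g s = 0" using norm_eq_0_iff[OF gm] R by simp
    have z: "g s = 0" if s: "0 < s" for s
    proof (rule ccontr)
      assume "g s \<noteq> 0"
      have "AE x in halfline. x \<notin> {0..s}"
        using \<open>AE s in halfline. g s = 0\<close>
      proof eventually_elim
        case (elim x)
        then show ?case using antimonoD[OF g, of x s] \<open>g s \<noteq> 0\<close> by auto
      qed
      moreover have "{0..s} \<in> sets halfline" by (simp add: sets_halfline)
      ultimately have "emeasure halfline {0..s} = 0" using AE_iff_null_sets by (metis null_setsD1)
      then show False using s by (simp add: emeasure_restrict_space ennreal_eq_0_iff)
    qed
    have "AE s in halfline. g (s / \<tau>) = 0"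
      using AE_halfline_pos by eventually_elim (use z \<tau> in auto)
    then have "\<rho> (\<lambda>s. g (s / \<tau>)) = 0" using norm_eq_0_iff[OF gdm] by simp
    then show ?thesis by simp
  next
    case False
    then have R0: "0 < R" using R by simp
    define f :: "real \<Rightarrow> complex" where "f s = complex_of_real (1 / R * enn2real (g s))" for s
    have nf: "ennreal (norm (f s)) = ennreal (1 / R) * g s" if "0 < s" for s
    proof -
      have "g s < \<infinity>" by (rule antimono_norm_finite[OF \<rho> g fin that])
      then have "ennreal (enn2real (g s)) = g s" by (simp add: less_top)
      moreover have "norm (f s) = 1 / R * enn2real (g s)" using R0 by (simp add: f_def norm_mult norm_divide)
      ultimately show ?thesis using R0 by (simp add: ennreal_mult' del: times_divide_eq_left)
    qed
    have fm: "f \<in> borel_measurable halfline" unfolding f_def using gm by measurable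
    have fdm: "(\<lambda>s. f (s / \<tau>)) \<in> borel_measurable halfline" unfolding f_def using gdm by measurable
    have "bfs_norm \<rho> f = \<rho> (\<lambda>s. ennreal (1 / R) * g s)"
      unfolding bfs_norm_def
    proof (rule norm_cong_AE)
      show "AE s in halfline. ennreal (norm (f s)) = ennreal (1 / R) * g s"
        using AE_halfline_pos by eventually_elim (rule nf)
    qed (use fm gm in measurable)
    also have "\<dots> = ennreal (1 / R) * ennreal R" using norm_scale[OF gm, of "1 / R"] R0 R by simp
    also have "\<dots> = 1" using R0 by (simp flip: ennreal_mult)
    finally have f1: "bfs_norm \<rho> f = 1" .
    then have "f \<in> {f \<in> bfs \<rho>. bfs_norm \<rho> f \<le> 1}" using fm by (simp add: bfs_def)
    then have le: "bfs_norm \<rho> (\<lambda>s. f (s / \<tau>)) \<le> dilation_norm \<rho> \<tau>"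
      unfolding dilation_norm_def by (rule SUP_upper)
    have "bfs_norm \<rho> (\<lambda>s. f (s / \<tau>)) = \<rho> (\<lambda>s. ennreal (1 / R) * g (s / \<tau>))"
      unfolding bfs_norm_def
    proof (rule norm_cong_AE)
      show "AE s in halfline. ennreal (norm (f (s / \<tau>))) = ennreal (1 / R) * g (s / \<tau>)"
        using AE_halfline_pos by eventually_elim (use nf \<tau> in simp)
    qed (use fdm gdm in measurable)
    also have "\<dots> = ennreal (1 / R) * \<rho> (\<lambda>s. g (s / \<tau>))" using norm_scale[OF gdm, of "1 / R"] R0 by simp
    finally have eq: "bfs_norm \<rho> (\<lambda>s. f (s / \<tau>)) = ennreal (1 / R) * \<rho> (\<lambda>s. g (s / \<tau>))" .
    have "\<rho> (\<lambda>s. g (s / \<tau>)) = ennreal R * bfs_norm \<rho> (\<lambda>s. f (s / \<tau>))"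
      unfolding eq using R0 by (simp add: mult.assoc[symmetric] flip: ennreal_mult)
    also have "\<dots> \<le> ennreal R * dilation_norm \<rho> \<tau>" using le by (rule mult_left_mono) simp
    finally show ?thesis using R by (simp add: mult.commute)
  qed
qed

text \<open>
  Only a finite, nonzero dilation norm with positive logarithm makes the quotient in the definition
  of the index positive: \<open>enn2real \<infinity> = 0\<close>, \<open>ln 0 = 0\<close> and division by \<open>0\<close> all lead to the value \<open>0\<close>.
\<close>

lemma dilation_norm_le_powr:
  assumes idx: "has_lower_boyd_index \<rho> p" and p: "0 < p" and v: "1 / p < v"
  shows "\<forall>\<^sub>F t in at_top. dilation_norm \<rho> t \<le> ennreal (t powr v)"
proof -
  have v0: "0 < v" using divide_pos_pos[OF zero_less_one p] v by linarith
  have "1 / v < p" using p v v0 by (simp add: field_simps)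
  then have "\<forall>\<^sub>F t in at_top. 1 / v < ln t / ln (enn2real (dilation_norm \<rho> t))"
    using idx unfolding has_lower_boyd_index_def by (rule order_tendstoD(1)[rotated])
  then show ?thesis using eventually_gt_at_top[of 1]
  proof eventually_elim
    case (elim t)
    let ?h = "enn2real (dilation_norm \<rho> t)"
    have lt: "0 < ln t" using elim by simp
    have "0 < ln t / ln ?h" using elim(1) divide_pos_pos[OF zero_less_one v0] by linarith
    then have lh: "0 < ln ?h" using lt by (simp add: zero_less_divide_iff)
    then have h: "?h \<noteq> 0" by auto
    then have h0: "0 < ?h" using enn2real_nonneg[of "dilation_norm \<rho> t"] by linarith
    have "dilation_norm \<rho> t \<noteq> \<infinity>" using h by auto
    then have eq: "dilation_norm \<rho> t = ennreal ?h" by (simp add: less_top)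
    have "ln ?h < v * ln t" using elim(1) lh v0 by (simp add: field_simps)
    also have "\<dots> = ln (t powr v)" using elim by (simp add: ln_powr)
    finally have "?h \<le> t powr v" using h0 elim by (subst (asm) ln_less_cancel_iff) auto
    then show ?case by (subst eq) (rule ennreal_leI)
  qed
qed

text \<open>
  A superposition of dyadic dilations, of the kind that dominates the rearranged maximal function.
  The bound \<open>2\<^bsup>v k\<^esup>\<close> for the dilation norm is available for large \<open>k\<close> only; as \<open>g\<close> is decreasing, the
  dilation by \<open>2\<^bsup>k+1\<^esup>\<close> may be replaced with that by \<open>2\<^bsup>k+1+n\<^esup>\<close> for a fixed large \<open>n\<close>.
\<close>

lemma norm_dilation_series_le:
  assumes \<rho>: "banach_function_norm halfline \<rho>" and idx: "has_lower_boyd_index \<rho> p" and p: "0 < p"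
    and u: "1 / p < u" and A: "0 \<le> A"
  obtains C where "0 \<le> C" "\<And>g. antimono g \<Longrightarrow> \<rho> g < \<infinity> \<Longrightarrow>
    \<rho> (\<lambda>t. g t + (\<Sum>k. ennreal (A * 2 powr (- (u * real k))) * g (t / 2 ^ Suc k))) \<le> ennreal C * \<rho> g"
proof -
  interpret banach_function_norm halfline \<rho> by fact
  obtain v where v: "1 / p < v" "v < u" using dense[OF u] by blast
  have v0: "0 < v" using divide_pos_pos[OF zero_less_one p] v(1) by linarith
  obtain T where T: "\<And>t. T \<le> t \<Longrightarrow> dilation_norm \<rho> t \<le> ennreal (t powr v)"
    using dilation_norm_le_powr[OF idx p v(1)] unfolding eventually_at_top_linorder by blast
  obtain n where n: "T < 2 ^ n" using real_arch_pow[of 2 T] by auto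
  define x where "x = 2 powr (v - u)"
  have x: "0 < x" "x < 1" using v powr_less_mono[of "v - u" 0 2] by (auto simp: x_def)
  define B where "B = A * 2 powr (v * (1 + real n))"
  have B: "0 \<le> B" using A by (simp add: B_def)
  define C where "C = 1 + B * (1 / (1 - x))"
  have C: "0 \<le> C" using B x by (simp add: C_def)
  show ?thesis
  proof (rule that[OF C])
    fix g :: "real \<Rightarrow> ennreal" assume g: "antimono g" and fin: "\<rho> g < \<infinity>"
    have gm: "g \<in> borel_measurable halfline" using antimono_measurable_halfline[OF g] .
    have gd: "(\<lambda>s. g (s / 2 ^ k)) \<in> borel_measurable halfline" for k
    proof (rule antimono_measurable_halfline)
      show "antimono (\<lambda>s. g (s / 2 ^ k))" using g by (auto simp: antimono_def divide_right_mono)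
    qed
    define F where "F k s = ennreal (A * 2 powr (- (u * real k))) * g (s / 2 ^ Suc k)" for k s
    have Fm: "F k \<in> borel_measurable halfline" for k
      unfolding F_def[abs_def] using gd[of "Suc k"] by measurable
    have "\<rho> (F k) \<le> ennreal (B * x ^ k) * \<rho> g" for k
    proof -
      have "\<rho> (F k) = ennreal (A * 2 powr (- (u * real k))) * \<rho> (\<lambda>s. g (s / 2 ^ Suc k))"
        unfolding F_def[abs_def] by (rule norm_scale[OF gd]) (simp add: A)
      also have "\<rho> (\<lambda>s. g (s / 2 ^ Suc k)) \<le> \<rho> (\<lambda>s. g (s / 2 ^ (Suc k + n)))"
      proof (rule norm_mono[OF gd gd])
        show "AE s in halfline. g (s / 2 ^ Suc k) \<le> g (s / 2 ^ (Suc k + n))"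
          using AE_halfline_pos
        proof eventually_elim
          case (elim s)
          have "(2::real) ^ Suc k \<le> 2 ^ (Suc k + n)" by (intro power_increasing) auto
          then have "s / 2 ^ (Suc k + n) \<le> s / 2 ^ Suc k"
            using elim by (intro divide_left_mono) auto
          then show ?case using g by (auto simp: antimono_def)
        qed
      qed
      also have "\<rho> (\<lambda>s. g (s / 2 ^ (Suc k + n))) \<le> dilation_norm \<rho> (2 ^ (Suc k + n)) * \<rho> g"
        by (rule norm_dilation_le[OF \<rho> g fin]) simp
      also have "dilation_norm \<rho> (2 ^ (Suc k + n)) \<le> ennreal ((2 ^ (Suc k + n)) powr v)"
      proof (rule T)
        have "(2::real) ^ n \<le> 2 ^ (Suc k + n)" by (intro power_increasing) auto
        then show "T \<le> 2 ^ (Suc k + n)" using n by linarith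
      qed
      finally have "\<rho> (F k) \<le> ennreal (A * 2 powr (- (u * real k))) * (ennreal ((2 ^ (Suc k + n)) powr v) * \<rho> g)"
        by (simp add: mult_left_mono mult_right_mono)
      also have "\<dots> = ennreal (A * 2 powr (- (u * real k)) * (2 ^ (Suc k + n)) powr v) * \<rho> g"
        using A by (simp add: ennreal_mult mult.assoc)
      also have "A * 2 powr (- (u * real k)) * (2 ^ (Suc k + n)) powr v = B * x ^ k"
      proof -
        have "((2::real) ^ (Suc k + n)) powr v = 2 powr (v * (1 + real n) + v * real k)"
          by (simp add: powr_powr powr_realpow[symmetric] algebra_simps del: power_Suc power_Suc2)
        moreover have "x ^ k = 2 powr (v * real k) * 2 powr (- (u * real k))"
          using x by (simp add: x_def powr_powr algebra_simps flip: powr_realpow powr_add)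
        ultimately show ?thesis by (simp add: B_def powr_add)
      qed
      finally show ?thesis .
    qed
    then have "(\<Sum>k. \<rho> (F k)) \<le> (\<Sum>k. ennreal (B * x ^ k) * \<rho> g)" by (intro suminf_le) auto
    also have "\<dots> = (\<Sum>k. ennreal (B * x ^ k)) * \<rho> g" by simp
    also have "(\<Sum>k. ennreal (B * x ^ k)) = ennreal (B * (1 / (1 - x)))"
    proof (rule suminf_ennreal_eq)
      show "(\<lambda>k. B * x ^ k) sums (B * (1 / (1 - x)))"
        using x by (intro sums_mult geometric_sums) auto
    qed (use x B in auto)
    finally have S: "(\<Sum>k. \<rho> (F k)) \<le> ennreal (B * (1 / (1 - x))) * \<rho> g" .
    have "\<rho> (\<lambda>t. g t + (\<Sum>k. F k t)) \<le> \<rho> g + \<rho> (\<lambda>t. \<Sum>k. F k t)"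
      using Fm by (intro norm_triangle gm borel_measurable_suminf_order)
    also have "\<dots> \<le> \<rho> g + ennreal (B * (1 / (1 - x))) * \<rho> g"
      using norm_suminf[OF Fm] S by (meson add_left_mono order_trans)
    also have "\<dots> = ennreal C * \<rho> g"
      using B x by (simp add: C_def ennreal_plus distrib_right)
    finally show "\<rho> (\<lambda>t. g t + (\<Sum>k. ennreal (A * 2 powr (- (u * real k))) * g (t / 2 ^ Suc k))) \<le> ennreal C * \<rho> g"
      by (simp add: F_def)
  qed
qed

section \<open>Boundedness\<close>

lemma (in one_sided_intervals) bounded_on_weighted_space_maximal:
  assumes \<rho>: "banach_function_norm halfline \<rho>" and idx: "has_lower_boyd_index \<rho> p"
    and w: "weight w" and r: "0 < r" "r < p" and C: "0 \<le> C"
    and wt: "weak_type_on_indicators (weighted_measure w) r C"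
  shows "bounded_on_weighted_space \<rho> w (\<lambda>f. maximal (\<lambda>s. ennreal (norm (f s))))"
proof -
  interpret banach_function_norm halfline \<rho> by fact
  let ?\<mu> = "weighted_measure w"
  have p: "0 < p" using r by simp
  have "1 / p < 1 / r" using r by (simp add: field_simps)
  then obtain u where u: "1 / p < u" "u < 1 / r" using dense by blast
  have ur: "u * r < 1" using u(2) r by (simp add: field_simps)
  have s\<mu>: "sets ?\<mu> = sets halfline" by (simp add: weighted_measure_def)
  have sp\<mu>: "space ?\<mu> = {0..}" using sets_eq_imp_space_eq[OF s\<mu>] by simp
  have n\<mu>: "null_sets ?\<mu> \<subseteq> null_sets halfline" by (rule null_sets_weighted_measure[OF w])
  define A where "A = ((C + 1) / (1 - 2 powr (u * r - 1))) powr (1 / r)"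
  have A: "0 \<le> A" by (simp add: A_def)
  obtain K where K: "0 \<le> K" "\<And>g. antimono g \<Longrightarrow> \<rho> g < \<infinity> \<Longrightarrow>
    \<rho> (\<lambda>t. g t + (\<Sum>k. ennreal (A * 2 powr (- (u * real k))) * g (t / 2 ^ Suc k))) \<le> ennreal K * \<rho> g"
    using norm_dilation_series_le[OF \<rho> idx p u(1) A] by blast
  have anti: "antimono (decreasing_rearrangement ?\<mu> f)" for f
    using decreasing_rearrangement_antimono by (auto simp: antimono_def)
  show ?thesis
    unfolding bounded_on_weighted_space_def
  proof (intro exI[of _ K] conjI ballI K(1))
    fix f assume f: "f \<in> weighted_space \<rho> w"
    let ?\<phi> = "\<lambda>s. ennreal (norm (f s))"
    let ?g = "decreasing_rearrangement ?\<mu> ?\<phi>"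
    let ?m = "decreasing_rearrangement ?\<mu> (maximal ?\<phi>)"
    have fm: "f \<in> borel_measurable halfline" and fin: "\<rho> ?g < \<infinity>"
      using f by (auto simp: weighted_space_def weighted_norm_def)
    have \<phi>m: "?\<phi> \<in> borel_measurable halfline" using fm by measurable
    show Mm: "maximal ?\<phi> \<in> borel_measurable halfline" by (rule measurable_maximal[OF \<phi>m])
    let ?G = "\<lambda>t. ?g t + (\<Sum>k. ennreal (A * 2 powr (- (u * real k))) * ?g (t / 2 ^ Suc k))"
    have gd: "(\<lambda>t. ?g (t / 2 ^ k)) \<in> borel_measurable halfline" for k
    proof (rule antimono_measurable_halfline)
      show "antimono (\<lambda>s. ?g (s / 2 ^ k))"
        by (intro antimonoI decreasing_rearrangement_antimono divide_right_mono) auto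
    qed
    have Gm: "?G \<in> borel_measurable halfline"
      by (intro borel_measurable_add borel_measurable_suminf_order borel_measurable_times_ennreal
          borel_measurable_const gd antimono_measurable_halfline anti)
    have "AE t in halfline. ?m t \<le> ?G t"
      using AE_halfline_pos
    proof eventually_elim
      case (elim t)
      show ?case
        using rearrangement_maximal_le[OF s\<mu> n\<mu> wt r(1) C ur \<phi>m elim] by (simp only: A_def)
    qed
    then have "\<rho> ?m \<le> \<rho> ?G"
      by (rule norm_mono[OF Gm antimono_measurable_halfline[OF anti]])
    also have "\<dots> \<le> ennreal K * \<rho> ?g" by (rule K(2)[OF anti fin])
    finally have le: "\<rho> ?m \<le> ennreal K * \<rho> ?g" .
    then show "weighted_norm \<rho> w (maximal ?\<phi>) \<le> ennreal K * weighted_norm \<rho> w ?\<phi>"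
      by (simp add: weighted_norm_def)
    have "ennreal K * \<rho> ?g < \<infinity>" using fin by (simp add: ennreal_mult_less_top)
    then have mfin: "\<rho> ?m < \<infinity>" using le by (rule le_less_trans[rotated])
    let ?Z = "{t \<in> space ?\<mu>. maximal ?\<phi> t = \<infinity>}"
    have Mm': "maximal ?\<phi> \<in> borel_measurable ?\<mu>" using Mm measurable_cong_sets[OF s\<mu> refl] by blast
    have Z: "?Z \<in> sets ?\<mu>" using Mm' by measurable
    have "emeasure ?\<mu> ?Z \<le> ennreal t" if t: "0 < t" for t
    proof -
      have "?m t < \<infinity>" by (rule antimono_norm_finite[OF \<rho> anti mfin t])
      then have "emeasure ?\<mu> ?Z \<le> emeasure ?\<mu> {x \<in> space ?\<mu>. ?m t < maximal ?\<phi> x}"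
        using Mm' by (intro emeasure_mono) auto
      also have "\<dots> \<le> ennreal t"
        using distribution_fun_rearrangement_le[OF Mm', of t] by (simp add: distribution_fun_def)
      finally show ?thesis .
    qed
    then have "emeasure ?\<mu> ?Z \<le> 0 + ennreal e" if "0 < e" for e using that by simp
    then have "emeasure ?\<mu> ?Z \<le> 0" by (rule ennreal_le_epsilon)
    then have "?Z \<in> null_sets ?\<mu>" using Z by (intro null_setsI) auto
    then have "?Z \<in> null_sets halfline" using n\<mu> by blast
    from AE_not_in[OF this] AE_space
    show "AE t in halfline. maximal ?\<phi> t < \<infinity>"
      by eventually_elim (auto simp: sp\<mu> less_top)
  qed
qed

theorem proposition4p1:
  fixes \<rho> :: "(real \<Rightarrow> ennreal) \<Rightarrow> ennreal" and p q :: real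
  assumes "rearrangement_invariant_norm halfline \<rho>"
    and "has_lower_boyd_index \<rho> p" and "1 < p"
    and "has_upper_boyd_index \<rho> q" and "1 < q"
  shows "(\<forall>w\<in>Ap_plus p. bounded_on_weighted_space \<rho> w maximal_plus) \<and>
         (\<forall>w\<in>Ap_minus p. bounded_on_weighted_space \<rho> w maximal_minus)"
proof (intro conjI ballI)
  have \<rho>: "banach_function_norm halfline \<rho>"
    using assms(1) by (rule rearrangement_invariant_norm.axioms(1))
  fix w
  show "bounded_on_weighted_space \<rho> w maximal_plus" if w: "w \<in> Ap_plus p"
  proof -
    obtain r C where "0 < r" "r < p" "0 \<le> C" "plus.weak_type_on_indicators (weighted_measure w) r C"
      by (rule weak_type_plus[OF w assms(3)])
    moreover have "weight w" using w by (simp add: Ap_plus_def)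
    moreover have "maximal_plus = (\<lambda>f. plus.maximal (\<lambda>s. ennreal (norm (f s))))"
      by (intro ext) (simp add: maximal_plus_def plus.maximal_def)
    ultimately show ?thesis
      using plus.bounded_on_weighted_space_maximal[OF \<rho> assms(2)] by simp
  qed
  show "bounded_on_weighted_space \<rho> w maximal_minus" if w: "w \<in> Ap_minus p"
  proof -
    obtain r C where "0 < r" "r < p" "0 \<le> C" "minus.weak_type_on_indicators (weighted_measure w) r C"
      by (rule weak_type_minus[OF w assms(3)])
    moreover have "weight w" using w by (simp add: Ap_minus_def)
    moreover have "maximal_minus = (\<lambda>f. minus.maximal (\<lambda>s. ennreal (norm (f s))))"
      by (intro ext) (simp add: maximal_minus_def minus.maximal_def)
    ultimately show ?thesis
      using minus.bounded_on_weighted_space_maximal[OF \<rho> assms(2)] by simp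
  qed
qed

end
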